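(* Let $\overrightarrow F\subseteq F$ be Jones' subgroup of R. Thompson's group $F$, i.e. the set of all reduced diagrams $\Delta$ in $F$ whose Thompson graph $T(\Delta)$ is bipartite. Then $\overrightarrow F$ is generated by the elements $x_0x_1,\ x_1x_2,\ x_2x_3$, where $x_i$ ($i\ge 0$) are the standard generators of $F$. Moreover, $\overrightarrow F$ is isomorphic to $F_3$, and $\overrightarrow F$ coincides with the smallest subgroup of $F$ which contains $x_0x_1$ and is closed under the addition $\oplus$.
   Context: $F$ is the group of all piecewise-linear increasing homeomorphisms of $[0,1]$ with all slopes powers of $2$ and all break points of the derivative dyadic fractions; products are composed from left to right: $(gh)(t)=h(g(t))$. Standard generators: $x_0(t)=2t$ on $[0,\frac14]$, $t+\frac14$ on $[\frac14,\frac12]$, $\frac t2+\frac12$ on $[\frac12,1]$; $x_1(t)=t$ on $[0,\frac12]$, $2t-\frac12$ on $[\frac12,\frac58]$, $t+\frac18$ on $[\frac58,\frac34]$, $\frac t2+\frac12$ on $[\frac34,1]$; and $x_{i+1}=x_0^{-i}x_1x_0^{i}$ for $i\ge1$. Addition on $F$: $(a\oplus b)(t)=\frac{a(2t)}2$ for $t\in[0,\frac12]$ and $(a\oplus b)(t)=\frac{b(2t-1)}2+\frac12$ for $t\in[\frac12,1]$. $F_n$ ($n\ge2$) is the group of all piecewise-linear increasing homeomorphisms of $[0,1]$ with all slopes powers of $n$ and all breaks of the derivative at $n$-adic fractions $\frac a{n^k}$. Diagrams: the cell $\pi$ is the plane directed graph whose top path is one edge and whose bottom path consists of two edges, with the same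 initial and terminal vertices (all edges are directed left to right). Diagrams over $\langle x\mid x=x^2\rangle$ are the plane graphs (up to isotopy) obtained from the single edge $\mathbf 1$ and from $\pi$ by addition $\Delta_1+\Delta_2$ (identify the terminal vertex of $\Delta_1$ with the initial vertex of $\Delta_2$), multiplication $\Delta_1\circ\Delta_2$ (identify the bottom path of $\Delta_1$ with the top path of $\Delta_2$ when they have the same length), and inversion (reflection in a horizontal line). A diagram $\Delta$ has an initial vertex $\iota(\Delta)$ and a terminal vertex $\tau(\Delta)$; the other vertices are called inner. A dipole is a subdiagram $\pi\circ\pi^{-1}$ or $\pi^{-1}\circ\pi$; it is eliminated by removing its two cells and identifying its top and bottom paths. A diagram is reduced if it has no dipoles; each diagram is equivalent via dipole moves to a unique reduced diagram. "Diagrams in $F$" are those whose top path and bottom path are single edges; reduced such diagrams, with product = reduced form of $\Delta_1\circ\Delta_2$, form a group identified with $F$ as follows. A reduced $\Delta$ is cut by its longest positive path from $\iota(\Delta)$ to $\tau(\Delta)$ as $\Delta=\Delta^+\circ\Delta^-$, where $\Delta^+$ consists of cells $\pi$ and $\Delta^-$ of cells $\pi^{-1}$. Assign $[0,1]$ to the top edge of $\Delta^+$ and, for each cell, the left and right halves of the interval of its top edge to its left and right bottom edges; the bottom path of $\Delta^+$ gives a dyadic subdivision of $[0,1]$ (top subdivision). Doing the same with $(\Delta^-)^{-1}$ gives the bottom subdivision. $\Delta$ corresponds to the homeomorphism mapping each segment of the top subdivision linearly onto the corresponding segment of the bottom subdivision. Thompson graph $T(\Delta)$: its vertices are all vertices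 of $\Delta$ except $\tau(\Delta)$; its edges are, for every inner vertex $v$ of $\Delta$, the top-most incoming edge of $v$ in $\Delta$ (upper edge) and the bottom-most incoming edge of $v$ in $\Delta$ (lower edge), counted as two distinct edges if they coincide. *)

theory Defs
  imports
    "HOL-Analysis.Analysis"
    "HOL-Algebra.Generated_Groups"
    "Graph_Theory.Digraph"
begin

section \<open>The groups $F_n$ and $F = F_2$\<close>

definition adic_fraction :: "nat \<Rightarrow> real \<Rightarrow> bool" where
  "adic_fraction n x \<longleftrightarrow> (\<exists>(a::int) (k::nat). x = of_int a / real n ^ k)"

text \<open>The subdivision \<open>t 0 < \<dots> < t m\<close> may be finer than the set of breaks of the derivative.\<close>

definition adic_piecewise_linear :: "nat \<Rightarrow> (real \<Rightarrow> real) \<Rightarrow> bool" where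
  "adic_piecewise_linear n f \<longleftrightarrow>
    (\<exists>(m::nat) (t::nat \<Rightarrow> real).
       t 0 = 0 \<and> t m = 1 \<and>
       (\<forall>i<m. t i < t (Suc i)) \<and>
       (\<forall>i\<le>m. adic_fraction n (t i)) \<and>
       (\<forall>i<m. \<exists>(k::int) (c::real). \<forall>x\<in>{t i..t (Suc i)}. f x = real n powi k * x + c))"

text \<open>
  Elements are functions with value \<open>undefined\<close> outside the unit interval, so that equality in
  the group is equality on \<open>{0..1}\<close>.  Products are composed from left to right.
\<close>

definition thompson_group :: "nat \<Rightarrow> (real \<Rightarrow> real) monoid" where
  "thompson_group n =
    \<lparr> carrier = {f \<in> extensional {0..1}.
        (\<exists>g. homeomorphism {0..1} {0..1} f g) \<and> strict_mono_on {0..1} f \<and>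
        adic_piecewise_linear n f},
      monoid.mult = (\<lambda>g h. compose {0..1} h g),
      one = (\<lambda>t\<in>{0..1}. t) \<rparr>"

abbreviation thompson_F :: "(real \<Rightarrow> real) monoid" where
  "thompson_F \<equiv> thompson_group 2"

definition thompson_x0 :: "real \<Rightarrow> real" where
  "thompson_x0 = (\<lambda>t\<in>{0..1}.
     if t \<le> 1/4 then 2 * t
     else if t \<le> 1/2 then t + 1/4
     else t / 2 + 1/2)"

definition thompson_x1 :: "real \<Rightarrow> real" where
  "thompson_x1 = (\<lambda>t\<in>{0..1}.
     if t \<le> 1/2 then t
     else if t \<le> 5/8 then 2 * t - 1/2
     else if t \<le> 3/4 then t + 1/8
     else t / 2 + 1/2)"

fun thompson_x :: "nat \<Rightarrow> real \<Rightarrow> real" where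
  "thompson_x 0 = thompson_x0"
| "thompson_x (Suc 0) = thompson_x1"
| "thompson_x (Suc (Suc i)) =
     inv\<^bsub>thompson_F\<^esub> (thompson_x0 [^]\<^bsub>thompson_F\<^esub> Suc i)
       \<otimes>\<^bsub>thompson_F\<^esub> thompson_x1 \<otimes>\<^bsub>thompson_F\<^esub> (thompson_x0 [^]\<^bsub>thompson_F\<^esub> Suc i)"

definition thompson_sum :: "(real \<Rightarrow> real) \<Rightarrow> (real \<Rightarrow> real) \<Rightarrow> real \<Rightarrow> real" where
  "thompson_sum a b = (\<lambda>t\<in>{0..1}.
     if t \<le> 1/2 then a (2 * t) / 2 else b (2 * t - 1) / 2 + 1/2)"

definition sum_closed :: "(real \<Rightarrow> real) set \<Rightarrow> bool" where
  "sum_closed H \<longleftrightarrow> (\<forall>a\<in>H. \<forall>b\<in>H. thompson_sum a b \<in> H)"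


section \<open>Diagrams over $\langle x \mid x = x^2\rangle$\<close>

text \<open>
  An edge carries its end points; the name distinguishes parallel edges.  A path is the list of
  its edges.  The plane embedding is recorded, up to isotopy, by the top and bottom paths of each
  cell and of the whole diagram: a cell is the pair of its top and bottom path, so that a copy of
  $\pi$ is \<open>([e], [a, b])\<close> and a copy of $\pi^{-1}$ is \<open>([a, b], [e])\<close>.
\<close>

datatype edge = Edge (source: nat) (name: nat) (target: nat)

type_synonym path = "edge list"
type_synonym cell = "path \<times> path"

record prediagram =
  edges :: "edge set"
  cells :: "cell set"
  top_path :: path
  bot_path :: path

definition path_verts :: "path \<Rightarrow> nat set" where
  "path_verts p = source ` set p \<union> target ` set p"

definition dverts :: "prediagram \<Rightarrow> nat set" where
  "dverts D = source ` edges D \<union> target ` edges D"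

definition init_vert :: "prediagram \<Rightarrow> nat" where
  "init_vert D = source (hd (top_path D))"

definition term_vert :: "prediagram \<Rightarrow> nat" where
  "term_vert D = target (last (top_path D))"

definition inner_verts :: "prediagram \<Rightarrow> nat set" where
  "inner_verts D = dverts D - {init_vert D, term_vert D}"

definition edge_diagram :: "edge \<Rightarrow> prediagram" where
  "edge_diagram e = \<lparr>edges = {e}, cells = {}, top_path = [e], bot_path = [e]\<rparr>"

definition pi_diagram :: "edge \<Rightarrow> edge \<Rightarrow> edge \<Rightarrow> prediagram" where
  "pi_diagram e a b =
    \<lparr>edges = {e, a, b}, cells = {([e], [a, b])}, top_path = [e], bot_path = [a, b]\<rparr>"

definition diagram_sum :: "prediagram \<Rightarrow> prediagram \<Rightarrow> prediagram" where
  "diagram_sum D1 D2 =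
    \<lparr>edges = edges D1 \<union> edges D2, cells = cells D1 \<union> cells D2,
     top_path = top_path D1 @ top_path D2, bot_path = bot_path D1 @ bot_path D2\<rparr>"

definition diagram_comp :: "prediagram \<Rightarrow> prediagram \<Rightarrow> prediagram" where
  "diagram_comp D1 D2 =
    \<lparr>edges = edges D1 \<union> edges D2, cells = cells D1 \<union> cells D2,
     top_path = top_path D1, bot_path = bot_path D2\<rparr>"

definition diagram_inv :: "prediagram \<Rightarrow> prediagram" where
  "diagram_inv D =
    \<lparr>edges = edges D, cells = (\<lambda>(p, q). (q, p)) ` cells D,
     top_path = bot_path D, bot_path = top_path D\<rparr>"

text \<open>
  Identifications are expressed by choosing representatives that share exactly the vertices and
  edges to be identified; any two diagrams can be renamed so as to meet the side conditions.
  Membership in the inductive set is closed under injective renaming.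
\<close>

definition summable_diagrams :: "prediagram \<Rightarrow> prediagram \<Rightarrow> bool" where
  "summable_diagrams D1 D2 \<longleftrightarrow>
     term_vert D1 = init_vert D2 \<and> dverts D1 \<inter> dverts D2 = {term_vert D1}"

definition composable_diagrams :: "prediagram \<Rightarrow> prediagram \<Rightarrow> bool" where
  "composable_diagrams D1 D2 \<longleftrightarrow>
     bot_path D1 = top_path D2 \<and>
     edges D1 \<inter> edges D2 = set (bot_path D1) \<and>
     dverts D1 \<inter> dverts D2 = path_verts (bot_path D1)"

inductive diagram :: "prediagram \<Rightarrow> bool" where
  diagram_edge: "u \<noteq> v \<Longrightarrow> diagram (edge_diagram (Edge u i v))"
| diagram_pi: "distinct [u, w, v] \<Longrightarrow> diagram (pi_diagram (Edge u i v) (Edge u j w) (Edge w k v))"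
| diagram_sum: "diagram D1 \<Longrightarrow> diagram D2 \<Longrightarrow> summable_diagrams D1 D2 \<Longrightarrow>
    diagram (diagram_sum D1 D2)"
| diagram_comp: "diagram D1 \<Longrightarrow> diagram D2 \<Longrightarrow> composable_diagrams D1 D2 \<Longrightarrow>
    diagram (diagram_comp D1 D2)"
| diagram_inv: "diagram D \<Longrightarrow> diagram (diagram_inv D)"

text \<open>
  Two cells sharing the bottom path of the first and the top path of the second are necessarily
  a \<open>\<pi>\<close>-cell and a \<open>\<pi>\<inverse>\<close>-cell, in one of the two orders.
\<close>

definition reduced :: "prediagram \<Rightarrow> bool" where
  "reduced D \<longleftrightarrow> \<not> (\<exists>p q r. (p, q) \<in> cells D \<and> (q, r) \<in> cells D)"

definition diagram_in_F :: "prediagram \<Rightarrow> bool" where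
  "diagram_in_F D \<longleftrightarrow> diagram D \<and> length (top_path D) = 1 \<and> length (bot_path D) = 1"


section \<open>The homeomorphism of a reduced diagram in $F$\<close>

definition positive_path :: "prediagram \<Rightarrow> path \<Rightarrow> bool" where
  "positive_path D p \<longleftrightarrow>
     p \<noteq> [] \<and> set p \<subseteq> edges D \<and> successively (\<lambda>d e. target d = source e) p \<and>
     source (hd p) = init_vert D \<and> target (last p) = term_vert D"

definition longest_positive_path :: "prediagram \<Rightarrow> path \<Rightarrow> bool" where
  "longest_positive_path D p \<longleftrightarrow>
     positive_path D p \<and> (\<forall>q. positive_path D q \<longrightarrow> length q \<le> length p)"

definition pi_cell :: "cell \<Rightarrow> bool" where
  "pi_cell c \<longleftrightarrow> length (fst c) = 1 \<and> length (snd c) = 2"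

definition cut_diagram :: "prediagram \<Rightarrow> prediagram \<Rightarrow> prediagram \<Rightarrow> bool" where
  "cut_diagram D Dp Dn \<longleftrightarrow>
     diagram Dp \<and> diagram Dn \<and> composable_diagrams Dp Dn \<and> D = diagram_comp Dp Dn \<and>
     longest_positive_path D (bot_path Dp) \<and>
     (\<forall>c\<in>cells Dp. pi_cell c) \<and> (\<forall>c\<in>cells (diagram_inv Dn). pi_cell c)"

text \<open>A pair \<open>(l, r)\<close> stands for the interval \<open>{l..r}\<close>.\<close>

definition interval_assignment :: "prediagram \<Rightarrow> (edge \<Rightarrow> real \<times> real) \<Rightarrow> bool" where
  "interval_assignment D I \<longleftrightarrow>
     I (hd (top_path D)) = (0, 1) \<and>
     (\<forall>e a b l r. ([e], [a, b]) \<in> cells D \<and> I e = (l, r) \<longrightarrow>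
        I a = (l, (l + r) / 2) \<and> I b = ((l + r) / 2, r))"

definition maps_linearly :: "(real \<Rightarrow> real) \<Rightarrow> real \<times> real \<Rightarrow> real \<times> real \<Rightarrow> bool" where
  "maps_linearly f J K \<longleftrightarrow>
     (\<forall>x\<in>{fst J..snd J}. f x = fst K + (snd K - fst K) / (snd J - fst J) * (x - fst J))"

definition corresponds :: "prediagram \<Rightarrow> (real \<Rightarrow> real) \<Rightarrow> bool" where
  "corresponds D f \<longleftrightarrow>
     (\<exists>Dp Dn I J. cut_diagram D Dp Dn \<and>
        interval_assignment Dp I \<and> interval_assignment (diagram_inv Dn) J \<and>
        (\<forall>e\<in>set (bot_path Dp). maps_linearly f (I e) (J e)))"


section \<open>Thompson graphs and Jones' subgroup\<close>

text \<open>
  Two incoming edges of a vertex \<open>v\<close> are vertically adjacent iff they are the last edges of the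
  top and the bottom path of a cell with terminal vertex \<open>v\<close>.
\<close>

definition weakly_above :: "prediagram \<Rightarrow> (edge \<times> edge) set" where
  "weakly_above D = {(last p, last q) | p q. (p, q) \<in> cells D}\<^sup>*"

definition incoming :: "prediagram \<Rightarrow> nat \<Rightarrow> edge set" where
  "incoming D v = {e \<in> edges D. target e = v}"

definition topmost_incoming :: "prediagram \<Rightarrow> nat \<Rightarrow> edge \<Rightarrow> bool" where
  "topmost_incoming D v e \<longleftrightarrow>
     e \<in> incoming D v \<and> (\<forall>d\<in>incoming D v. (e, d) \<in> weakly_above D)"

definition bottommost_incoming :: "prediagram \<Rightarrow> nat \<Rightarrow> edge \<Rightarrow> bool" where
  "bottommost_incoming D v e \<longleftrightarrow>
     e \<in> incoming D v \<and> (\<forall>d\<in>incoming D v. (d, e) \<in> weakly_above D)"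

datatype side = Upper | Lower

text \<open>
  The orientation inherited from the diagram is kept, but it is irrelevant for bipartiteness.
  The tag keeps the upper and the lower edge of a vertex apart if they come from the same edge.
\<close>

definition thompson_graph :: "prediagram \<Rightarrow> (nat, side \<times> edge) pre_digraph" where
  "thompson_graph D =
    \<lparr> verts = dverts D - {term_vert D},
      arcs = {(Upper, e) | e v. v \<in> inner_verts D \<and> topmost_incoming D v e} \<union>
             {(Lower, e) | e v. v \<in> inner_verts D \<and> bottommost_incoming D v e},
      tail = (\<lambda>(s, e). source e),
      head = (\<lambda>(s, e). target e) \<rparr>"

definition bipartite :: "('v, 'e) pre_digraph \<Rightarrow> bool" where
  "bipartite G \<longleftrightarrow>
     (\<exists>A B. verts G = A \<union> B \<and> A \<inter> B = {} \<and>
        (\<forall>e\<in>arcs G. tail G e \<in> A \<and> head G e \<in> B \<or> tail G e \<in> B \<and> head G e \<in> A))"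

definition jones_subgroup :: "(real \<Rightarrow> real) set" where
  "jones_subgroup =
    {f \<in> carrier thompson_F.
       \<exists>D. diagram_in_F D \<and> reduced D \<and> corresponds D f \<and> bipartite (thompson_graph D)}"

end

theory Submission
  imports Defs
begin

text \<open>
Call a dyadic fraction odd if its binary expansion has an odd number of digits 1.  The proof rests
on one description of Jones' subgroup: it is the stabilizer in $F$ of the set of odd dyadic
fractions (\<open>jones_subgroup_eq\<close>).

Let $\Delta = \Delta^+ \circ \Delta^-$.  Every inner vertex $v$ is created by exactly one cell of
$\Delta^+$, which halves an interval $[a/2^k, (a+1)/2^k]$.  The top-most edge entering $v$ is the
left lower edge of that cell, so the upper edge of $v$ in $T(\Delta)$ joins the midpoint
$(2a+1)/2^{k+1}$ to the left end $a/2^k$, and passing from $a$ to $2a+1$ appends one digit 1.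
Hence a 2-colouring along the upper edges must be the parity of the digit sum at the points of the
top subdivision; along the lower edges it must be the parity at the points of the bottom
subdivision.  So $T(\Delta)$ is bipartite iff corresponding division points have the same parity,
and since the homeomorphism is linear between dyadic intervals, this means that it preserves the
parity of all dyadic fractions.  For the converse direction an element of the stabilizer is
written by a pair of binary trees with as few leaves as possible; the diagram glued from the two
trees is then reduced.

\<^bold>\<open>Generators.\<close>  Halving an interval whose left end has parity $p$ gives left ends of
parity $p, 1-p$; halving the right half again gives $p, 1-p, p$.  So the left ends of the leaves
of a tree that is built from such ternary carets have alternating parities, and conversely a tree
with an odd number of leaves and alternating parities is built from ternary carets
(\<open>alternates_ternary\<close>).  An element of the stabilizer maps a fine ternary subdivision to a
subdivision with alternating parities, hence to a ternary one.  The element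
$y_i = x_i x_{i+1}$ opens a ternary caret that hangs at position $i$ of a right comb, so products
of these elements carry every ternary tree to a comb (\<open>ternary_to_vine\<close>).  Therefore the
$y_i$ generate the stabilizer, and $y_j y_0 = y_0 y_{j+2}$ for $j \ge 1$ leaves only
$y_0, y_1, y_2$.

\<^bold>\<open>Addition.\<close>  Since $x_{i+1} = 1 \oplus x_i$, also $y_{i+1} = 1 \oplus y_i$.  Thus a subgroup
that is closed under addition and contains $y_0$ contains all $y_i$, and the stabilizer is itself
closed under addition.

\<^bold>\<open>Isomorphism with $F_3$.\<close>  Let $\varphi$ be the increasing homeomorphism of $[0,1]$ that
sends the subdivision into thirds to the subdivision at $\frac12, \frac34$, and so on recursively
in each piece.  As 3 is odd, $\varphi(t/3^k)$ is odd exactly if the integer $t$ is.  Conjugation by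
$\varphi$ is the isomorphism.  It sends $F_3$ into the stabilizer, because elements of $F_3$
preserve the parity of the numerators of triadic fractions.  It is onto, because each dyadic
interval is either the image of a triadic interval, and then its ends have different parities, or
the right half of such an image, and then its ends have equal parities
(\<open>dyadic_cylinder\<close>); an element of the stabilizer preserves this difference.
\<close>

section \<open>Parity of binary digit sums\<close>

text \<open>
  This is the Thue--Morse sequence.
\<close>

fun odd_ones :: "nat \<Rightarrow> bool" where
  "odd_ones n = (if n = 0 then False else odd n \<noteq> odd_ones (n div 2))"

declare odd_ones.simps [simp del]

lemma odd_ones_0 [simp]: "\<not> odd_ones 0"
  by (simp add: odd_ones.simps)

lemma odd_ones_double [simp]: "odd_ones (2 * n) = odd_ones n"
  by (cases "n = 0") (simp_all add: odd_ones.simps [of "2 * n"])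

lemma odd_ones_Suc_double [simp]: "odd_ones (Suc (2 * n)) = (\<not> odd_ones n)"
  by (simp add: odd_ones.simps [of "Suc (2 * n)"])

text \<open>
  The binary expansion of $a 2^j + b$ is that of $a$ followed by that of $b$, padded to length
  $j$.
\<close>

lemma odd_ones_concat:
  assumes "b < 2 ^ j"
  shows "odd_ones (a * 2 ^ j + b) = (odd_ones a \<noteq> odd_ones b)"
  using assms
proof (induction j arbitrary: b)
  case (Suc j)
  obtain c where c: "b = 2 * c \<or> b = Suc (2 * c)"
    by (metis oddE Suc_eq_plus1 evenE)
  have lt: "c < 2 ^ j" using Suc.prems c by auto
  have e: "a * 2 ^ Suc j + 2 * c = 2 * (a * 2 ^ j + c)"
    and o: "a * 2 ^ Suc j + Suc (2 * c) = Suc (2 * (a * 2 ^ j + c))" by auto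
  show ?case using c Suc.IH[OF lt] e o by (metis odd_ones_Suc_double odd_ones_double)
qed auto

lemma odd_ones_shift [simp]: "odd_ones (a * 2 ^ j) = odd_ones a"
  using odd_ones_concat [of 0 j a] by simp

definition odd_dyadics :: "real set" where
  "odd_dyadics = {real a / 2 ^ k | a k. odd_ones a}"

lemma odd_dyadics_iff [simp]: "real a / 2 ^ k \<in> odd_dyadics \<longleftrightarrow> odd_ones a"
proof -
  have "odd_ones a" if "odd_ones b" "real a / 2 ^ k = real b / 2 ^ j" for b j
  proof -
    have "real (a * 2 ^ j) = real (b * 2 ^ k)" using that(2) by (simp add: field_simps)
    then have "a * 2 ^ j = b * 2 ^ k" by (simp only: of_nat_eq_iff)
    then show ?thesis using that(1) by (metis odd_ones_shift)
  qed
  then show ?thesis unfolding odd_dyadics_def by blast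
qed

lemma odd_dyadics_concat:
  assumes "b < 2 ^ j"
  shows "(real a + real b / 2 ^ j) / 2 ^ k \<in> odd_dyadics \<longleftrightarrow> odd_ones a \<noteq> odd_ones b"
proof -
  have "(real a + real b / 2 ^ j) / 2 ^ k = real (a * 2 ^ j + b) / 2 ^ (j + k)"
    by (simp add: field_simps power_add)
  then show ?thesis using odd_ones_concat[OF assms] by (simp only: odd_dyadics_iff)
qed

text \<open>
  A map that is linear from one dyadic interval onto another keeps the relative offset $y$ from
  the left end. Only the digits of $a$ and $b$ in front of those of $y$ change, which is why the
  parities at the left ends decide about all points of the interval.
\<close>

lemma odd_dyadics_same_offset:
  assumes y: "0 \<le> y" "y < 1" and ab: "odd_ones a = odd_ones b"
  shows "(real a + y) / 2 ^ k \<in> odd_dyadics \<longleftrightarrow> (real b + y) / 2 ^ m \<in> odd_dyadics"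
proof -
  have *: "\<exists>c j. y = real c / 2 ^ j \<and> c < 2 ^ j" if "(real d + y) / 2 ^ l \<in> odd_dyadics" for d l
  proof -
    obtain c j where cj: "(real d + y) / 2 ^ l = real c / 2 ^ j"
      using \<open>_ \<in> odd_dyadics\<close> unfolding odd_dyadics_def by blast
    then have e: "y * 2 ^ j = real (c * 2 ^ l) - real (d * 2 ^ j)" by (simp add: field_simps)
    moreover have "0 \<le> y * 2 ^ j" using y by simp
    ultimately have "real (d * 2 ^ j) \<le> real (c * 2 ^ l)" by linarith
    then have le: "d * 2 ^ j \<le> c * 2 ^ l" by (simp only: of_nat_le_iff)
    then have e': "y * 2 ^ j = real (c * 2 ^ l - d * 2 ^ j)" using e by (simp only: of_nat_diff)
    have "y * 2 ^ j < 2 ^ j" using y by simp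
    then have "real (c * 2 ^ l - d * 2 ^ j) < real (2 ^ j)" using e' by simp
    then have "c * 2 ^ l - d * 2 ^ j < 2 ^ j" by (simp only: of_nat_less_iff)
    then show ?thesis using e'
      by (intro exI[of _ "c * 2 ^ l - d * 2 ^ j"] exI[of _ j]) (simp add: field_simps)
  qed
  show ?thesis
  proof (cases "\<exists>c j. y = real c / 2 ^ j \<and> c < 2 ^ j")
    case True
    then show ?thesis using odd_dyadics_concat ab by blast
  next
    case False
    then show ?thesis using * by blast
  qed
qed

section \<open>Adic intervals\<close>

definition adic_interval :: "nat \<Rightarrow> nat \<Rightarrow> nat \<Rightarrow> real \<times> real" where
  "adic_interval n k a = (real a / real n ^ k, (real a + 1) / real n ^ k)"

lemma fst_adic_interval [simp]: "fst (adic_interval n k a) = real a / real n ^ k"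
  and snd_adic_interval [simp]: "snd (adic_interval n k a) = (real a + 1) / real n ^ k"
  by (simp_all add: adic_interval_def)

lemma adic_interval_less: "n > 0 \<Longrightarrow> fst (adic_interval n k a) < snd (adic_interval n k a)"
  by (simp add: divide_strict_right_mono)

lemma affine_into:
  fixes l r :: real
  assumes "l \<le> r" "x \<in> {0..1}"
  shows "l + (r - l) * x \<in> {l..r}"
  using assms mult_left_le[of x "r - l"] mult_nonneg_nonneg[of "r - l" x] by simp

lemma maps_linearly_iff:
  assumes "l < r"
  shows "maps_linearly f (l, r) (l', r') \<longleftrightarrow>
    (\<forall>x\<in>{0..1}. f (l + (r - l) * x) = l' + (r' - l') * x)"
proof
  assume f: "maps_linearly f (l, r) (l', r')"
  show "\<forall>x\<in>{0..1}. f (l + (r - l) * x) = l' + (r' - l') * x"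
  proof
    fix x :: real assume x: "x \<in> {0..1}"
    have "l + (r - l) * x \<in> {l..r}" using affine_into x assms by simp
    then show "f (l + (r - l) * x) = l' + (r' - l') * x"
      using f assms by (simp add: maps_linearly_def)
  qed
next
  assume f: "\<forall>x\<in>{0..1}. f (l + (r - l) * x) = l' + (r' - l') * x"
  show "maps_linearly f (l, r) (l', r')"
    unfolding maps_linearly_def
  proof
    fix x assume "x \<in> {fst (l, r)..snd (l, r)}"
    then have "(x - l) / (r - l) \<in> {0..1}" using assms by (simp add: divide_simps)
    from f[rule_format, OF this] show "f x = fst (l', r') + (snd (l', r') - fst (l', r')) / (snd (l, r) - fst (l, r)) * (x - fst (l, r))"
      using assms by simp
  qed
qed

lemma maps_linearly_ends:
  assumes "maps_linearly f J K" "fst J < snd J"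
  shows "f (fst J) = fst K" "f (snd J) = snd K"
  using assms by (simp_all add: maps_linearly_def)

lemma maps_linearly_adic:
  assumes "n > 0"
  shows "maps_linearly f (adic_interval n k a) (adic_interval n m b) \<longleftrightarrow>
    (\<forall>x\<in>{0..1}. f ((real a + x) / real n ^ k) = (real b + x) / real n ^ m)"
proof -
  have "real a / real n ^ k + ((real a + 1) / real n ^ k - real a / real n ^ k) * x = (real a + x) / real n ^ k" for a k x
    by (simp add: add_divide_distrib)
  moreover have "real a / real n ^ k < (real a + 1) / real n ^ k"
    using assms by (simp add: divide_strict_right_mono)
  ultimately show ?thesis unfolding adic_interval_def by (simp add: maps_linearly_iff)
qed

lemma maps_linearly_cong:
  "maps_linearly f J K \<Longrightarrow> (\<And>x. x \<in> {fst J..snd J} \<Longrightarrow> f x = g x) \<Longrightarrow> maps_linearly g J K"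
  by (simp add: maps_linearly_def)

lemma maps_linearly_comp:
  assumes "maps_linearly f J K" "maps_linearly g K L" "fst J < snd J" "fst K < snd K"
  shows "maps_linearly (\<lambda>x. g (f x)) J L"
proof -
  obtain l r l' r' l'' r'' where "J = (l, r)" "K = (l', r')" "L = (l'', r'')" by (metis prod.exhaust)
  then show ?thesis using assms by (simp add: maps_linearly_iff)
qed

lemma maps_linearly_inverse:
  assumes "maps_linearly f J K" "fst J < snd J" "fst K < snd K"
    and "\<And>x. x \<in> {fst J..snd J} \<Longrightarrow> g (f x) = x"
  shows "maps_linearly g K J"
proof -
  obtain l r l' r' where JK: "J = (l, r)" "K = (l', r')" by fastforce
  have "g (l' + (r' - l') * x) = l + (r - l) * x" if x: "x \<in> {0..1}" for x
  proof -
    have "f (l + (r - l) * x) = l' + (r' - l') * x" using assms x JK by (simp add: maps_linearly_iff)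
    moreover have "l + (r - l) * x \<in> {l..r}" using affine_into x assms JK by simp
    ultimately show ?thesis using assms(4)[of "l + (r - l) * x"] JK by simp
  qed
  then show ?thesis using assms JK by (simp add: maps_linearly_iff)
qed

lemma maps_linearly_halves:
  assumes "l < r"
  shows "maps_linearly f (l, r) (l', r') \<longleftrightarrow>
    maps_linearly f (l, (l + r) / 2) (l', (l' + r') / 2) \<and>
    maps_linearly f ((l + r) / 2, r) ((l' + r') / 2, r')" (is "?A \<longleftrightarrow> ?B \<and> ?C")
proof -
  have lr: "l < (l + r) / 2" "(l + r) / 2 < r" using assms by auto
  have half1: "a + ((a + b) / 2 - a) * x = a + (b - a) * (x / 2)" for a b x :: real
    by (simp add: field_simps)
  have half2: "(a + b) / 2 + (b - (a + b) / 2) * x = a + (b - a) * ((1 + x) / 2)" for a b x :: real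
    by (simp add: field_simps)
  have B: "?B \<longleftrightarrow> (\<forall>x\<in>{0..1}. f (l + (r - l) * (x / 2)) = l' + (r' - l') * (x / 2))"
    unfolding maps_linearly_iff[OF lr(1)] half1 ..
  have C: "?C \<longleftrightarrow> (\<forall>x\<in>{0..1}. f (l + (r - l) * ((1 + x) / 2)) = l' + (r' - l') * ((1 + x) / 2))"
    unfolding maps_linearly_iff[OF lr(2)] half2 ..
  have A: "?A \<longleftrightarrow> (\<forall>x\<in>{0..1}. f (l + (r - l) * x) = l' + (r' - l') * x)"
    using assms by (simp add: maps_linearly_iff)
  show ?thesis
  proof
    assume ?A
    then have a: "f (l + (r - l) * x) = l' + (r' - l') * x" if "x \<in> {0..1}" for x
      using that unfolding A by blast
    show "?B \<and> ?C" unfolding B C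
      by (intro conjI ballI a) (auto simp: field_simps)
  next
    assume bc: "?B \<and> ?C"
    show ?A unfolding A
    proof
      fix x :: real assume x: "x \<in> {0..1}"
      show "f (l + (r - l) * x) = l' + (r' - l') * x"
      proof (cases "x \<le> 1 / 2")
        case True
        then have "2 * x \<in> {0..1}" using x by auto
        with bc B have "f (l + (r - l) * ((2 * x) / 2)) = l' + (r' - l') * ((2 * x) / 2)" by blast
        then show ?thesis by simp
      next
        case False
        then have "2 * x - 1 \<in> {0..1}" using x by auto
        with bc C have "f (l + (r - l) * ((1 + (2 * x - 1)) / 2)) = l' + (r' - l') * ((1 + (2 * x - 1)) / 2)" by blast
        then show ?thesis by simp
      qed
    qed
  qed
qed

lemma maps_linearly_sub:
  assumes n: "n > 0" and f: "maps_linearly f (adic_interval n j c) (adic_interval n m b)" and d: "d < n ^ i"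
  shows "maps_linearly f (adic_interval n (j + i) (c * n ^ i + d)) (adic_interval n (m + i) (b * n ^ i + d))"
  unfolding maps_linearly_adic[OF n]
proof
  fix x :: real assume x: "x \<in> {0..1}"
  have "real (Suc d) \<le> real (n ^ i)" using d by (simp only: of_nat_le_iff)
  then have "(real d + x) / real n ^ i \<in> {0..1}" using x n by (simp add: divide_simps)
  then have "f ((real c + (real d + x) / real n ^ i) / real n ^ j) = (real b + (real d + x) / real n ^ i) / real n ^ m"
    using f unfolding maps_linearly_adic[OF n] by blast
  moreover have "(real e + (real d + x) / real n ^ i) / real n ^ k = (real (e * n ^ i + d) + x) / real n ^ (k + i)" for e k
    using n by (simp add: field_simps power_add)
  ultimately show "f ((real (c * n ^ i + d) + x) / real n ^ (j + i)) = (real (b * n ^ i + d) + x) / real n ^ (m + i)"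
    by simp
qed

lemma adic_interval_nested:
  assumes n: "n > 0" and jk: "j \<le> k"
    and "real c / real n ^ j \<le> real a / real n ^ k" "real a / real n ^ k < (real c + 1) / real n ^ j"
  obtains d where "d < n ^ (k - j)" "a = c * n ^ (k - j) + d"
proof -
  have p: "real n ^ k = real n ^ j * real n ^ (k - j)" using jk by (simp flip: power_add)
  have "real c * real n ^ (k - j) \<le> real a" "real a < (real c + 1) * real n ^ (k - j)"
    using assms unfolding p by (simp_all add: divide_simps)
  then have "real (c * n ^ (k - j)) \<le> real a" "real a < real ((c + 1) * n ^ (k - j))" by (simp_all add: algebra_simps)
  then have "c * n ^ (k - j) \<le> a" "a < (c + 1) * n ^ (k - j)" by (simp_all only: of_nat_le_iff of_nat_less_iff)
  then show ?thesis by (intro that[of "a - c * n ^ (k - j)"]) auto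
qed

section \<open>Chains of intervals\<close>

text \<open>
  The intervals of a chain have positive length. This makes a map that is linear between two
  chains strictly increasing.
\<close>

fun chain :: "real \<Rightarrow> real \<Rightarrow> (real \<times> real) list \<Rightarrow> bool" where
  "chain l r [] \<longleftrightarrow> l = r"
| "chain l r (I # xs) \<longleftrightarrow> fst I = l \<and> l < snd I \<and> chain (snd I) r xs"

lemma chain_append: "chain l r (xs @ ys) \<longleftrightarrow> (\<exists>m. chain l m xs \<and> chain m r ys)"
  by (induction xs arbitrary: l) auto

lemma chain_le: "chain l r xs \<Longrightarrow> l \<le> r"
  by (induction xs arbitrary: l) fastforce+

lemma chain_less: "chain l r xs \<Longrightarrow> xs \<noteq> [] \<Longrightarrow> l < r"
  using chain_le by (cases xs) fastforce+

lemma chain_members: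
  assumes "chain l r xs" "I \<in> set xs"
  shows "l \<le> fst I" "fst I < snd I" "snd I \<le> r"
  using assms chain_le by (induction xs arbitrary: l) fastforce+

lemma chain_cover:
  assumes "chain l r xs" "l \<le> x" "x < r"
  shows "\<exists>I\<in>set xs. fst I \<le> x \<and> x < snd I"
  using assms
proof (induction xs arbitrary: l)
  case (Cons I xs)
  then show ?case by (cases "x < snd I") auto
qed auto

lemma chain_map_upt:
  assumes "\<And>i. i < n \<Longrightarrow> p i < p (Suc i)"
  shows "chain (p 0) (p n) (map (\<lambda>i. (p i, p (Suc i))) [0..<n])"
  using assms by (induction n) (auto simp: chain_append)

lemma chain_maps:
  assumes "list_all2 (maps_linearly f) xs ys" "chain l r xs" "chain l' r' ys" "xs \<noteq> []"
  shows "f l = l' \<and> f r = r' \<and> strict_mono_on {l..r} f \<and> f ` {l..r} = {l'..r'}"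
  using assms
proof (induction xs ys arbitrary: l l' rule: list_all2_induct)
  case (Cons I xs K ys)
  define m m' where "m = snd I" and "m' = snd K"
  have I: "I = (l, m)" "l < m" and K: "K = (l', m')" "l' < m'"
    and ch: "chain m r xs" "chain m' r' ys" using Cons.prems by (auto simp: m_def m'_def)
  have lin: "f x = l' + (m' - l') / (m - l) * (x - l)" if "x \<in> {l..m}" for x
    using Cons.hyps(1) that I K by (simp add: maps_linearly_def)
  have pos: "(m' - l') / (m - l) > 0" using I K by simp
  have 1: "f l = l'" "f m = m'" using lin I by simp_all
  have slope: "a < b \<Longrightarrow> (m' - l') / (m - l) * (a - l) < (m' - l') / (m - l) * (b - l)" for a b
    using mult_strict_left_mono[OF _ pos, of "a - l" "b - l"] by simp
  have mono1: "f x < f y" if "x \<in> {l..m}" "y \<in> {l..m}" "x < y" for x y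
    using lin[OF that(1)] lin[OF that(2)] slope[OF that(3)] by linarith
  have im1: "f ` {l..m} = {l'..m'}"
  proof (intro equalityI subsetI)
    fix z assume "z \<in> f ` {l..m}"
    then obtain x where x: "x \<in> {l..m}" "z = f x" by blast
    then show "z \<in> {l'..m'}"
      using mono1[of l x] mono1[of x m] 1 I by (cases "x = l"; cases "x = m") auto
  next
    fix z assume z: "z \<in> {l'..m'}"
    define x where "x = l + (m - l) * ((z - l') / (m' - l'))"
    have q: "(z - l') / (m' - l') \<in> {0..1}" using z K by (simp add: divide_simps)
    then have "(m - l) * ((z - l') / (m' - l')) \<le> (m - l) * 1" using I by (intro mult_left_mono) auto
    moreover have "0 \<le> (m - l) * ((z - l') / (m' - l'))" using q I by (intro mult_nonneg_nonneg) auto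
    ultimately have "x \<in> {l..m}" by (auto simp: x_def)
    moreover from this have "f x = z" using lin[of x] I K by (simp add: x_def)
    ultimately show "z \<in> f ` {l..m}" by blast
  qed
  show ?case
  proof (cases "xs = []")
    case True
    then have "r = m" "r' = m'" using ch Cons.hyps by auto
    then show ?thesis using 1 im1 mono1 by (auto simp: strict_mono_on_def)
  next
    case False
    from Cons.IH[OF ch False] have IH: "f m = m'" "f r = r'" "strict_mono_on {m..r} f" "f ` {m..r} = {m'..r'}" by auto
    have mr: "m < r" "m' \<le> r'" using ch chain_less chain_le False by auto
    have mono: "strict_mono_on {l..r} f"
    proof (rule strict_mono_onI)
      fix x y assume xy: "x \<in> {l..r}" "y \<in> {l..r}" "x < y"
      have a: "f x \<le> m'" if "x \<le> m" using im1 xy that by auto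
      consider "y \<le> m" | "x < m" "m < y" | "m \<le> x" by linarith
      then show "f x < f y"
      proof cases
        case 1
        then show ?thesis using mono1 xy by auto
      next
        case 2
        have "f x < f m" using mono1 2 xy by auto
        also have "f m < f y" using IH(3) 2 xy mr by (auto simp: strict_mono_on_def)
        finally show ?thesis .
      next
        case 3
        then show ?thesis using IH(3) xy by (auto simp: strict_mono_on_def)
      qed
    qed
    have "{l..r} = {l..m} \<union> {m..r}" "{l'..r'} = {l'..m'} \<union> {m'..r'}" using I K mr by auto
    then have "f ` {l..r} = {l'..r'}" using im1 IH(4) by (simp add: image_Un)
    then show ?thesis using mono 1 IH by simp
  qed
qed auto

section \<open>The groups $F_n$ through adic subdivisions\<close>

text \<open>
  A monotone function with open range is continuous. The range of \<open>f\<close> is not open,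
  but its extension by the identity is a monotone bijection of the whole line.
\<close>

lemma strict_mono_bij_homeomorphism:
  fixes f :: "real \<Rightarrow> real"
  assumes mono: "strict_mono_on {0..1} f" and surj: "f ` {0..1} = {0..1}"
  shows "\<exists>g. homeomorphism {0..1} {0..1} f g"
proof -
  have le: "f x \<le> f y" if "x \<in> {0..1}" "y \<in> {0..1}" "x \<le> y" for x y
    using mono that by (cases "x = y") (auto simp: strict_mono_on_def less_imp_le)
  have im: "f x \<in> {0..1}" if "x \<in> {0..1}" for x using surj that by blast
  define F where "F x = (if x \<in> {0..1} then f x else x)" for x
  have "F ` UNIV = UNIV"
  proof -
    have "y \<in> F ` UNIV" for y
    proof (cases "y \<in> {0..1}")
      case True
      then obtain x where "x \<in> {0..1}" "y = f x" using surj by blast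
      then have "y = F x" by (simp add: F_def)
      then show ?thesis by blast
    next
      case False
      then have "y = F y" unfolding F_def by (rule if_not_P[symmetric])
      then show ?thesis by blast
    qed
    then show ?thesis by blast
  qed
  then have "open (F ` UNIV)" by simp
  moreover have "F x \<le> F y" if "x \<le> y" for x y
    using le[of x y] im[of x] im[of y] that by (auto simp: F_def)
  ultimately have "continuous_on UNIV F" by (intro continuous_onI_mono) auto
  then have "continuous_on {0..1} F" by (rule continuous_on_subset) simp
  then have "continuous_on {0..1} f"
    by (rule continuous_on_eq) (simp add: F_def)
  moreover have "inj_on f {0..1}" using mono by (simp add: strict_mono_on_imp_inj_on)
  ultimately show ?thesis using surj by (intro homeomorphism_compact) auto
qed

lemma thompson_carrierD:
  assumes "f \<in> carrier (thompson_group n)"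
  shows "f \<in> extensional {0..1}" "strict_mono_on {0..1} f" "f ` {0..1} = {0..1}"
    "f 0 = 0" "f 1 = 1" "adic_piecewise_linear n f"
proof -
  show 1: "f \<in> extensional {0..1}" "strict_mono_on {0..1} f" "adic_piecewise_linear n f"
    and 2: "f ` {0..1} = {0..1}"
    using assms by (auto simp: thompson_group_def homeomorphism_def)
  have le: "f x \<le> f y" if "x \<in> {0..1}" "y \<in> {0..1}" "x \<le> y" for x y
    using 1 that by (cases "x = y") (auto simp: strict_mono_on_def less_imp_le)
  obtain u v where uv: "u \<in> {0..1}" "f u = 0" "v \<in> {0..1}" "f v = 1"
    using 2 by (metis (no_types, lifting) imageE atLeastAtMost_iff zero_le_one order_refl)
  have "f 0 \<in> {0..1}" "f 1 \<in> {0..1}" using 2 by auto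
  then show "f 0 = 0" "f 1 = 1" using le[of 0 u] le[of v 1] uv by auto
qed

lemma thompson_carrierI:
  assumes "f \<in> extensional {0..1}" "strict_mono_on {0..1} f" "f ` {0..1} = {0..1}"
    "adic_piecewise_linear n f"
  shows "f \<in> carrier (thompson_group n)"
  using assms strict_mono_bij_homeomorphism by (auto simp: thompson_group_def)

lemma adic_fraction_add: "n > 0 \<Longrightarrow> adic_fraction n x \<Longrightarrow> adic_fraction n y \<Longrightarrow> adic_fraction n (x + y)"
  and adic_fraction_diff: "n > 0 \<Longrightarrow> adic_fraction n x \<Longrightarrow> adic_fraction n y \<Longrightarrow> adic_fraction n (x - y)"
  and adic_fraction_mult: "adic_fraction n x \<Longrightarrow> adic_fraction n y \<Longrightarrow> adic_fraction n (x * y)"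
proof -
  assume n: "n > 0" and "adic_fraction n x" "adic_fraction n y"
  then obtain a k b j where xy: "x = of_int a / real n ^ k" "y = of_int b / real n ^ j"
    unfolding adic_fraction_def by blast
  have "x + y = of_int (a * int n ^ j + b * int n ^ k) / real n ^ (k + j)"
    "x - y = of_int (a * int n ^ j - b * int n ^ k) / real n ^ (k + j)"
    using n unfolding xy by (simp_all add: field_simps power_add)
  then show "adic_fraction n (x + y)" "adic_fraction n (x - y)" unfolding adic_fraction_def by blast+
next
  assume "adic_fraction n x" "adic_fraction n y"
  then obtain a k b j where xy: "x = of_int a / real n ^ k" "y = of_int b / real n ^ j"
    unfolding adic_fraction_def by blast
  have "x * y = of_int (a * b) / real n ^ (k + j)" unfolding xy by (simp add: power_add)
  then show "adic_fraction n (x * y)" unfolding adic_fraction_def by blast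
qed

lemma adic_fraction_powi: "adic_fraction n (real n powi k)"
proof (cases "k \<ge> 0")
  case True
  then have "real n powi k = of_int (int n ^ nat k) / real n ^ 0" by (simp add: power_int_def)
  then show ?thesis unfolding adic_fraction_def by blast
next
  case False
  then have "real n powi k = of_int 1 / real n ^ nat (- k)" by (simp add: power_int_def divide_inverse power_inverse)
  then show ?thesis unfolding adic_fraction_def by blast
qed

lemma adic_fraction_common_denominator:
  assumes "finite A" "n > 0" "\<And>x. x \<in> A \<Longrightarrow> adic_fraction n x"
  shows "\<exists>M. \<forall>k\<ge>M. \<forall>x\<in>A. \<exists>z::int. x * real n ^ k = of_int z"
  using assms
proof (induction A rule: finite_induct)
  case (insert y A)
  then obtain M where M: "\<forall>k\<ge>M. \<forall>x\<in>A. \<exists>z::int. x * real n ^ k = of_int z" by blast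
  obtain a j where y: "y = of_int a / real n ^ j" using insert.prems unfolding adic_fraction_def by blast
  have "\<exists>z::int. y * real n ^ k = of_int z" if "k \<ge> j" for k
  proof -
    have "real n ^ k = real n ^ j * real n ^ (k - j)" using that by (simp flip: power_add)
    then have "y * real n ^ k = of_int (a * int n ^ (k - j))" using \<open>n > 0\<close> y by simp
    then show ?thesis by blast
  qed
  then show ?case using M by (intro exI[of _ "max M j"]) auto
qed auto

text \<open>
  The uniform form of piecewise linearity: every sufficiently fine standard interval is mapped
  linearly onto a standard interval, which is as fine as desired. Since no subdivision adapted
  to \<open>f\<close> occurs, this form passes to compositions without common refinements.
\<close>

definition grid_linear :: "nat \<Rightarrow> (real \<Rightarrow> real) \<Rightarrow> bool" where
  "grid_linear n f \<longleftrightarrow> (\<forall>K. \<exists>N. \<forall>k\<ge>N. \<forall>a<n ^ k. \<exists>m\<ge>K. \<exists>b<n ^ m.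
     maps_linearly f (adic_interval n k a) (adic_interval n m b))"

text \<open>
  On each piece \<open>f\<close> has the form $n^e x + c$. By induction over the division
  points, starting with $f(0) = 0$, all values there and hence all constants $c$ are $n$-adic,
  with a common denominator $n^M$. On a standard interval of level $k$ this gives $f((a+x)/n^k)
  = (a+x)/n^m + c$ with $m = k - e$, and as soon as $m \ge M$ the constant is a multiple of
  $n^{-m}$, so the image is standard.
\<close>

lemma thompson_grid_linear:
  assumes n: "n \<ge> 2" and f: "f \<in> carrier (thompson_group n)"
  shows "grid_linear n f"
proof -
  have n0: "n > 0" using n by simp
  note fD = thompson_carrierD[OF f]
  obtain m t where t: "t 0 = 0" "t m = 1" "\<forall>i<m. t i < t (Suc i)" "\<forall>i\<le>m. adic_fraction n (t i)"
    and "\<forall>i<m. \<exists>(k::int) (c::real). \<forall>x\<in>{t i..t (Suc i)}. f x = real n powi k * x + c"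
    using fD(6) unfolding adic_piecewise_linear_def by auto
  then obtain ks cs where lin: "\<And>i x. i < m \<Longrightarrow> x \<in> {t i..t (Suc i)} \<Longrightarrow> f x = real n powi ks i * x + cs i"
    by metis
  have f_adic: "adic_fraction n (f (t i))" if "i \<le> m" for i
    using that
  proof (induction i)
    case 0
    have "adic_fraction n 0" unfolding adic_fraction_def by (intro exI[of _ 0]) simp
    then show ?case using t fD by simp
  next
    case (Suc i)
    then have lt: "t i < t (Suc i)" using t by simp
    have "f (t (Suc i)) = f (t i) + real n powi ks i * (t (Suc i) - t i)"
      using lin[of i "t i"] lin[of i "t (Suc i)"] lt Suc.prems by (simp add: algebra_simps)
    moreover have "adic_fraction n (f (t i) + real n powi ks i * (t (Suc i) - t i))"
      using Suc t(4) by (intro adic_fraction_add adic_fraction_mult adic_fraction_diff adic_fraction_powi n0) auto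
    ultimately show ?case by simp
  qed
  have c_adic: "adic_fraction n (cs i)" if "i < m" for i
  proof -
    have "cs i = f (t i) - real n powi ks i * t i" using lin[of i "t i"] t that by force
    also have "adic_fraction n \<dots>"
      using f_adic[of i] t(4) that by (intro adic_fraction_mult adic_fraction_diff adic_fraction_powi n0) auto
    finally show ?thesis .
  qed
  obtain M where M: "\<And>k i. k \<ge> M \<Longrightarrow> i < m \<Longrightarrow> \<exists>z::int. cs i * real n ^ k = of_int z"
  proof -
    have "\<exists>M. \<forall>k\<ge>M. \<forall>x\<in>cs ` {..<m}. \<exists>z::int. x * real n ^ k = of_int z"
      using n0 c_adic by (intro adic_fraction_common_denominator) auto
    then show ?thesis using that by auto
  qed
  obtain L where L: "\<And>k i. k \<ge> L \<Longrightarrow> i \<le> m \<Longrightarrow> \<exists>z::int. t i * real n ^ k = of_int z"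
  proof -
    have "\<exists>M. \<forall>k\<ge>M. \<forall>x\<in>t ` {..m}. \<exists>z::int. x * real n ^ k = of_int z"
      using n0 t(4) by (intro adic_fraction_common_denominator) auto
    then show ?thesis using that by auto
  qed
  \<comment> \<open>A bound for all exponents of the slopes, so that \<open>k - ks i\<close> is large if \<open>k\<close> is.\<close>
  define B where "B = (\<Sum>i<m. nat \<bar>ks i\<bar>)"
  have B: "\<bar>ks i\<bar> \<le> int B" if "i < m" for i
  proof -
    have "nat \<bar>ks i\<bar> \<le> B" unfolding B_def using that by (intro member_le_sum) auto
    then show ?thesis by linarith
  qed
  show ?thesis
    unfolding grid_linear_def
  proof (intro allI)
    fix K
    show "\<exists>N. \<forall>k\<ge>N. \<forall>a<n ^ k. \<exists>m\<ge>K. \<exists>b<n ^ m. maps_linearly f (adic_interval n k a) (adic_interval n m b)"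
    proof (rule exI[of _ "L + M + B + K"], intro allI impI)
      fix k a assume k: "k \<ge> L + M + B + K" and a: "a < n ^ k"
      have pk: "real n ^ k > 0" using n0 by simp
      have ch: "chain (t 0) (t m) (map (\<lambda>i. (t i, t (Suc i))) [0..<m])" using t by (intro chain_map_upt) auto
      have "real a < real (n ^ k)" using a by (simp only: of_nat_less_iff)
      then have "t 0 \<le> real a / real n ^ k" "real a / real n ^ k < t m" using pk t by simp_all
      from chain_cover[OF ch this] obtain i where i: "i < m" "t i \<le> real a / real n ^ k" "real a / real n ^ k < t (Suc i)"
        by auto
      obtain z where z: "t (Suc i) * real n ^ k = of_int z" using L[of k "Suc i"] k i by auto
      have "real a < of_int z" using i(3) pk z[symmetric] by (simp add: field_simps)
      then have "real_of_int (int a) < of_int z" by simp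
      then have "int a + 1 \<le> z" by (simp only: of_int_less_iff)
      then have "real_of_int (int a + 1) \<le> of_int z" by (simp only: of_int_le_iff)
      then have "real a + 1 \<le> of_int z" by simp
      then have right: "(real a + 1) / real n ^ k \<le> t (Suc i)" using pk z by (simp add: field_simps)
      define m' where "m' = nat (int k - ks i)"
      have m': "int m' = int k - ks i" "m' \<ge> M" "m' \<ge> K" using B[OF i(1)] k by (auto simp: m'_def)
      have "real n powi ks i = real n ^ k / real n ^ m'"
      proof -
        have "ks i = int k - int m'" using m' by simp
        then show ?thesis using n0 by (simp add: power_int_diff)
      qed
      moreover have pos: "(real a + x) / real n ^ k \<in> {t i..t (Suc i)}" if "x \<in> {0..1}" for x
      proof -
        have "real a / real n ^ k \<le> (real a + x) / real n ^ k" "(real a + x) / real n ^ k \<le> (real a + 1) / real n ^ k"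
          using that pk by (auto intro!: divide_right_mono)
        then show ?thesis using i right by auto
      qed
      ultimately have fx: "f ((real a + x) / real n ^ k) = (real a + x) / real n ^ m' + cs i" if "x \<in> {0..1}" for x
        using lin[OF i(1) pos[OF that]] n0 by simp
      obtain w where w: "cs i * real n ^ m' = of_int w" using M[OF m'(2) i(1)] by blast
      have pm: "real n ^ m' > 0" using n0 by simp
      have fx': "f ((real a + x) / real n ^ k) = (of_int (int a + w) + x) / real n ^ m'" if "x \<in> {0..1}" for x
        using fx[OF that] pm w[symmetric] by (simp add: field_simps)
      have in01: "(real a + x) / real n ^ k \<in> {0..1}" if "x \<in> {0, 1}" for x
      proof -
        have "real (Suc a) \<le> real (n ^ k)" using a by (simp only: of_nat_le_iff)
        then show ?thesis using that pk a by auto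
      qed
      have b0: "0 \<le> int a + w" and b1: "int a + w + 1 \<le> int n ^ m'"
      proof -
        have "f ((real a + 0) / real n ^ k) \<in> {0..1}" "f ((real a + 1) / real n ^ k) \<in> {0..1}" using in01 fD(3) by blast+
        then have "0 \<le> real_of_int (int a + w) / real n ^ m'" "(real_of_int (int a + w) + 1) / real n ^ m' \<le> 1"
          using fx'[of 0] fx'[of 1] by auto
        then have "0 \<le> real_of_int (int a + w)" "real_of_int (int a + w + 1) \<le> of_int (int n ^ m')"
          using pm by (simp_all add: divide_simps)
        then show "0 \<le> int a + w" "int a + w + 1 \<le> int n ^ m'" by (simp_all only: of_int_le_iff of_int_0_le_iff)
      qed
      define b where "b = nat (int a + w)"
      have b: "int b = int a + w" "b < n ^ m'" using b0 b1 by (auto simp: b_def nat_less_iff)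
      have "real b = of_int (int a + w)" using b(1) by (metis of_int_of_nat_eq)
      then have "maps_linearly f (adic_interval n k a) (adic_interval n m' b)"
        unfolding maps_linearly_adic[OF n0] using fx' by simp
      then show "\<exists>m\<ge>K. \<exists>b<n ^ m. maps_linearly f (adic_interval n k a) (adic_interval n m b)"
        using m' b by blast
    qed
  qed
qed

lemma grid_piecewise_linear:
  assumes n: "n \<ge> 2"
    and f: "\<And>a. a < n ^ k \<Longrightarrow> \<exists>m b. maps_linearly f (adic_interval n k a) (adic_interval n m b)"
  shows "adic_piecewise_linear n f"
proof -
  have pk: "real n ^ j > 0" for j using n by simp
  define t where "t i = real i / real n ^ k" for i
  have "\<exists>(j::int) (c::real). \<forall>x\<in>{t i..t (Suc i)}. f x = real n powi j * x + c" if i: "i < n ^ k" for i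
  proof -
    obtain m b where "maps_linearly f (adic_interval n k i) (adic_interval n m b)" using f[OF i] by blast
    then have lin: "\<forall>x\<in>{t i..t (Suc i)}. f x = real b / real n ^ m +
        ((real b + 1) / real n ^ m - real b / real n ^ m) / ((real i + 1) / real n ^ k - real i / real n ^ k) * (x - t i)"
      by (simp add: maps_linearly_def adic_interval_def t_def add.commute)
    have s: "((real b + 1) / real n ^ m - real b / real n ^ m) / ((real i + 1) / real n ^ k - real i / real n ^ k) = real n powi (int k - int m)"
      using n pk by (simp add: power_int_diff flip: diff_divide_distrib)
    from lin[unfolded s] show ?thesis
      by (intro exI[of _ "int k - int m"] exI[of _ "real b / real n ^ m - real n powi (int k - int m) * t i"])
        (auto simp: algebra_simps)
  qed
  moreover have "adic_fraction n (t i)" for i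
    unfolding adic_fraction_def t_def by (metis of_int_of_nat_eq)
  moreover have "t 0 = 0" "t (n ^ k) = 1" "\<forall>i<n ^ k. t i < t (Suc i)"
    using pk n by (auto simp: t_def divide_strict_right_mono)
  ultimately show ?thesis unfolding adic_piecewise_linear_def by blast
qed

definition is_adic :: "nat \<Rightarrow> real \<times> real \<Rightarrow> bool" where
  "is_adic n I \<longleftrightarrow> (\<exists>k a. I = adic_interval n k a)"

lemma is_adic_interval [simp]: "is_adic n (adic_interval n k a)"
  by (auto simp: is_adic_def)

lemma adic_levels_bounded:
  assumes "\<And>I. I \<in> set xs \<Longrightarrow> is_adic n I"
  obtains N where "\<And>I. I \<in> set xs \<Longrightarrow> \<exists>k\<le>N. \<exists>a. I = adic_interval n k a"
proof -
  obtain lev where lev: "\<And>I. I \<in> set xs \<Longrightarrow> \<exists>a. I = adic_interval n (lev I) a"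
    using assms unfolding is_adic_def by metis
  have "lev I \<le> Max (lev ` set xs)" if "I \<in> set xs" for I using that by simp
  then show ?thesis using lev that by blast
qed

text \<open>
  A presentation of \<open>f\<close> by two subdivisions of the unit interval into standard
  intervals. Elements of $F_n$ are exactly the extensional functions with such a presentation.
\<close>

definition subdivision_map :: "nat \<Rightarrow> (real \<Rightarrow> real) \<Rightarrow> (real \<times> real) list \<Rightarrow> (real \<times> real) list \<Rightarrow> bool" where
  "subdivision_map n f xs ys \<longleftrightarrow> chain 0 1 xs \<and> (\<forall>I\<in>set xs. is_adic n I) \<and>
     chain 0 1 ys \<and> (\<forall>K\<in>set ys. is_adic n K) \<and> list_all2 (maps_linearly f) xs ys"

lemma subdivision_mapD:
  assumes "subdivision_map n f xs ys"
  shows "chain 0 1 xs" "\<And>I. I \<in> set xs \<Longrightarrow> is_adic n I" "chain 0 1 ys"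
    "\<And>K. K \<in> set ys \<Longrightarrow> is_adic n K" "list_all2 (maps_linearly f) xs ys"
  using assms by (simp_all add: subdivision_map_def)

lemma subdivision_map_grid_linear:
  assumes n: "n \<ge> 2" and map: "subdivision_map n f xs ys"
  shows "grid_linear n f"
  unfolding grid_linear_def
proof
  fix K
  note xs = subdivision_mapD(1,2)[OF map] and ys = subdivision_mapD(3,4)[OF map] and f = subdivision_mapD(5)[OF map]
  have n0: "n > 0" using n by simp
  obtain N where N: "\<And>I. I \<in> set xs \<Longrightarrow> \<exists>k\<le>N. \<exists>a. I = adic_interval n k a"
    using adic_levels_bounded xs by blast
  show "\<exists>N. \<forall>k\<ge>N. \<forall>a<n ^ k. \<exists>m\<ge>K. \<exists>b<n ^ m. maps_linearly f (adic_interval n k a) (adic_interval n m b)"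
  proof (rule exI[of _ "N + K"], intro allI impI)
    fix k a assume k: "k \<ge> N + K" and a: "a < n ^ k"
    have "real a < real (n ^ k)" using a by (simp only: of_nat_less_iff)
    then have "real a / real n ^ k < 1" using n0 by simp
    then obtain I where I: "I \<in> set xs" "fst I \<le> real a / real n ^ k" "real a / real n ^ k < snd I"
      using chain_cover[OF xs(1), of "real a / real n ^ k"] by auto
    then obtain j c where j: "j \<le> N" "I = adic_interval n j c" using N by blast
    obtain d where d: "d < n ^ (k - j)" "a = c * n ^ (k - j) + d"
      using adic_interval_nested[of n j k c a] n0 j k I by auto
    obtain J where J: "J \<in> set ys" "maps_linearly f I J"
      using f I(1) by (metis in_set_conv_nth list_all2_conv_all_nth)
    then obtain m b where mb: "J = adic_interval n m b" using ys(2) unfolding is_adic_def by blast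
    have "(real b + 1) / real n ^ m \<le> 1" using chain_members[OF ys(1) J(1)] mb by simp
    then have "real (Suc b) \<le> real (n ^ m)" using n0 by (simp add: divide_simps)
    then have "Suc b \<le> n ^ m" by (simp only: of_nat_le_iff)
    then have "Suc b * n ^ (k - j) \<le> n ^ m * n ^ (k - j)" by (rule mult_right_mono) simp
    then have b: "b * n ^ (k - j) + d < n ^ (m + (k - j))" using d(1) by (simp add: power_add)
    have "maps_linearly f (adic_interval n (j + (k - j)) (c * n ^ (k - j) + d)) (adic_interval n (m + (k - j)) (b * n ^ (k - j) + d))"
      using J j mb d(1) by (intro maps_linearly_sub n0) auto
    then have "maps_linearly f (adic_interval n k a) (adic_interval n (m + (k - j)) (b * n ^ (k - j) + d))"
      using j k d by simp
    moreover have "m + (k - j) \<ge> K" using j k by simp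
    ultimately show "\<exists>m\<ge>K. \<exists>b<n ^ m. maps_linearly f (adic_interval n k a) (adic_interval n m b)"
      using b by blast
  qed
qed

lemma subdivision_map_thompson:
  assumes n: "n \<ge> 2" and ext: "f \<in> extensional {0..1}" and map: "subdivision_map n f xs ys"
  shows "f \<in> carrier (thompson_group n)"
proof (rule thompson_carrierI)
  note xs = subdivision_mapD(1)[OF map] and ys = subdivision_mapD(3)[OF map] and f = subdivision_mapD(5)[OF map]
  have "xs \<noteq> []" using xs by auto
  from chain_maps[OF f xs ys this] show "strict_mono_on {0..1} f" "f ` {0..1} = {0..1}" by auto
  obtain N where "\<forall>k\<ge>N. \<forall>a<n ^ k. \<exists>m\<ge>0. \<exists>b<n ^ m. maps_linearly f (adic_interval n k a) (adic_interval n m b)"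
    using subdivision_map_grid_linear[OF n map] unfolding grid_linear_def by blast
  then show "adic_piecewise_linear n f" by (intro grid_piecewise_linear[OF n, of N]) blast
qed (rule ext)

lemma image_chain:
  assumes "chain l r xs" "\<And>I. I \<in> set xs \<Longrightarrow> \<exists>K. is_adic n K \<and> maps_linearly f I K" "n > 0"
  shows "\<exists>ys. chain (f l) (f r) ys \<and> list_all2 (maps_linearly f) xs ys \<and> (\<forall>K\<in>set ys. is_adic n K)"
  using assms
proof (induction xs arbitrary: l)
  case (Cons I xs)
  obtain ys where ys: "chain (f (snd I)) (f r) ys" "list_all2 (maps_linearly f) xs ys" "\<forall>K\<in>set ys. is_adic n K"
    using Cons.IH[of "snd I"] Cons.prems by auto
  obtain K where K: "is_adic n K" "maps_linearly f I K" using Cons.prems(2)[of I] by auto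
  have I: "fst I = l" "l < snd I" using Cons.prems by auto
  have "f l = fst K" "f (snd I) = snd K" using maps_linearly_ends[OF K(2)] I by auto
  moreover have "fst K < snd K" using K(1) \<open>n > 0\<close> adic_interval_less unfolding is_adic_def by blast
  ultimately show ?case using ys K by (intro exI[of _ "K # ys"]) auto
qed (auto intro!: exI[of _ "[]"])

lemma adic_grid_chain:
  assumes "n > 0"
  shows "chain 0 1 (map (adic_interval n k) [0..<n ^ k])"
proof -
  have "chain (real 0 / real n ^ k) (real (n ^ k) / real n ^ k)
      (map (\<lambda>i. (real i / real n ^ k, real (Suc i) / real n ^ k)) [0..<n ^ k])"
    using assms by (intro chain_map_upt[of _ "\<lambda>i. real i / real n ^ k"]) (auto intro: divide_strict_right_mono)
  moreover have "(\<lambda>i. (real i / real n ^ k, real (Suc i) / real n ^ k)) = adic_interval n k"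
    by (auto simp: adic_interval_def add.commute)
  ultimately show ?thesis using assms by simp
qed

lemma grid_linear_subdivision:
  assumes n: "n \<ge> 2" and f: "grid_linear n f" "f 0 = 0" "f 1 = 1"
  obtains xs ys where "subdivision_map n f xs ys"
proof -
  obtain k where k: "\<And>a. a < n ^ k \<Longrightarrow> \<exists>m b. maps_linearly f (adic_interval n k a) (adic_interval n m b)"
    using f(1) unfolding grid_linear_def by (metis le_refl)
  let ?xs = "map (adic_interval n k) [0..<n ^ k]"
  have ch: "chain 0 1 ?xs" "\<forall>I\<in>set ?xs. is_adic n I" using n by (auto intro!: adic_grid_chain)
  have "\<exists>ys. chain (f 0) (f 1) ys \<and> list_all2 (maps_linearly f) ?xs ys \<and> (\<forall>K\<in>set ys. is_adic n K)"
  proof (rule image_chain[OF ch(1)])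
    fix I assume "I \<in> set ?xs"
    then obtain a where a: "a < n ^ k" "I = adic_interval n k a" by auto
    then show "\<exists>K. is_adic n K \<and> maps_linearly f I K" using k[OF a(1)] is_adic_interval by metis
  qed (use n in simp)
  then obtain ys where "chain (f 0) (f 1) ys" "list_all2 (maps_linearly f) ?xs ys" "\<forall>K\<in>set ys. is_adic n K"
    by blast
  with ch show ?thesis using that[of ?xs ys] f unfolding subdivision_map_def by simp
qed

lemma grid_linear_thompson:
  assumes "n \<ge> 2" "f \<in> extensional {0..1}" "grid_linear n f" "f 0 = 0" "f 1 = 1"
  shows "f \<in> carrier (thompson_group n)"
proof -
  obtain xs ys where "subdivision_map n f xs ys" using grid_linear_subdivision[OF assms(1,3-5)] .
  then show ?thesis by (rule subdivision_map_thompson[OF assms(1,2)])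
qed

lemma thompson_mult [simp]: "f \<otimes>\<^bsub>thompson_group n\<^esub> g = compose {0..1} g f"
  and thompson_one [simp]: "\<one>\<^bsub>thompson_group n\<^esub> = (\<lambda>t\<in>{0..1}. t)"
  by (simp_all add: thompson_group_def)

lemma adic_interval_unit:
  assumes "n > 0" "a < n ^ k"
  shows "{fst (adic_interval n k a)..snd (adic_interval n k a)} \<subseteq> {0..1}"
proof -
  have "real (Suc a) \<le> real (n ^ k)" using assms by (simp only: of_nat_le_iff)
  then have "(real a + 1) / real n ^ k \<le> 1" using assms by (simp add: divide_simps)
  moreover have "0 \<le> real a / real n ^ k" by simp
  ultimately show ?thesis by auto
qed

text \<open>
  The fine intervals of \<open>f\<close> go to intervals that are fine enough for
  \<open>g\<close>.
\<close>

lemma thompson_mult_closed: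
  assumes n: "n \<ge> 2" and f: "f \<in> carrier (thompson_group n)" and g: "g \<in> carrier (thompson_group n)"
  shows "compose {0..1} g f \<in> carrier (thompson_group n)"
proof (rule grid_linear_thompson[OF n])
  have n0: "n > 0" using n by simp
  show "grid_linear n (compose {0..1} g f)"
    unfolding grid_linear_def
  proof
    fix K
    obtain M where M: "\<And>k a. k \<ge> M \<Longrightarrow> a < n ^ k \<Longrightarrow> \<exists>m\<ge>K. \<exists>b<n ^ m. maps_linearly g (adic_interval n k a) (adic_interval n m b)"
      using thompson_grid_linear[OF n g] unfolding grid_linear_def by metis
    obtain N where N: "\<And>k a. k \<ge> N \<Longrightarrow> a < n ^ k \<Longrightarrow> \<exists>m\<ge>M. \<exists>b<n ^ m. maps_linearly f (adic_interval n k a) (adic_interval n m b)"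
      using thompson_grid_linear[OF n f] unfolding grid_linear_def by metis
    show "\<exists>N. \<forall>k\<ge>N. \<forall>a<n ^ k. \<exists>m\<ge>K. \<exists>b<n ^ m.
        maps_linearly (compose {0..1} g f) (adic_interval n k a) (adic_interval n m b)"
    proof (rule exI[of _ N], intro allI impI)
      fix k a assume k: "k \<ge> N" and a: "a < n ^ k"
      obtain m b where m: "m \<ge> M" "b < n ^ m" "maps_linearly f (adic_interval n k a) (adic_interval n m b)"
        using N[OF k a] by blast
      obtain l c where l: "l \<ge> K" "c < n ^ l" "maps_linearly g (adic_interval n m b) (adic_interval n l c)"
        using M[OF m(1,2)] by blast
      have "maps_linearly (\<lambda>x. g (f x)) (adic_interval n k a) (adic_interval n l c)"
        by (rule maps_linearly_comp[OF m(3) l(3)]) (simp_all only: adic_interval_less n0)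
      then have "maps_linearly (compose {0..1} g f) (adic_interval n k a) (adic_interval n l c)"
      proof (rule maps_linearly_cong)
        fix x assume "x \<in> {fst (adic_interval n k a)..snd (adic_interval n k a)}"
        then have "x \<in> {0..1}" using adic_interval_unit[OF n0 a] by blast
        then show "g (f x) = compose {0..1} g f x" by (simp add: compose_def)
      qed
      then show "\<exists>m\<ge>K. \<exists>b<n ^ m. maps_linearly (compose {0..1} g f) (adic_interval n k a) (adic_interval n m b)"
        using l by blast
    qed
  qed
qed (use thompson_carrierD[OF f] thompson_carrierD[OF g] in \<open>auto simp: compose_def\<close>)

lemma list_all2_maps_inverse:
  assumes "list_all2 (maps_linearly f) xs ys" "chain l r xs" "chain l' r' ys"
    and "\<And>x. x \<in> {l..r} \<Longrightarrow> g (f x) = x"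
  shows "list_all2 (maps_linearly g) ys xs"
  unfolding list_all2_conv_all_nth
proof (intro conjI allI impI)
  show "length ys = length xs" using assms by (simp add: list_all2_lengthD)
  fix i assume i: "i < length ys"
  then have "xs ! i \<in> set xs" "ys ! i \<in> set ys" "maps_linearly f (xs ! i) (ys ! i)"
    using assms by (auto simp: list_all2_conv_all_nth)
  then show "maps_linearly g (ys ! i) (xs ! i)"
    using chain_members[OF assms(2), of "xs ! i"] chain_members[OF assms(3), of "ys ! i"]
    by (intro maps_linearly_inverse[of f "xs ! i" "ys ! i"]) (simp_all add: assms(4))
qed

lemma subdivision_map_inverse:
  assumes "subdivision_map n f xs ys" and "\<And>x. x \<in> {0..1} \<Longrightarrow> g (f x) = x"
  shows "subdivision_map n g ys xs"
  using assms list_all2_maps_inverse[of f xs ys 0 1 0 1 g] unfolding subdivision_map_def by blast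

lemma thompson_inverse:
  assumes n: "n \<ge> 2" and f: "f \<in> carrier (thompson_group n)"
  shows "\<exists>g\<in>carrier (thompson_group n). compose {0..1} f g = (\<lambda>t\<in>{0..1}. t)"
proof -
  note fD = thompson_carrierD[OF f]
  define g where "g = restrict (inv_into {0..1} f) {0..1}"
  have inj: "inj_on f {0..1}" using fD by (simp add: strict_mono_on_imp_inj_on)
  have gf: "g (f x) = x" if "x \<in> {0..1}" for x
  proof -
    have "f x \<in> {0..1}" using that fD by blast
    then show ?thesis using that inj by (simp add: g_def)
  qed
  obtain xs ys where "subdivision_map n f xs ys"
    using grid_linear_subdivision[OF n thompson_grid_linear[OF n f] fD(4,5)] .
  then have "subdivision_map n g ys xs" using gf by (rule subdivision_map_inverse)
  then have "g \<in> carrier (thompson_group n)"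
    by (intro subdivision_map_thompson[OF n]) (simp_all add: g_def)
  moreover have "compose {0..1} f g = (\<lambda>t\<in>{0..1}. t)"
  proof
    fix x show "compose {0..1} f g x = (\<lambda>t\<in>{0..1}. t) x"
      using fD(3) by (auto simp: compose_def g_def f_inv_into_f)
  qed
  ultimately show ?thesis by blast
qed

lemma thompson_maps_unit: "f \<in> carrier (thompson_group n) \<Longrightarrow> x \<in> {0..1} \<Longrightarrow> f x \<in> {0..1}"
  using thompson_carrierD(3) by blast

lemma thompson_one_closed:
  assumes "n \<ge> 2"
  shows "(\<lambda>t\<in>{0..1}. t) \<in> carrier (thompson_group n)"
  by (rule subdivision_map_thompson[OF assms, where xs = "[(0, 1)]" and ys = "[(0, 1)]"])
    (auto simp: subdivision_map_def maps_linearly_def is_adic_def adic_interval_def intro!: exI[of _ "0::nat"])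

lemma group_thompson:
  assumes n: "n \<ge> 2"
  shows "group (thompson_group n)"
proof (rule groupI)
  fix f g h assume fgh: "f \<in> carrier (thompson_group n)" "g \<in> carrier (thompson_group n)" "h \<in> carrier (thompson_group n)"
  then show "f \<otimes>\<^bsub>thompson_group n\<^esub> g \<otimes>\<^bsub>thompson_group n\<^esub> h = f \<otimes>\<^bsub>thompson_group n\<^esub> (g \<otimes>\<^bsub>thompson_group n\<^esub> h)"
    using thompson_maps_unit[OF fgh(1)] thompson_maps_unit[OF fgh(2)] by (auto simp: compose_def fun_eq_iff)
next
  fix f assume f: "f \<in> carrier (thompson_group n)"
  show "\<one>\<^bsub>thompson_group n\<^esub> \<otimes>\<^bsub>thompson_group n\<^esub> f = f"
    using thompson_carrierD(1)[OF f] by (auto simp: compose_def fun_eq_iff extensional_def)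
  show "\<exists>g\<in>carrier (thompson_group n). g \<otimes>\<^bsub>thompson_group n\<^esub> f = \<one>\<^bsub>thompson_group n\<^esub>"
    using thompson_inverse[OF n f] by simp
qed (use n in \<open>auto intro: thompson_mult_closed thompson_one_closed\<close>)

section \<open>Binary trees and dyadic subdivisions\<close>

datatype btree = Leaf | Node btree btree

fun leaf_intervals :: "btree \<Rightarrow> real \<Rightarrow> real \<Rightarrow> (real \<times> real) list" where
  "leaf_intervals Leaf l r = [(l, r)]"
| "leaf_intervals (Node A B) l r = leaf_intervals A l ((l + r) / 2) @ leaf_intervals B ((l + r) / 2) r"

fun leaves :: "btree \<Rightarrow> nat" where
  "leaves Leaf = 1"
| "leaves (Node A B) = leaves A + leaves B"

lemma leaves_pos [simp]: "leaves T > 0"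
  by (induction T) auto

lemma length_leaf_intervals [simp]: "length (leaf_intervals T l r) = leaves T"
  by (induction T arbitrary: l r) auto

lemma leaf_intervals_nonempty [simp]: "leaf_intervals T l r \<noteq> []"
  by (induction T arbitrary: l r) auto

lemma chain_leaf_intervals: "l < r \<Longrightarrow> chain l r (leaf_intervals T l r)"
proof (induction T arbitrary: l r)
  case (Node A B)
  then have "chain l ((l + r) / 2) (leaf_intervals A l ((l + r) / 2))" "chain ((l + r) / 2) r (leaf_intervals B ((l + r) / 2) r)"
    by auto
  then show ?case by (auto simp: chain_append)
qed auto

lemma hd_leaf_intervals: "fst (hd (leaf_intervals T l r)) = l"
  by (induction T arbitrary: l r) auto

lemma adic_interval_left_half:
  "adic_interval 2 (Suc k) (2 * a) =
    (fst (adic_interval 2 k a), (fst (adic_interval 2 k a) + snd (adic_interval 2 k a)) / 2)"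
  and adic_interval_right_half:
  "adic_interval 2 (Suc k) (Suc (2 * a)) =
    ((fst (adic_interval 2 k a) + snd (adic_interval 2 k a)) / 2, snd (adic_interval 2 k a))"
  by (simp_all add: adic_interval_def field_simps)

text \<open>
  The subdivision of the standard dyadic interval number \<open>a\<close> of level
  \<open>k\<close>. Compared with \<open>leaf_intervals\<close>, this form shows that all the
  intervals are dyadic and what the numerators of their left ends are.
\<close>

definition subtree_leaves :: "btree \<Rightarrow> nat \<Rightarrow> nat \<Rightarrow> (real \<times> real) list" where
  "subtree_leaves T k a = leaf_intervals T (fst (adic_interval 2 k a)) (snd (adic_interval 2 k a))"

lemma subtree_leaves_Leaf [simp]: "subtree_leaves Leaf k a = [adic_interval 2 k a]"
  by (simp add: subtree_leaves_def adic_interval_def)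

lemma subtree_leaves_Node [simp]:
  "subtree_leaves (Node A B) k a = subtree_leaves A (Suc k) (2 * a) @ subtree_leaves B (Suc k) (Suc (2 * a))"
  unfolding subtree_leaves_def adic_interval_left_half adic_interval_right_half by simp

lemma subtree_leaves_unit: "subtree_leaves T 0 0 = leaf_intervals T 0 1"
  by (simp add: subtree_leaves_def)

lemma subtree_leaves_adic: "I \<in> set (subtree_leaves T k a) \<Longrightarrow> is_adic 2 I"
  by (induction T arbitrary: k a) auto

lemma leaf_intervals_adic: "I \<in> set (leaf_intervals T 0 1) \<Longrightarrow> is_adic 2 I"
  using subtree_leaves_adic[of I T 0 0] by (simp add: subtree_leaves_unit)

text \<open>
  Two dyadic intervals are nested or overlap in at most an end point, so a dyadic interval
  properly inside another one cannot contain its midpoint in the interior.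
\<close>

lemma dyadic_nested_half:
  assumes I: "is_adic 2 I" and sub: "fst (adic_interval 2 k a) \<le> fst I" "snd I \<le> snd (adic_interval 2 k a)"
    and ne: "I \<noteq> adic_interval 2 k a"
  shows "snd I \<le> snd (adic_interval 2 (Suc k) (2 * a)) \<or> snd (adic_interval 2 (Suc k) (2 * a)) \<le> fst I"
proof -
  obtain j c where jc: "I = adic_interval 2 j c" using I unfolding is_adic_def by blast
  have *: "real a / 2 ^ k \<le> real c / 2 ^ j" "(real c + 1) / 2 ^ j \<le> (real a + 1) / 2 ^ k" using sub jc by auto
  have "1 / 2 ^ j = (real c + 1) / 2 ^ j - real c / (2::real) ^ j" by (simp add: add_divide_distrib)
  also have "\<dots> \<le> (real a + 1) / 2 ^ k - real a / 2 ^ k" using * by linarith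
  also have "\<dots> = 1 / 2 ^ k" by (simp add: add_divide_distrib)
  finally have "(2::real) ^ k \<le> 2 ^ j" by (simp add: divide_simps)
  then have "k \<le> j" by simp
  moreover have "k \<noteq> j"
  proof
    assume "k = j"
    then have "real a \<le> real c" "real c + 1 \<le> real a + 1" using * by (simp_all add: divide_simps)
    then show False using ne jc \<open>k = j\<close> by simp
  qed
  ultimately have "Suc k \<le> j" by simp
  then obtain i where i: "j = Suc k + i" using le_Suc_ex by blast
  have half: "snd (adic_interval 2 (Suc k) (2 * a)) = real ((2 * a + 1) * 2 ^ i) / 2 ^ j"
    unfolding i by (simp add: power_add field_simps)
  have I': "fst I = real c / 2 ^ j" "snd I = real (c + 1) / 2 ^ j" using jc by (simp_all add: add.commute)
  have "c + 1 \<le> (2 * a + 1) * 2 ^ i \<or> (2 * a + 1) * 2 ^ i \<le> c" by linarith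
  then have "real (c + 1) \<le> real ((2 * a + 1) * 2 ^ i) \<or> real ((2 * a + 1) * 2 ^ i) \<le> real c"
    by (simp only: of_nat_le_iff)
  then show ?thesis unfolding half I' by (auto intro!: divide_right_mono simp del: of_nat_add of_nat_mult)
qed

lemma chain_split:
  assumes "chain l r xs" "l \<le> m" "m \<le> r" "\<And>I. I \<in> set xs \<Longrightarrow> snd I \<le> m \<or> m \<le> fst I"
  shows "\<exists>ys zs. xs = ys @ zs \<and> chain l m ys \<and> chain m r zs"
  using assms
proof (induction xs arbitrary: l)
  case (Cons I xs)
  show ?case
  proof (cases "l = m")
    case True
    then have "I # xs = [] @ (I # xs) \<and> chain l m [] \<and> chain m r (I # xs)" using Cons.prems by simp
    then show ?thesis by blast
  next
    case False
    then have "snd I \<le> m" using Cons.prems(1,2) Cons.prems(4)[of I] by auto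
    then obtain ys zs where "xs = ys @ zs" "chain (snd I) m ys" "chain m r zs"
      using Cons.IH[of "snd I"] Cons.prems by auto
    then have "I # xs = (I # ys) @ zs \<and> chain l m (I # ys) \<and> chain m r zs" using Cons.prems(1) by simp
    then show ?thesis by blast
  qed
qed auto

text \<open>
  Unless the subdivision is trivial, none of its intervals crosses the midpoint. So it splits
  into subdivisions of the two halves, which come from trees by induction.
\<close>

lemma dyadic_chain_tree:
  assumes "chain (fst (adic_interval 2 k a)) (snd (adic_interval 2 k a)) xs"
    and "\<And>I. I \<in> set xs \<Longrightarrow> is_adic 2 I"
  shows "\<exists>T. subtree_leaves T k a = xs"
  using assms
proof (induction "length xs" arbitrary: xs k a rule: less_induct)
  case less
  let ?J = "adic_interval 2 k a" and ?m = "snd (adic_interval 2 (Suc k) (2 * a))"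
  have "fst ?J < snd ?J" by (rule adic_interval_less) simp
  moreover have "?m = (fst ?J + snd ?J) / 2" by (simp only: adic_interval_left_half snd_conv)
  moreover have "x < m \<and> m < y" if "x < y" "m = (x + y) / 2" for x y m :: real using that by simp
  ultimately have mid: "fst ?J < ?m" "?m < snd ?J" by blast+
  have ends: "fst (adic_interval 2 (Suc k) (2 * a)) = fst ?J"
      "fst (adic_interval 2 (Suc k) (Suc (2 * a))) = ?m" "snd (adic_interval 2 (Suc k) (Suc (2 * a))) = snd ?J"
    by (simp_all only: adic_interval_left_half adic_interval_right_half fst_conv snd_conv)
  show ?case
  proof (cases "?J \<in> set xs")
    case True
    then obtain ys zs where xs: "xs = ys @ ?J # zs" by (auto simp: in_set_conv_decomp)
    then have ch: "chain (fst ?J) (fst ?J) ys" "chain (snd ?J) (snd ?J) zs"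
      using less.prems(1) by (auto simp: chain_append)
    then have "ys = []" "zs = []" using chain_less less_irrefl by metis+
    then have "subtree_leaves Leaf k a = xs" using xs by simp
    then show ?thesis by blast
  next
    case False
    have "snd I \<le> ?m \<or> ?m \<le> fst I" if "I \<in> set xs" for I
      using dyadic_nested_half[of I k a] less.prems(2)[OF that] chain_members[OF less.prems(1) that] that False
      by metis
    then obtain ys zs where xs: "xs = ys @ zs" "chain (fst ?J) ?m ys" "chain ?m (snd ?J) zs"
      using chain_split[OF less.prems(1), of ?m] mid by (meson less_imp_le)
    have ne: "ys \<noteq> []" "zs \<noteq> []" using xs(2,3) mid by (metis chain.simps(1) less_irrefl)+
    obtain A where A: "subtree_leaves A (Suc k) (2 * a) = ys"
      using less.hyps[of ys "Suc k" "2 * a", unfolded ends] less.prems(2) xs ne by auto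
    obtain B where B: "subtree_leaves B (Suc k) (Suc (2 * a)) = zs"
      using less.hyps[of zs "Suc k" "Suc (2 * a)", unfolded ends] less.prems(2) xs ne by auto
    have "subtree_leaves (Node A B) k a = xs" using A B xs by simp
    then show ?thesis by blast
  qed
qed

definition tree_map :: "(real \<Rightarrow> real) \<Rightarrow> btree \<Rightarrow> btree \<Rightarrow> bool" where
  "tree_map f T T' \<longleftrightarrow> list_all2 (maps_linearly f) (leaf_intervals T 0 1) (leaf_intervals T' 0 1)"

lemma tree_map_subdivision: "tree_map f T T' \<Longrightarrow> subdivision_map 2 f (leaf_intervals T 0 1) (leaf_intervals T' 0 1)"
  by (auto simp: subdivision_map_def tree_map_def chain_leaf_intervals leaf_intervals_adic)

lemma tree_map_leaves: "tree_map f T T' \<Longrightarrow> leaves T = leaves T'"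
  using list_all2_lengthD length_leaf_intervals unfolding tree_map_def by metis

lemma tree_map_thompson: "f \<in> extensional {0..1} \<Longrightarrow> tree_map f T T' \<Longrightarrow> f \<in> carrier thompson_F"
  by (rule subdivision_map_thompson[OF _ _ tree_map_subdivision]) simp_all

lemma subdivision_tree_map:
  assumes "subdivision_map 2 f xs ys"
  obtains T T' where "tree_map f T T'" "leaf_intervals T 0 1 = xs" "leaf_intervals T' 0 1 = ys"
proof -
  note D = subdivision_mapD[OF assms]
  obtain T where T: "subtree_leaves T 0 0 = xs" using dyadic_chain_tree[of 0 0 xs] D by auto
  obtain T' where T': "subtree_leaves T' 0 0 = ys" using dyadic_chain_tree[of 0 0 ys] D by auto
  show ?thesis using that[of T T'] T T' D(5) by (simp add: tree_map_def subtree_leaves_unit)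
qed

lemma thompson_tree_map:
  assumes "f \<in> carrier thompson_F"
  obtains T T' where "tree_map f T T'"
proof -
  note fD = thompson_carrierD[OF assms]
  obtain xs ys where "subdivision_map 2 f xs ys"
    using grid_linear_subdivision[OF order_refl thompson_grid_linear[OF order_refl assms] fD(4,5)] .
  then show ?thesis by (rule subdivision_tree_map) (rule that)
qed

lemma list_all2_maps_comp:
  assumes "list_all2 (maps_linearly f) xs ys" "list_all2 (maps_linearly g) ys zs"
    and "chain l r xs" "chain l' r' ys" "\<And>x. x \<in> {l..r} \<Longrightarrow> h x = g (f x)"
  shows "list_all2 (maps_linearly h) xs zs"
  unfolding list_all2_conv_all_nth
proof (intro conjI allI impI)
  show "length xs = length zs" using assms(1,2) by (simp add: list_all2_lengthD)
  fix i assume i: "i < length xs"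
  then have mem: "xs ! i \<in> set xs" "ys ! i \<in> set ys"
    and maps: "maps_linearly f (xs ! i) (ys ! i)" "maps_linearly g (ys ! i) (zs ! i)"
    using assms by (auto simp: list_all2_conv_all_nth)
  have "maps_linearly (\<lambda>x. g (f x)) (xs ! i) (zs ! i)"
    by (rule maps_linearly_comp[OF maps chain_members(2)[OF assms(3) mem(1)] chain_members(2)[OF assms(4) mem(2)]])
  then show "maps_linearly h (xs ! i) (zs ! i)"
  proof (rule maps_linearly_cong)
    fix x assume "x \<in> {fst (xs ! i)..snd (xs ! i)}"
    then have "x \<in> {l..r}" using chain_members[OF assms(3) mem(1)] by simp
    then show "g (f x) = h x" by (simp add: assms(5))
  qed
qed

lemma tree_map_comp:
  assumes "tree_map f S T" "tree_map g T U"
  shows "tree_map (compose {0..1} g f) S U"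
  using assms list_all2_maps_comp[OF _ _ chain_leaf_intervals chain_leaf_intervals, of f S 0 1 T 0 1 g "leaf_intervals U 0 1" "compose {0..1} g f"]
  by (simp add: tree_map_def compose_def)

abbreviation (input) thompson_product :: "(real \<Rightarrow> real) \<Rightarrow> (real \<Rightarrow> real) \<Rightarrow> real \<Rightarrow> real"
    (infixl \<open>\<cdot>\<close> 70) where
  "f \<cdot> g \<equiv> f \<otimes>\<^bsub>thompson_F\<^esub> g"

lemma group_F: "group thompson_F"
  by (rule group_thompson) simp

lemma thompson_inv:
  assumes "f \<in> carrier thompson_F" "x \<in> {0..1}"
  shows "f ((inv\<^bsub>thompson_F\<^esub> f) x) = x" "(inv\<^bsub>thompson_F\<^esub> f) (f x) = x"
  using fun_cong[OF group.l_inv[OF group_F assms(1)], of x] fun_cong[OF group.r_inv[OF group_F assms(1)], of x] assms(2)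
  by (simp_all add: compose_def)

lemma tree_map_inv:
  assumes "f \<in> carrier thompson_F" "tree_map f S T"
  shows "tree_map (inv\<^bsub>thompson_F\<^esub> f) T S"
  using subdivision_map_inverse[OF tree_map_subdivision[OF assms(2)], of "inv\<^bsub>thompson_F\<^esub> f"] thompson_inv(2)[OF assms(1)]
  by (simp add: tree_map_def subdivision_map_def)

lemma tree_map_unique:
  assumes "f \<in> carrier thompson_F" "g \<in> carrier thompson_F" "tree_map f S T" "tree_map g S T"
  shows "f = g"
proof (rule extensionalityI)
  show "f \<in> extensional {0..1}" "g \<in> extensional {0..1}" using thompson_carrierD(1) assms by blast+
  fix x :: real assume x: "x \<in> {0..1}"
  show "f x = g x"
  proof (cases "x = 1")
    case True
    then show ?thesis using thompson_carrierD(5) assms by metis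
  next
    case False
    then obtain I where I: "I \<in> set (leaf_intervals S 0 1)" "x \<in> {fst I..snd I}"
      using chain_cover[OF chain_leaf_intervals, of 0 1 x S] x by auto
    then obtain i where i: "i < length (leaf_intervals S 0 1)" "I = leaf_intervals S 0 1 ! i" by (metis in_set_conv_nth)
    then have "maps_linearly f I (leaf_intervals T 0 1 ! i)" "maps_linearly g I (leaf_intervals T 0 1 ! i)"
      using assms(3,4) by (simp_all add: tree_map_def list_all2_conv_all_nth)
    then show ?thesis using I(2) by (simp add: maps_linearly_def)
  qed
qed

lemma maps_linearly_leaf_intervals:
  "maps_linearly f (l, r) (l', r') \<Longrightarrow> l < r \<Longrightarrow> list_all2 (maps_linearly f) (leaf_intervals T l r) (leaf_intervals T l' r')"
proof (induction T arbitrary: l r l' r')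
  case (Node A B)
  then have h: "maps_linearly f (l, (l + r) / 2) (l', (l' + r') / 2)" "maps_linearly f ((l + r) / 2, r) ((l' + r') / 2, r')"
    using maps_linearly_halves[of l r f l' r'] by auto
  have lt: "l < (l + r) / 2" "(l + r) / 2 < r" using Node.prems by auto
  show ?case using Node.IH(1)[OF h(1) lt(1)] Node.IH(2)[OF h(2) lt(2)] by (simp add: list_all2_appendI)
qed auto

lemma tree_map_one: "tree_map (\<lambda>t\<in>{0..1}. t) T T"
  unfolding tree_map_def by (rule maps_linearly_leaf_intervals) (auto simp: maps_linearly_def)

section \<open>Addition\<close>

lemma leaf_intervals_affine:
  "leaf_intervals T (c + d * l) (c + d * r) = map (\<lambda>I. (c + d * fst I, c + d * snd I)) (leaf_intervals T l r)"
proof (induction T arbitrary: l r)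
  case (Node A B)
  have "((c + d * l) + (c + d * r)) / 2 = c + d * ((l + r) / 2)" by (simp add: field_simps)
  then show ?case by (simp only: leaf_intervals.simps Node.IH map_append)
qed auto

lemma maps_linearly_affine:
  assumes f: "maps_linearly f I K" "fst I < snd I" and d: "d > 0"
    and g: "\<And>x. x \<in> {fst I..snd I} \<Longrightarrow> g (c + d * x) = c' + d' * f x"
  shows "maps_linearly g (c + d * fst I, c + d * snd I) (c' + d' * fst K, c' + d' * snd K)"
proof -
  obtain l r l' r' where IK: "I = (l, r)" "K = (l', r')" by fastforce
  have lr: "l < r" "c + d * l < c + d * r" using f(2) d IK by simp_all
  have "g (c + d * l + (c + d * r - (c + d * l)) * x) = c' + d' * l' + (c' + d' * r' - (c' + d' * l')) * x"
    if x: "x \<in> {0..1}" for x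
  proof -
    define z where "z = l + (r - l) * x"
    have "z \<in> {l..r}" unfolding z_def using affine_into[of l r x] lr x by simp
    then have "g (c + d * z) = c' + d' * f z" using g IK by simp
    also have "f z = l' + (r' - l') * x" unfolding z_def using f IK maps_linearly_iff lr x by blast
    also have "c + d * z = c + d * l + (c + d * r - (c + d * l)) * x" by (simp add: z_def algebra_simps)
    finally show ?thesis by (simp add: algebra_simps)
  qed
  then show ?thesis using IK maps_linearly_iff[OF lr(2)] by simp
qed

lemma list_all2_maps_affine:
  assumes "list_all2 (maps_linearly f) xs ys" "chain l r xs" "d > 0"
    and "\<And>x. x \<in> {l..r} \<Longrightarrow> g (c + d * x) = c' + d' * f x"
  shows "list_all2 (maps_linearly g) (map (\<lambda>I. (c + d * fst I, c + d * snd I)) xs)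
    (map (\<lambda>I. (c' + d' * fst I, c' + d' * snd I)) ys)"
  unfolding list_all2_map1 list_all2_map2
proof (rule list.rel_mono_strong[OF assms(1)])
  fix I K assume I: "I \<in> set xs" and f: "maps_linearly f I K"
  show "maps_linearly g (c + d * fst I, c + d * snd I) (c' + d' * fst K, c' + d' * snd K)"
    using chain_members[OF assms(2) I] by (intro maps_linearly_affine[OF f]) (auto intro!: assms(3,4))
qed

lemma thompson_sum_ext [simp]: "thompson_sum a b \<in> extensional {0..1}"
  by (simp add: thompson_sum_def)

lemma thompson_sum_left: "t \<in> {0..1/2} \<Longrightarrow> thompson_sum a b t = a (2 * t) / 2"
  by (simp add: thompson_sum_def)

lemma thompson_sum_right:
  assumes "a 1 = 1" "b 0 = 0" "t \<in> {1/2..1}"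
  shows "thompson_sum a b t = b (2 * t - 1) / 2 + 1 / 2"
proof (cases "t = 1 / 2")
  case True
  show ?thesis unfolding True using assms by (simp add: thompson_sum_def)
qed (use assms in \<open>auto simp: thompson_sum_def\<close>)

lemma tree_map_sum:
  assumes "tree_map a A A'" "tree_map b B B'" "a 1 = 1" "b 0 = 0"
  shows "tree_map (thompson_sum a b) (Node A B) (Node A' B')"
proof -
  have left: "leaf_intervals T 0 (1/2) = map (\<lambda>I. (0 + 1/2 * fst I, 0 + 1/2 * snd I)) (leaf_intervals T 0 1)" for T
    using leaf_intervals_affine[of T 0 "1/2" 0 1] by simp
  have right: "leaf_intervals T (1/2) 1 = map (\<lambda>I. (1/2 + 1/2 * fst I, 1/2 + 1/2 * snd I)) (leaf_intervals T 0 1)" for T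
    using leaf_intervals_affine[of T "1/2" "1/2" 0 1] by simp
  have "list_all2 (maps_linearly (thompson_sum a b)) (leaf_intervals A 0 (1/2)) (leaf_intervals A' 0 (1/2))"
    unfolding left using assms(1)
    by (intro list_all2_maps_affine[of a _ _ 0 1]) (auto simp: tree_map_def chain_leaf_intervals thompson_sum_left)
  moreover have "list_all2 (maps_linearly (thompson_sum a b)) (leaf_intervals B (1/2) 1) (leaf_intervals B' (1/2) 1)"
    unfolding right using assms
    by (intro list_all2_maps_affine[of b _ _ 0 1]) (auto simp: tree_map_def chain_leaf_intervals thompson_sum_right)
  ultimately show ?thesis by (simp add: tree_map_def list_all2_appendI)
qed

lemma thompson_sum_closed:
  assumes a: "a \<in> carrier thompson_F" and b: "b \<in> carrier thompson_F"
  shows "thompson_sum a b \<in> carrier thompson_F"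
proof -
  obtain A A' where A: "tree_map a A A'" using thompson_tree_map[OF a] .
  obtain B B' where B: "tree_map b B B'" using thompson_tree_map[OF b] .
  have "tree_map (thompson_sum a b) (Node A B) (Node A' B')"
    using A B thompson_carrierD(5)[OF a] thompson_carrierD(4)[OF b] by (intro tree_map_sum)
  then show ?thesis by (intro tree_map_thompson) auto
qed

lemma thompson_sum_mult:
  assumes "a \<in> carrier thompson_F" "b \<in> carrier thompson_F" "c \<in> carrier thompson_F" "d \<in> carrier thompson_F"
  shows "thompson_sum a b \<cdot> thompson_sum c d =
    thompson_sum (a \<cdot> c) (b \<cdot> d)"
proof (rule extensionalityI)
  fix t :: real assume t: "t \<in> {0..1}"
  show "(thompson_sum a b \<cdot> thompson_sum c d) t =
    thompson_sum (a \<cdot> c) (b \<cdot> d) t"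
  proof (cases "t \<le> 1/2")
    case True
    then have "a (2 * t) \<in> {0..1}" using t thompson_maps_unit[OF assms(1)] by auto
    then have "a (2 * t) / 2 \<in> {0..1/2}" by auto
    then show ?thesis using t True by (simp add: compose_def thompson_sum_left)
  next
    case False
    then have "b (2 * t - 1) \<in> {0..1}" using t thompson_maps_unit[OF assms(2)] by auto
    then have "b (2 * t - 1) / 2 + 1/2 \<in> {1/2..1}" by auto
    then have "thompson_sum c d (b (2 * t - 1) / 2 + 1/2) = d (2 * (b (2 * t - 1) / 2 + 1/2) - 1) / 2 + 1/2"
      using thompson_carrierD[OF assms(3)] thompson_carrierD[OF assms(4)] by (intro thompson_sum_right) auto
    moreover have "thompson_sum a b t = b (2 * t - 1) / 2 + 1/2" using t False by (simp add: thompson_sum_def)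
    moreover have "thompson_sum p q t = q (2 * t - 1) / 2 + 1/2" for p q using t False by (simp add: thompson_sum_def)
    ultimately show ?thesis using t False by (simp add: compose_def)
  qed
qed (simp_all add: compose_def)

section \<open>The standard generators\<close>

abbreviation thompson_id :: "real \<Rightarrow> real" where
  "thompson_id \<equiv> (\<lambda>t\<in>{0..1}. t)"

lemma thompson_id_closed: "thompson_id \<in> carrier thompson_F"
  by (rule thompson_one_closed) simp

lemma tree_map_x0: "tree_map thompson_x0 (Node (Node A B) C) (Node A (Node B C))"
proof -
  have "maps_linearly thompson_x0 (0, 1/4) (0, 1/2)" "maps_linearly thompson_x0 (1/4, 1/2) (1/2, 3/4)"
    by (auto simp: maps_linearly_def thompson_x0_def)
  moreover have "maps_linearly thompson_x0 (1/2, 1) (3/4, 1)"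
    unfolding maps_linearly_def
  proof
    fix x :: real assume "x \<in> {fst (1/2, 1)..snd (1/2, 1)}"
    then show "thompson_x0 x = fst (3/4, 1) + (snd (3/4, 1) - fst (3/4, 1)) / (snd (1/2, 1) - fst (1/2, 1)) * (x - fst (1/2, 1))"
      by (cases "x = 1/2") (simp_all add: thompson_x0_def field_simps)
  qed
  ultimately have "list_all2 (maps_linearly thompson_x0) (leaf_intervals A 0 (1/4)) (leaf_intervals A 0 (1/2))"
    "list_all2 (maps_linearly thompson_x0) (leaf_intervals B (1/4) (1/2)) (leaf_intervals B (1/2) (3/4))"
    "list_all2 (maps_linearly thompson_x0) (leaf_intervals C (1/2) 1) (leaf_intervals C (3/4) 1)"
    by (auto intro: maps_linearly_leaf_intervals)
  then show ?thesis by (simp add: tree_map_def list_all2_appendI)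
qed

lemma thompson_x0_closed: "thompson_x0 \<in> carrier thompson_F"
  by (rule tree_map_thompson[OF _ tree_map_x0]) (simp add: thompson_x0_def)

lemma thompson_x1_eq: "thompson_x1 = thompson_sum thompson_id thompson_x0"
  by (rule extensionalityI[of _ "{0..1}"])
    (auto simp: thompson_x1_def thompson_sum_def thompson_x0_def add_divide_distrib diff_divide_distrib)

text \<open>
  The map $x_0$ carries $[\frac12, 1]$ linearly onto $[\frac34, 1]$, so conjugation by $x_0$
  moves a map supported in the right half one step further to the right, that is, it acts as
  \<open>thompson_sum thompson_id\<close>.
\<close>

lemma sum_id_x0:
  assumes a: "a \<in> carrier thompson_F"
  defines "g \<equiv> thompson_sum thompson_id a"
  shows "g \<cdot> thompson_x0 = thompson_x0 \<cdot> thompson_sum thompson_id g"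
proof (rule extensionalityI)
  note aD = thompson_carrierD[OF a]
  have gl: "g t = t" if "t \<in> {0..1/2}" for t using that by (simp add: g_def thompson_sum_left)
  have gr: "g t = a (2 * t - 1) / 2 + 1/2" if "t \<in> {1/2..1}" for t
    using that aD by (simp add: g_def thompson_sum_right)
  have g0: "g 0 = 0" using gl by simp
  have hl: "thompson_sum thompson_id g t = t" if "t \<in> {0..1/2}" for t using that by (simp add: thompson_sum_left)
  have hr: "thompson_sum thompson_id g t = g (2 * t - 1) / 2 + 1/2" if "t \<in> {1/2..1}" for t
    using that g0 by (simp add: thompson_sum_right)
  fix t :: real assume t: "t \<in> {0..1}"
  consider "t \<le> 1/4" | "1/4 < t" "t \<le> 1/2" | "1/2 < t" by linarith
  then have "thompson_x0 (g t) = thompson_sum thompson_id g (thompson_x0 t)"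
  proof cases
    case 1
    then show ?thesis using t gl[of t] hl[of "2 * t"] by (simp add: thompson_x0_def)
  next
    case 2
    then show ?thesis using t gl[of t] hr[of "t + 1/4"] gl[of "2 * (t + 1/4) - 1"]
      by (simp add: thompson_x0_def field_simps)
  next
    case 3
    have "a (2 * t - 1) \<in> {0..1}" using t 3 by (intro thompson_maps_unit[OF a]) auto
    then have "g t \<in> {1/2..1}" using gr[of t] t 3 by simp
    then have "thompson_x0 (g t) = g t / 2 + 1/2" by (cases "g t = 1/2") (auto simp: thompson_x0_def)
    moreover have "thompson_x0 t = t / 2 + 1/2" using 3 t by (simp add: thompson_x0_def)
    ultimately show ?thesis using hr[of "t / 2 + 1/2"] t 3 by simp
  qed
  then show "(g \<cdot> thompson_x0) t = (thompson_x0 \<cdot> thompson_sum thompson_id g) t"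
    using t by (simp add: compose_def)
qed (simp_all add: compose_def)

lemma thompson_x_conj:
  "thompson_x (Suc i) = inv\<^bsub>thompson_F\<^esub> (thompson_x0 [^]\<^bsub>thompson_F\<^esub> i) \<cdot> thompson_x1
     \<cdot> (thompson_x0 [^]\<^bsub>thompson_F\<^esub> i)"
proof (cases i)
  case 0
  interpret group thompson_F by (rule group_F)
  have "thompson_x1 \<in> carrier thompson_F"
    unfolding thompson_x1_eq by (intro thompson_sum_closed thompson_id_closed thompson_x0_closed)
  moreover have "inv\<^bsub>thompson_F\<^esub> \<one>\<^bsub>thompson_F\<^esub> = \<one>\<^bsub>thompson_F\<^esub>" by (rule inv_one)
  ultimately show ?thesis using 0 l_one r_one by (simp only: nat_pow_0 thompson_x.simps One_nat_def)
qed simp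

text \<open>
  Since $x_{i+2} = x_0^{-1} x_{i+1} x_0$, the step is \<open>sum_id_x0\<close> applied to
  $x_{i+1} = 1 \oplus x_i$.
\<close>

lemma thompson_x_closed_and_shift:
  "thompson_x i \<in> carrier thompson_F \<and> thompson_x (Suc i) = thompson_sum thompson_id (thompson_x i)"
proof (induction i)
  case 0
  show ?case unfolding thompson_x.simps thompson_x1_eq using thompson_x0_closed by blast
next
  case (Suc i)
  interpret group thompson_F by (rule group_F)
  have cl: "thompson_x0 \<in> carrier thompson_F" "thompson_x1 \<in> carrier thompson_F"
      "thompson_x0 [^]\<^bsub>thompson_F\<^esub> i \<in> carrier thompson_F"
    unfolding thompson_x1_eq by (intro thompson_sum_closed thompson_id_closed thompson_x0_closed nat_pow_closed)+
  have si: "thompson_x (Suc i) \<in> carrier thompson_F"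
    using Suc thompson_sum_closed thompson_id_closed by metis
  have "thompson_x0 \<cdot> thompson_x (Suc (Suc i)) = thompson_x (Suc i) \<cdot> thompson_x0"
    unfolding thompson_x_conj[of "Suc i"] thompson_x_conj[of i] nat_pow_Suc
    using cl by (simp add: inv_mult_group m_assoc[symmetric] del: thompson_mult thompson_one)
  also have "\<dots> = thompson_x0 \<cdot> thompson_sum thompson_id (thompson_x (Suc i))"
    unfolding conjunct2[OF Suc] by (rule sum_id_x0[OF conjunct1[OF Suc]])
  finally have "thompson_x (Suc (Suc i)) = thompson_sum thompson_id (thompson_x (Suc i))"
    using cl si by (subst (asm) Units_l_cancel) (auto simp: thompson_x_conj[of "Suc i"] intro!: thompson_sum_closed thompson_id_closed
       simp del: thompson_mult thompson_one thompson_x.simps)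
  then show ?case using si by blast
qed

lemmas thompson_x_closed = thompson_x_closed_and_shift[THEN conjunct1]
lemmas thompson_x_Suc = thompson_x_closed_and_shift[THEN conjunct2]

declare thompson_x.simps(2,3) [simp del]

text \<open>
  The relations with $x_0$ are \<open>sum_id_x0\<close>; all others follow by applying the
  homomorphism $a \mapsto 1 \oplus a$.
\<close>

lemma thompson_x_relation:
  "i < j \<Longrightarrow> thompson_x j \<cdot> thompson_x i = thompson_x i \<cdot> thompson_x (Suc j)"
proof (induction i arbitrary: j)
  case 0
  then obtain k where j: "j = Suc k" by (cases j) auto
  show ?case unfolding j thompson_x_Suc[of "Suc k"] thompson_x_Suc[of k] thompson_x.simps(1)
    by (rule sum_id_x0[OF thompson_x_closed])
next
  case (Suc i)
  then obtain k where j: "j = Suc k" "i < k" by (cases j) auto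
  note cl = thompson_id_closed thompson_x_closed
  have "thompson_x j \<cdot> thompson_x (Suc i) =
      thompson_sum (thompson_id \<cdot> thompson_id) (thompson_x k \<cdot> thompson_x i)"
    unfolding j(1) thompson_x_Suc[of k] thompson_x_Suc[of i] by (rule thompson_sum_mult[OF cl cl])
  also have "\<dots> = thompson_sum (thompson_id \<cdot> thompson_id) (thompson_x i \<cdot> thompson_x (Suc k))"
    using Suc.IH[OF j(2)] by simp
  also have "\<dots> = thompson_x (Suc i) \<cdot> thompson_x (Suc j)"
    unfolding j(1) thompson_x_Suc[of "Suc k"] thompson_x_Suc[of i] by (rule thompson_sum_mult[OF cl cl, symmetric])
  finally show ?case .
qed

definition jones_gen :: "nat \<Rightarrow> real \<Rightarrow> real" where
  "jones_gen i = thompson_x i \<cdot> thompson_x (Suc i)"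

lemma jones_gen_closed: "jones_gen i \<in> carrier thompson_F"
  unfolding jones_gen_def by (rule monoid.m_closed[OF group.is_monoid[OF group_F] thompson_x_closed thompson_x_closed])

lemma jones_gen_Suc: "jones_gen (Suc i) = thompson_sum thompson_id (jones_gen i)"
proof -
  have "jones_gen (Suc i) = thompson_sum (thompson_id \<cdot> thompson_id) (jones_gen i)"
    unfolding jones_gen_def thompson_x_Suc[of "Suc i"]
    by (subst (1) thompson_x_Suc) (rule thompson_sum_mult[OF thompson_id_closed thompson_x_closed thompson_id_closed thompson_x_closed])
  moreover have "thompson_id \<cdot> thompson_id = thompson_id"
    using monoid.l_one[OF group.is_monoid[OF group_F] thompson_id_closed] by (simp only: thompson_one)
  ultimately show ?thesis by simp
qed

text \<open>
  Moving $x_0$ and then $x_1$ to the left past $x_j x_{j+1}$ raises both indices by one each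
  time.
\<close>

lemma jones_gen_relation:
  assumes "0 < j"
  shows "jones_gen j \<cdot> jones_gen 0 = jones_gen 0 \<cdot> jones_gen (Suc (Suc j))"
proof -
  interpret group thompson_F by (rule group_F)
  define x where "x = thompson_x"
  have cl: "x i \<in> carrier thompson_F" for i by (simp add: x_def thompson_x_closed)
  have swap: "x k \<cdot> x i = x i \<cdot> x (Suc k)" if "i < k" for i k
    using thompson_x_relation[OF that] by (simp add: x_def)
  have swap': "x k \<cdot> (x i \<cdot> z) = x i \<cdot> (x (Suc k) \<cdot> z)"
    if "i < k" "z \<in> carrier thompson_F" for i k z
    using swap[OF that(1)] that(2) cl m_assoc by metis
  note [simp del] = thompson_mult thompson_one
  have "jones_gen j \<cdot> jones_gen 0 = x j \<cdot> (x (Suc j) \<cdot> (x 0 \<cdot> x 1))"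
    using cl unfolding jones_gen_def x_def[symmetric] by (simp add: m_assoc)
  also have "\<dots> = x j \<cdot> (x 0 \<cdot> (x (Suc (Suc j)) \<cdot> x 1))"
    using cl swap' by simp
  also have "\<dots> = x 0 \<cdot> (x (Suc j) \<cdot> (x (Suc (Suc j)) \<cdot> x 1))"
    using cl swap' assms by simp
  also have "\<dots> = x 0 \<cdot> (x (Suc j) \<cdot> (x 1 \<cdot> x (Suc (Suc (Suc j)))))"
    using swap by simp
  also have "\<dots> = x 0 \<cdot> (x 1 \<cdot> (x (Suc (Suc j)) \<cdot> x (Suc (Suc (Suc j)))))"
    using cl swap' assms by simp
  also have "\<dots> = jones_gen 0 \<cdot> jones_gen (Suc (Suc j))"
    using cl unfolding jones_gen_def x_def[symmetric] by (simp add: m_assoc)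
  finally show ?thesis .
qed

abbreviation jones_generators :: "(real \<Rightarrow> real) set" where
  "jones_generators \<equiv> {jones_gen 0, jones_gen 1, jones_gen 2}"

definition jones_generated :: "(real \<Rightarrow> real) set" where
  "jones_generated = generate thompson_F jones_generators"

lemma jones_generated_subgroup: "subgroup jones_generated thompson_F"
  unfolding jones_generated_def by (rule group.generate_is_subgroup[OF group_F]) (auto simp: jones_gen_closed)

lemma jones_gen_generated: "jones_gen j \<in> jones_generated"
proof (induction j rule: less_induct)
  case (less j)
  interpret group thompson_F by (rule group_F)
  consider "j = 0" | "j = 1" | "j = 2" | k where "j = Suc (Suc k)" "0 < k"
    by (metis One_nat_def gr0I numeral_2_eq_2 old.nat.exhaust)
  then show ?case
  proof cases
    case (4 k)
    have "jones_gen j = inv\<^bsub>thompson_F\<^esub> jones_gen 0 \<cdot> (jones_gen k \<cdot> jones_gen 0)"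
      unfolding jones_gen_relation[OF 4(2)] 4(1) using jones_gen_closed by (simp add: m_assoc[symmetric] del: thompson_mult thompson_one)
    then show ?thesis
      using less.IH[of 0] less.IH[of k] 4(1) subgroup.m_closed[OF jones_generated_subgroup]
        subgroup.m_inv_closed[OF jones_generated_subgroup] by simp
  qed (auto simp: jones_generated_def intro!: generate.incl)
qed

section \<open>Vines and ternary trees\<close>

text \<open>
  A right comb with the given trees at its ends. A single tree stands for itself, so that a list
  of $n$ trees is attached to the comb with $n$ leaves; consequently the last tree may be merged
  with the comb (\<open>vine_last\<close>).
\<close>

fun vine :: "btree list \<Rightarrow> btree" where
  "vine [] = Leaf"
| "vine [T] = T"
| "vine (T # U # Us) = Node T (vine (U # Us))"

lemma vine_Cons: "Us \<noteq> [] \<Longrightarrow> vine (T # Us) = Node T (vine Us)"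
  by (cases Us) auto

lemma vine_last: "vine (Ts @ [Node A B]) = vine (Ts @ [A, B])"
  by (induction Ts) (auto simp: vine_Cons)

text \<open>
  The element $x_i$ removes the caret at the root of the tree at position $i$ and spreads its
  two subtrees over two positions. At the last position both combs are the same tree
  (\<open>vine_last\<close>), so there the identity takes the place of $x_i$.
\<close>

lemma tree_map_x:
  assumes "Us \<noteq> []"
  shows "tree_map (thompson_x (length Ts)) (vine (Ts @ Node A B # Us)) (vine (Ts @ A # B # Us))"
proof (induction Ts)
  case Nil
  then show ?case using assms tree_map_x0 by (simp add: vine_Cons)
next
  case (Cons T Ts)
  show ?case
    using tree_map_sum[OF tree_map_one Cons.IH, of T] thompson_carrierD(4)[OF thompson_x_closed]
    by (simp add: vine_Cons thompson_x_Suc)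
qed

lemma tree_map_mult:
  "tree_map f S T \<Longrightarrow> tree_map g T U \<Longrightarrow> tree_map (f \<cdot> g) S U"
  unfolding thompson_mult by (rule tree_map_comp)

lemma tree_map_jones_gen:
  assumes "Us \<noteq> []"
  shows "tree_map (jones_gen (length Ts)) (vine (Ts @ Node A (Node B C) # Us)) (vine (Ts @ A # B # C # Us))"
  unfolding jones_gen_def
proof (rule tree_map_mult)
  show "tree_map (thompson_x (length Ts)) (vine (Ts @ Node A (Node B C) # Us)) (vine (Ts @ A # Node B C # Us))"
    using assms by (rule tree_map_x)
  show "tree_map (thompson_x (Suc (length Ts))) (vine (Ts @ A # Node B C # Us)) (vine (Ts @ A # B # C # Us))"
    using tree_map_x[OF assms, of "Ts @ [A]" B C] by simp
qed

text \<open>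
  The ternary caret halves an interval and then halves its right half.
\<close>

inductive ternary :: "btree \<Rightarrow> bool" where
  ternary_Leaf: "ternary Leaf"
| ternary_Node: "ternary A \<Longrightarrow> ternary B \<Longrightarrow> ternary C \<Longrightarrow> ternary (Node A (Node B C))"

text \<open>
  The root caret is opened by a generator, or by nothing at the last position. The three
  subtrees are then unfolded from right to left, so that the list in front of the tree in
  question, and with it the index of the generator, stays the same.
\<close>

lemma ternary_to_vine:
  "ternary T \<Longrightarrow> \<exists>h\<in>jones_generated. tree_map h (vine (Ts @ T # Us)) (vine (Ts @ replicate (leaves T) Leaf @ Us))"
proof (induction T arbitrary: Ts Us rule: ternary.induct)
  case ternary_Leaf
  have "thompson_id \<in> jones_generated"
    using subgroup.one_closed[OF jones_generated_subgroup] by simp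
  then show ?case using tree_map_one by auto
next
  case (ternary_Node A B C)
  note m_closed = subgroup.m_closed[OF jones_generated_subgroup]
  let ?a = "replicate (leaves A) Leaf" and ?b = "replicate (leaves B) Leaf" and ?c = "replicate (leaves C) Leaf"
  have "\<exists>h\<in>jones_generated. tree_map h (vine (Ts @ Node A (Node B C) # Us)) (vine (Ts @ A # B # C # Us))"
  proof (cases "Us = []")
    case True
    have "vine (Ts @ Node A (Node B C) # Us) = vine (Ts @ A # B # C # Us)"
      using True vine_last[of Ts A "Node B C"] vine_last[of "Ts @ [A]" B C] by simp
    then show ?thesis using tree_map_one subgroup.one_closed[OF jones_generated_subgroup] by auto
  next
    case False
    then show ?thesis using tree_map_jones_gen jones_gen_generated by blast
  qed
  then obtain h0 where h0: "h0 \<in> jones_generated" "tree_map h0 (vine (Ts @ Node A (Node B C) # Us)) (vine (Ts @ A # B # C # Us))" by blast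
  obtain h1 where h1: "h1 \<in> jones_generated" "tree_map h1 (vine (Ts @ A # B # C # Us)) (vine (Ts @ A # B # ?c @ Us))"
    using ternary_Node.IH(3)[of "Ts @ [A, B]" Us] by auto
  obtain h2 where h2: "h2 \<in> jones_generated" "tree_map h2 (vine (Ts @ A # B # ?c @ Us)) (vine (Ts @ A # ?b @ ?c @ Us))"
    using ternary_Node.IH(2)[of "Ts @ [A]" "?c @ Us"] by auto
  obtain h3 where h3: "h3 \<in> jones_generated" "tree_map h3 (vine (Ts @ A # ?b @ ?c @ Us)) (vine (Ts @ ?a @ ?b @ ?c @ Us))"
    using ternary_Node.IH(1)[of Ts "?b @ ?c @ Us"] by auto
  let ?h = "h0 \<cdot> h1 \<cdot> h2 \<cdot> h3"
  have "?h \<in> jones_generated" by (intro m_closed h0 h1 h2 h3)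
  moreover have "tree_map ?h (vine (Ts @ Node A (Node B C) # Us)) (vine (Ts @ ?a @ ?b @ ?c @ Us))"
    by (rule tree_map_mult[OF tree_map_mult[OF tree_map_mult[OF h0(2) h1(2)] h2(2)] h3(2)])
  moreover have "?a @ ?b @ ?c @ Us = replicate (leaves (Node A (Node B C))) Leaf @ Us"
    by (simp add: replicate_add)
  ultimately show ?case by metis
qed

lemma ternary_map_generated:
  assumes f: "f \<in> carrier thompson_F" "tree_map f S T" and S: "ternary S" and T: "ternary T"
  shows "f \<in> jones_generated"
proof -
  interpret group thompson_F by (rule group_F)
  note sub = subgroup.subset[OF jones_generated_subgroup]
  obtain g where g: "g \<in> jones_generated" "tree_map g S (vine (replicate (leaves S) Leaf))"
    using ternary_to_vine[OF S, of "[]" "[]"] by auto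
  obtain h where h: "h \<in> jones_generated" "tree_map h T (vine (replicate (leaves S) Leaf))"
    using ternary_to_vine[OF T, of "[]" "[]"] tree_map_leaves[OF f(2)] by auto
  have "tree_map (g \<cdot> inv\<^bsub>thompson_F\<^esub> h) S T"
    using g h sub by (intro tree_map_mult[OF g(2)] tree_map_inv) auto
  moreover have mem: "g \<cdot> inv\<^bsub>thompson_F\<^esub> h \<in> jones_generated"
    using g h by (intro subgroup.m_closed[OF jones_generated_subgroup] subgroup.m_inv_closed[OF jones_generated_subgroup])
  ultimately have "f = g \<cdot> inv\<^bsub>thompson_F\<^esub> h"
    using sub f by (intro tree_map_unique[of f _ S T]) auto
  then show ?thesis using mem by simp
qed

fun alternates :: "bool \<Rightarrow> bool list \<Rightarrow> bool" where
  "alternates b [] \<longleftrightarrow> True"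
| "alternates b (p # ps) \<longleftrightarrow> p = b \<and> alternates (\<not> b) ps"

lemma alternates_append:
  "alternates b (ps @ qs) \<longleftrightarrow> alternates b ps \<and> alternates (b \<noteq> odd (length ps)) qs"
proof (induction ps arbitrary: b)
  case (Cons p ps)
  have "((\<not> b) \<noteq> odd (length ps)) = (b \<noteq> odd (length (p # ps)))" by (cases b) simp_all
  then show ?case by (simp only: append_Cons alternates.simps Cons.IH conj_assoc)
qed simp

definition parities :: "(real \<times> real) list \<Rightarrow> bool list" where
  "parities xs = map (\<lambda>I. fst I \<in> odd_dyadics) xs"

lemma parities_append [simp]: "parities (xs @ ys) = parities xs @ parities ys"
  and length_parities [simp]: "length (parities xs) = length xs"
  by (simp_all add: parities_def)

lemma length_subtree_leaves [simp]: "length (subtree_leaves T k a) = leaves T"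
  by (simp add: subtree_leaves_def)

lemma odd_dyadics_iff_numeral: "real a / real 2 ^ k \<in> odd_dyadics \<longleftrightarrow> odd_ones a"
  using odd_dyadics_iff[of a k] by simp

lemma parities_start: "\<exists>ps. parities (subtree_leaves T k a) = odd_ones a # ps"
proof (induction T arbitrary: k a)
  case Leaf
  then show ?case by (simp add: parities_def)
next
  case (Node A B)
  obtain ps where "parities (subtree_leaves A (Suc k) (2 * a)) = odd_ones (2 * a) # ps" using Node.IH(1) by blast
  then show ?case by simp
qed

lemma ternary_alternates:
  "ternary T \<Longrightarrow> odd (leaves T) \<and> alternates (odd_ones a) (parities (subtree_leaves T k a))"
proof (induction T arbitrary: k a rule: ternary.induct)
  case ternary_Leaf
  then show ?case by (simp add: parities_def)
next
  case (ternary_Node A B C)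
  show ?case
    using ternary_Node.IH(1)[of "2 * a" "Suc k"] ternary_Node.IH(2)[of "2 * Suc (2 * a)" "Suc (Suc k)"]
      ternary_Node.IH(3)[of "Suc (2 * Suc (2 * a))" "Suc (Suc k)"]
    by (simp add: alternates_append del: mult_Suc_right)
qed

text \<open>
  The left end of the right subtree has the parity opposite to that of the whole interval. For
  an alternating sequence this says that the left subtree has an odd number of leaves, hence is
  ternary. The right subtree is again alternating: if its number of leaves is odd, both subtrees
  are ternary and the total is even; if it is even, the right subtree itself is a pair of
  ternary trees, and the whole tree has a ternary caret at the root.
\<close>

lemma alternates_ternary:
  assumes "alternates (odd_ones a) (parities (subtree_leaves T k a))"
  shows "if odd (leaves T) then ternary T else \<exists>A B. T = Node A B \<and> ternary A \<and> ternary B"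
  using assms
proof (induction T arbitrary: k a)
  case Leaf
  then show ?case by (simp add: ternary_Leaf)
next
  case (Node A B)
  have A: "alternates (odd_ones (2 * a)) (parities (subtree_leaves A (Suc k) (2 * a)))"
    and B: "alternates (odd_ones a \<noteq> odd (leaves A)) (parities (subtree_leaves B (Suc k) (Suc (2 * a))))"
    using Node.prems by (simp_all add: alternates_append)
  have oddA: "odd (leaves A)"
    using B parities_start[of B "Suc k" "Suc (2 * a)"] by auto
  then have tA: "ternary A" using Node.IH(1)[OF A] by simp
  have "alternates (odd_ones (Suc (2 * a))) (parities (subtree_leaves B (Suc k) (Suc (2 * a))))"
    using B oddA by simp
  from Node.IH(2)[OF this] show ?case
    using oddA tA by (auto split: if_splits intro: ternary_Node)
qed

fun full_ternary :: "nat \<Rightarrow> btree" where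
  "full_ternary 0 = Leaf"
| "full_ternary (Suc n) = Node (full_ternary n) (Node (full_ternary n) (full_ternary n))"

lemma ternary_full: "ternary (full_ternary n)"
  by (induction n) (auto intro: ternary.intros)

lemma full_ternary_levels:
  "I \<in> set (subtree_leaves (full_ternary n) k a) \<Longrightarrow> a < 2 ^ k \<Longrightarrow> \<exists>j\<ge>k + n. \<exists>c<2 ^ j. I = adic_interval 2 j c"
proof (induction n arbitrary: k a)
  case (Suc n)
  then consider "I \<in> set (subtree_leaves (full_ternary n) (Suc k) (2 * a))"
    | "I \<in> set (subtree_leaves (full_ternary n) (Suc (Suc k)) (2 * Suc (2 * a)))"
    | "I \<in> set (subtree_leaves (full_ternary n) (Suc (Suc k)) (Suc (2 * Suc (2 * a))))" by auto
  then show ?case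
  proof cases
    case 1
    then show ?thesis using Suc.IH[of "Suc k" "2 * a"] Suc.prems(2) by auto
  next
    case 2
    from Suc.IH[OF this] have "\<exists>j\<ge>Suc (Suc k) + n. \<exists>c<2 ^ j. I = adic_interval 2 j c" using Suc.prems(2) by simp
    then show ?thesis by (metis add_Suc_right add_Suc_shift Suc_leD)
  next
    case 3
    from Suc.IH[OF this] have "\<exists>j\<ge>Suc (Suc k) + n. \<exists>c<2 ^ j. I = adic_interval 2 j c" using Suc.prems(2) by simp
    then show ?thesis by (metis add_Suc_right add_Suc_shift Suc_leD)
  qed
qed auto

section \<open>The stabilizer of the parity of digit sums\<close>

definition parity_stabilizer :: "(real \<Rightarrow> real) set" where
  "parity_stabilizer =
    {f \<in> carrier thompson_F. \<forall>x\<in>{0..1}. f x \<in> odd_dyadics \<longleftrightarrow> x \<in> odd_dyadics}"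

text \<open>
  On each interval both the offset from the left end and the parity of the left end are kept, so
  \<open>odd_dyadics_same_offset\<close> applies; it remains the point 1, which is fixed.
\<close>

lemma subdivision_parity_stabilizer:
  assumes f: "f \<in> extensional {0..1}" and map: "subdivision_map 2 f xs ys" and par: "parities xs = parities ys"
  shows "f \<in> parity_stabilizer"
proof -
  note D = subdivision_mapD[OF map]
  have car: "f \<in> carrier thompson_F" using subdivision_map_thompson[OF _ f map] by simp
  have "f x \<in> odd_dyadics \<longleftrightarrow> x \<in> odd_dyadics" if x: "x \<in> {0..1}" for x
  proof (cases "x = 1")
    case True
    then show ?thesis using thompson_carrierD(5)[OF car] by simp
  next
    case False
    then obtain I where I: "I \<in> set xs" "fst I \<le> x" "x < snd I" using chain_cover[OF D(1), of x] x by auto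
    then obtain i where i: "i < length xs" "I = xs ! i" by (metis in_set_conv_nth)
    define K where "K = ys ! i"
    have len: "length ys = length xs" using D(5) by (simp add: list_all2_lengthD)
    have K: "K \<in> set ys" "maps_linearly f I K" using D(5) i len by (auto simp: K_def list_all2_conv_all_nth)
    obtain k a where a: "I = adic_interval 2 k a" using D(2)[OF I(1)] unfolding is_adic_def by blast
    obtain m b where b: "K = adic_interval 2 m b" using D(4)[OF K(1)] unfolding is_adic_def by blast
    have "parities xs ! i = parities ys ! i" using par by simp
    then have "fst I \<in> odd_dyadics \<longleftrightarrow> fst K \<in> odd_dyadics" using i len by (simp add: parities_def K_def)
    then have ab: "odd_ones a = odd_ones b" using a b by simp
    define y where "y = x * 2 ^ k - real a"
    have y: "0 \<le> y" "y < 1" "x = (real a + y) / 2 ^ k" using I(2,3) a by (simp_all add: y_def field_simps)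
    have "f x = (real b + y) / 2 ^ m" using K(2) y unfolding a b by (simp add: maps_linearly_adic)
    then show ?thesis using odd_dyadics_same_offset[OF y(1,2) ab, of k m] y(3) by simp
  qed
  then show ?thesis using car by (simp add: parity_stabilizer_def)
qed

lemma stabilizer_subdivision_parities:
  assumes "f \<in> parity_stabilizer" "chain 0 1 xs" "list_all2 (maps_linearly f) xs ys"
  shows "parities xs = parities ys"
proof (rule nth_equalityI)
  show len: "length (parities xs) = length (parities ys)" using assms(3) by (simp add: list_all2_lengthD)
  fix i assume i: "i < length (parities xs)"
  then have I: "xs ! i \<in> set xs" "maps_linearly f (xs ! i) (ys ! i)" using assms(3) by (auto simp: list_all2_conv_all_nth)
  have b: "0 \<le> fst (xs ! i)" "fst (xs ! i) < snd (xs ! i)" "snd (xs ! i) \<le> 1" using chain_members[OF assms(2) I(1)] .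
  then have "f (fst (xs ! i)) = fst (ys ! i)" using maps_linearly_ends[OF I(2)] by simp
  moreover have "f (fst (xs ! i)) \<in> odd_dyadics \<longleftrightarrow> fst (xs ! i) \<in> odd_dyadics"
    using assms(1) b by (simp add: parity_stabilizer_def)
  ultimately show "parities xs ! i = parities ys ! i" using i len by (simp add: parities_def)
qed

lemma parity_stabilizer_subgroup: "subgroup parity_stabilizer thompson_F"
proof -
  interpret group thompson_F by (rule group_F)
  show ?thesis
  proof (rule subgroupI)
    have "\<one>\<^bsub>thompson_F\<^esub> \<in> parity_stabilizer"
      using one_closed by (simp add: parity_stabilizer_def)
    then show "parity_stabilizer \<noteq> {}" by blast
  next
    fix f assume f: "f \<in> parity_stabilizer"
    then have car: "f \<in> carrier thompson_F" by (simp add: parity_stabilizer_def)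
    have "(inv\<^bsub>thompson_F\<^esub> f) x \<in> odd_dyadics \<longleftrightarrow> x \<in> odd_dyadics" if x: "x \<in> {0..1}" for x
    proof -
      have "(inv\<^bsub>thompson_F\<^esub> f) x \<in> {0..1}" using thompson_maps_unit[OF inv_closed[OF car] x] .
      then have "f ((inv\<^bsub>thompson_F\<^esub> f) x) \<in> odd_dyadics \<longleftrightarrow> (inv\<^bsub>thompson_F\<^esub> f) x \<in> odd_dyadics"
        using f by (simp add: parity_stabilizer_def)
      then show ?thesis using thompson_inv(1)[OF car x] by simp
    qed
    then show "inv\<^bsub>thompson_F\<^esub> f \<in> parity_stabilizer" using inv_closed[OF car] by (simp add: parity_stabilizer_def)
  next
    fix f g assume fg: "f \<in> parity_stabilizer" "g \<in> parity_stabilizer"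
    then have car: "f \<in> carrier thompson_F" "g \<in> carrier thompson_F" by (simp_all add: parity_stabilizer_def)
    then have "f \<cdot> g \<in> carrier thompson_F" by (rule m_closed)
    moreover have "f x \<in> {0..1}" if "x \<in> {0..1}" for x using thompson_maps_unit[OF car(1) that] .
    ultimately show "f \<cdot> g \<in> parity_stabilizer"
      using fg by (simp add: parity_stabilizer_def compose_def)
  qed (auto simp: parity_stabilizer_def)
qed

lemma tree_map_stabilizer:
  assumes "f \<in> extensional {0..1}" "tree_map f T T'" "parities (leaf_intervals T 0 1) = parities (leaf_intervals T' 0 1)"
  shows "f \<in> parity_stabilizer"
  using subdivision_parity_stabilizer[OF assms(1) tree_map_subdivision[OF assms(2)] assms(3)] .

lemma tree_map_parities:
  assumes "f \<in> parity_stabilizer" "tree_map f T T'"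
  shows "parities (leaf_intervals T 0 1) = parities (leaf_intervals T' 0 1)"
  using stabilizer_subdivision_parities[OF assms(1) chain_leaf_intervals] assms(2) by (simp add: tree_map_def)

text \<open>
  Inside a dyadic interval with number \<open>a\<close> the digits of \<open>a\<close> precede
  all others, so the pattern of parities is that of the unit interval, flipped if
  \<open>a\<close> is odd.
\<close>

lemma parities_subtree: "parities (subtree_leaves T k a) = map (\<lambda>p. p \<noteq> odd_ones a) (parities (leaf_intervals T 0 1))"
proof -
  have gen: "a < 2 ^ i \<Longrightarrow> parities (subtree_leaves T (k + i) (b * 2 ^ i + a)) = map (\<lambda>p. p \<noteq> odd_ones b) (parities (subtree_leaves T i a))" for i a b
  proof (induction T arbitrary: i a)
    case Leaf
    show ?case
      by (simp only: subtree_leaves_Leaf parities_def list.map fst_adic_interval odd_dyadics_iff_numeral odd_ones_concat[OF Leaf])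
        blast
  next
    case (Node A B)
    have e: "2 * (b * 2 ^ i + a) = b * 2 ^ Suc i + 2 * a" "Suc (2 * (b * 2 ^ i + a)) = b * 2 ^ Suc i + Suc (2 * a)" by auto
    show ?case
      using Node.IH(1)[of "2 * a" "Suc i"] Node.IH(2)[of "Suc (2 * a)" "Suc i"] Node.prems
      by (simp only: subtree_leaves_Node parities_append map_append e) simp
  qed
  show ?thesis using gen[of 0 0 a] by (simp add: subtree_leaves_unit)
qed

lemma parity_stabilizer_sum:
  assumes a: "a \<in> parity_stabilizer" and b: "b \<in> parity_stabilizer"
  shows "thompson_sum a b \<in> parity_stabilizer"
proof -
  have car: "a \<in> carrier thompson_F" "b \<in> carrier thompson_F" using a b by (simp_all add: parity_stabilizer_def)
  obtain A A' where A: "tree_map a A A'" using thompson_tree_map[OF car(1)] .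
  obtain B B' where B: "tree_map b B B'" using thompson_tree_map[OF car(2)] .
  have "tree_map (thompson_sum a b) (Node A B) (Node A' B')"
    using A B thompson_carrierD(5)[OF car(1)] thompson_carrierD(4)[OF car(2)] by (intro tree_map_sum)
  moreover have "parities (leaf_intervals (Node A B) 0 1) = parities (leaf_intervals (Node A' B') 0 1)"
    using tree_map_parities[OF a A] tree_map_parities[OF b B]
      parities_subtree[of A 1 0] parities_subtree[of A' 1 0] parities_subtree[of B 1 1] parities_subtree[of B' 1 1]
    by (simp flip: subtree_leaves_unit)
  ultimately show ?thesis by (rule tree_map_stabilizer[OF thompson_sum_ext])
qed

lemma jones_gen_stabilizer: "jones_gen i \<in> parity_stabilizer"
proof (induction i)
  case 0
  \<comment> \<open>Both subdivisions have left ends of parity even, odd, even, odd.\<close>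
  let ?S = "Node (Node Leaf (Node Leaf Leaf)) Leaf" and ?T = "Node Leaf (Node Leaf (Node Leaf Leaf))"
  have "tree_map (jones_gen 0) ?S ?T"
    using tree_map_jones_gen[of "[Leaf]" "[]" Leaf Leaf Leaf] by simp
  moreover have "parities (subtree_leaves ?S 0 0) = parities (subtree_leaves ?T 0 0)"
  proof -
    have "odd_ones 1" "\<not> odd_ones 3" "odd_ones 7" by (simp_all add: odd_ones.simps)
    then have "1 / 2 \<in> odd_dyadics" "1 / 4 \<in> odd_dyadics" "3 / 8 \<notin> odd_dyadics" "3 / 4 \<notin> odd_dyadics" "7 / 8 \<in> odd_dyadics"
      using odd_dyadics_iff[of 1 1] odd_dyadics_iff[of 1 2] odd_dyadics_iff[of 3 3] odd_dyadics_iff[of 3 2]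
        odd_dyadics_iff[of 7 3] by simp_all
    then show ?thesis by (simp add: parities_def)
  qed
  ultimately show ?case
    unfolding subtree_leaves_unit by (rule tree_map_stabilizer[OF thompson_carrierD(1)[OF jones_gen_closed]])
next
  case (Suc i)
  have "thompson_id \<in> parity_stabilizer" using subgroup.one_closed[OF parity_stabilizer_subgroup] by simp
  then show ?case unfolding jones_gen_Suc using Suc by (intro parity_stabilizer_sum)
qed

text \<open>
  A sufficiently fine ternary tree is mapped to a subdivision into dyadic intervals. Its
  parities are those of the ternary tree, hence alternate, so the image is given by a ternary
  tree as well, and both trees can be carried to the same comb.
\<close>

theorem parity_stabilizer_generated: "parity_stabilizer = jones_generated"
proof
  show "jones_generated \<subseteq> parity_stabilizer"
    unfolding jones_generated_def using jones_gen_stabilizer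
    by (intro group.generate_subgroup_incl[OF group_F _ parity_stabilizer_subgroup]) auto
  show "parity_stabilizer \<subseteq> jones_generated"
  proof
    fix f assume f: "f \<in> parity_stabilizer"
    then have car: "f \<in> carrier thompson_F" by (simp add: parity_stabilizer_def)
    note fD = thompson_carrierD[OF car]
    obtain N where N: "\<And>k a. k \<ge> N \<Longrightarrow> a < 2 ^ k \<Longrightarrow> \<exists>m b. maps_linearly f (adic_interval 2 k a) (adic_interval 2 m b)"
      using thompson_grid_linear[OF order_refl car] unfolding grid_linear_def by metis
    let ?S = "full_ternary N"
    have "\<exists>ys. chain (f 0) (f 1) ys \<and> list_all2 (maps_linearly f) (leaf_intervals ?S 0 1) ys \<and> (\<forall>K\<in>set ys. is_adic 2 K)"
    proof (rule image_chain)
      fix I assume "I \<in> set (leaf_intervals ?S 0 1)"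
      then obtain j c where "j \<ge> N" "c < 2 ^ j" "I = adic_interval 2 j c"
        using full_ternary_levels[of I N 0 0] by (auto simp: subtree_leaves_unit)
      then show "\<exists>K. is_adic 2 K \<and> maps_linearly f I K" using N[of j c] is_adic_interval by metis
    qed (simp_all add: chain_leaf_intervals)
    then obtain ys where ys: "chain 0 1 ys" "list_all2 (maps_linearly f) (leaf_intervals ?S 0 1) ys" "\<forall>K\<in>set ys. is_adic 2 K"
      using fD by auto
    obtain T where T: "subtree_leaves T 0 0 = ys" using dyadic_chain_tree[of 0 0 ys] ys by auto
    have map: "tree_map f ?S T" using ys T by (simp add: tree_map_def subtree_leaves_unit)
    have "alternates (odd_ones 0) (parities (subtree_leaves T 0 0))"
      using ternary_alternates[OF ternary_full, of N 0 0] tree_map_parities[OF f map] by (simp add: subtree_leaves_unit)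
    moreover have "odd (leaves T)"
      using ternary_alternates[OF ternary_full, of N 0 0] tree_map_leaves[OF map] by simp
    ultimately have "ternary T" using alternates_ternary[of 0 T 0] by simp
    then show "f \<in> jones_generated" using ternary_map_generated[OF car map ternary_full] by blast
  qed
qed

section \<open>Structure of diagrams\<close>

fun path_between :: "nat \<Rightarrow> nat \<Rightarrow> path \<Rightarrow> bool" where
  "path_between u v [] \<longleftrightarrow> u = v"
| "path_between u v (e # p) \<longleftrightarrow> source e = u \<and> path_between (target e) v p"

lemma path_between_append: "path_between u w (p @ q) \<longleftrightarrow> (\<exists>v. path_between u v p \<and> path_between v w q)"
  by (induction p arbitrary: u) auto

lemma path_between_hd: "path_between u v p \<Longrightarrow> p \<noteq> [] \<Longrightarrow> source (hd p) = u"
  by (cases p) auto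

lemma path_between_last: "path_between u v p \<Longrightarrow> p \<noteq> [] \<Longrightarrow> target (last p) = v"
  by (induction p arbitrary: u) auto

lemma path_between_vert:
  assumes "path_between u v p" "x \<in> path_verts p" "x \<noteq> u"
  shows "\<exists>e\<in>set p. target e = x"
  using assms
proof (induction p arbitrary: u)
  case (Cons e p)
  show ?case
  proof (cases "x = target e")
    case False
    then have "x \<in> path_verts p" using Cons.prems by (auto simp: path_verts_def)
    then show ?thesis using Cons.IH[of "target e"] Cons.prems False by auto
  qed simp
qed (simp add: path_verts_def)

definition cell_ok :: "edge set \<Rightarrow> cell \<Rightarrow> bool" where
  "cell_ok E c \<longleftrightarrow> (\<exists>e a b. (c = ([e], [a, b]) \<or> c = ([a, b], [e])) \<and> {e, a, b} \<subseteq> E \<and>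
     source a = source e \<and> target a = source b \<and> target b = target e)"

text \<open>
  The part of the inductive invariant that is symmetric under reflection. That no edge enters
  the initial vertex makes the incoming edges of a vertex common to two summands or factors easy
  to locate.
\<close>

definition diagram_base :: "prediagram \<Rightarrow> bool" where
  "diagram_base D \<longleftrightarrow>
    top_path D \<noteq> [] \<and> bot_path D \<noteq> [] \<and> set (top_path D) \<subseteq> edges D \<and> set (bot_path D) \<subseteq> edges D \<and>
    path_between (init_vert D) (term_vert D) (top_path D) \<and> path_between (init_vert D) (term_vert D) (bot_path D) \<and>
    (\<forall>e\<in>edges D. source e \<noteq> target e \<and> target e \<noteq> init_vert D) \<and> (\<forall>c\<in>cells D. cell_ok (edges D) c)"

text \<open>
  The part of the inductive invariant that speaks of the upper side; the lower side is covered
  by \<open>diagram_upper (diagram_inv D)\<close>. The first two clauses provide top-most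
  incoming edges. The third keeps the vertices created by $\pi$-cells apart from everything that
  is composed from above, and the last two make the top-most incoming edge of such a vertex
  unique.
\<close>

definition diagram_upper :: "prediagram \<Rightarrow> bool" where
  "diagram_upper D \<longleftrightarrow>
    (\<forall>e\<in>set (top_path D). \<forall>d\<in>edges D. target d = target e \<longrightarrow> (e, d) \<in> weakly_above D) \<and>
    (\<forall>e a b d. ([e], [a, b]) \<in> cells D \<and> d \<in> edges D \<and> target d = target a \<longrightarrow> (a, d) \<in> weakly_above D) \<and>
    (\<forall>e a b. ([e], [a, b]) \<in> cells D \<longrightarrow> target a \<notin> path_verts (top_path D)) \<and>
    (\<forall>p q p' q' e. (p, q) \<in> cells D \<and> (p', q') \<in> cells D \<and> e \<in> set q \<inter> set q' \<longrightarrow> (p, q) = (p', q')) \<and>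
    (\<forall>p q e. (p, q) \<in> cells D \<and> e \<in> set q \<longrightarrow> e \<notin> set (top_path D))"

lemma diagram_inv_simps [simp]:
  "edges (diagram_inv D) = edges D" "top_path (diagram_inv D) = bot_path D" "bot_path (diagram_inv D) = top_path D"
  "(p, q) \<in> cells (diagram_inv D) \<longleftrightarrow> (q, p) \<in> cells D" "dverts (diagram_inv D) = dverts D"
proof -
  have "cells (diagram_inv D) = prod.swap ` cells D"
    by (simp add: diagram_inv_def prod.swap_def case_prod_unfold)
  then show "(p, q) \<in> cells (diagram_inv D) \<longleftrightarrow> (q, p) \<in> cells D" by force
qed (simp_all add: diagram_inv_def dverts_def)

lemma diagram_inv_inv [simp]: "diagram_inv (diagram_inv D) = D"
proof (rule prediagram.equality)
  show "cells (diagram_inv (diagram_inv D)) = cells D" proof (rule Set.set_eqI)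
    fix c show "c \<in> cells (diagram_inv (diagram_inv D)) \<longleftrightarrow> c \<in> cells D" by (cases c) simp
  qed
qed simp_all

lemma diagram_comp_simps [simp]:
  "edges (diagram_comp D E) = edges D \<union> edges E" "cells (diagram_comp D E) = cells D \<union> cells E"
  "top_path (diagram_comp D E) = top_path D" "bot_path (diagram_comp D E) = bot_path E"
  "dverts (diagram_comp D E) = dverts D \<union> dverts E"
  by (auto simp: diagram_comp_def dverts_def)

lemma diagram_sum_simps [simp]:
  "edges (diagram_sum D E) = edges D \<union> edges E" "cells (diagram_sum D E) = cells D \<union> cells E"
  "top_path (diagram_sum D E) = top_path D @ top_path E" "bot_path (diagram_sum D E) = bot_path D @ bot_path E"
  "dverts (diagram_sum D E) = dverts D \<union> dverts E"
  by (auto simp: diagram_sum_def dverts_def)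

lemma pi_diagram_simps [simp]:
  "edges (pi_diagram e a b) = {e, a, b}" "cells (pi_diagram e a b) = {([e], [a, b])}"
  "top_path (pi_diagram e a b) = [e]" "bot_path (pi_diagram e a b) = [a, b]"
  by (auto simp: pi_diagram_def)

lemma edge_diagram_simps [simp]:
  "edges (edge_diagram e) = {e}" "cells (edge_diagram e) = {}"
  "top_path (edge_diagram e) = [e]" "bot_path (edge_diagram e) = [e]"
  by (auto simp: edge_diagram_def)

lemma diagram_inv_comp: "diagram_inv (diagram_comp D E) = diagram_comp (diagram_inv E) (diagram_inv D)"
  and diagram_inv_sum: "diagram_inv (diagram_sum D E) = diagram_sum (diagram_inv D) (diagram_inv E)"
  by (auto simp: diagram_inv_def diagram_comp_def diagram_sum_def)

lemma dverts_edge: "e \<in> edges D \<Longrightarrow> source e \<in> dverts D" "e \<in> edges D \<Longrightarrow> target e \<in> dverts D"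
  by (auto simp: dverts_def)

lemma path_verts_subset: "set p \<subseteq> edges D \<Longrightarrow> path_verts p \<subseteq> dverts D"
  by (auto simp: path_verts_def dverts_def)

lemma weakly_above_mono: "cells D \<subseteq> cells E \<Longrightarrow> weakly_above D \<subseteq> weakly_above E"
  unfolding weakly_above_def by (intro rtrancl_mono) auto

lemma weakly_above_trans: "(a, b) \<in> weakly_above D \<Longrightarrow> (b, c) \<in> weakly_above D \<Longrightarrow> (a, c) \<in> weakly_above D"
  unfolding weakly_above_def by (rule rtrancl_trans)

lemma weakly_above_inv: "weakly_above (diagram_inv D) = (weakly_above D)\<inverse>"
proof -
  have "{(last p, last q) |p q. (p, q) \<in> cells (diagram_inv D)} = {(last p, last q) |p q. (p, q) \<in> cells D}\<inverse>"
    by auto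
  then show ?thesis unfolding weakly_above_def by (simp only: rtrancl_converse)
qed

lemma base_ends_inv:
  assumes "diagram_base D"
  shows "init_vert (diagram_inv D) = init_vert D" "term_vert (diagram_inv D) = term_vert D"
  using assms path_between_hd[of "init_vert D" "term_vert D" "bot_path D"] path_between_last[of "init_vert D" "term_vert D" "bot_path D"]
  unfolding diagram_base_def init_vert_def term_vert_def by auto

lemma cell_ok_inv: "cell_ok E (p, q) \<longleftrightarrow> cell_ok E (q, p)"
  unfolding cell_ok_def by blast

lemma cell_ok_mono: "cell_ok E c \<Longrightarrow> E \<subseteq> E' \<Longrightarrow> cell_ok E' c"
  unfolding cell_ok_def by blast

lemma cell_ok_edges: "cell_ok E (p, q) \<Longrightarrow> set p \<subseteq> E \<and> set q \<subseteq> E"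
  unfolding cell_ok_def by auto

lemma cell_ok_pi:
  assumes "cell_ok E ([e], [a, b])"
  shows "e \<in> E" "a \<in> E" "b \<in> E" "source a = source e" "target a = source b" "target b = target e"
  using assms unfolding cell_ok_def by auto

lemma diagram_base_inv: "diagram_base D \<Longrightarrow> diagram_base (diagram_inv D)"
  using base_ends_inv[of D] unfolding diagram_base_def by (auto simp: split_paired_all intro: cell_ok_inv[THEN iffD1])

lemma composable_ends:
  assumes "diagram_base D" "diagram_base E" "composable_diagrams D E"
  shows "init_vert E = init_vert D" "term_vert E = term_vert D"
    "init_vert (diagram_comp D E) = init_vert D" "term_vert (diagram_comp D E) = term_vert D"
proof -
  have "path_between (init_vert D) (term_vert D) (top_path E)" "top_path E \<noteq> []"
    using assms unfolding diagram_base_def composable_diagrams_def by auto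
  then show "init_vert E = init_vert D" "term_vert E = term_vert D"
    using path_between_hd path_between_last unfolding init_vert_def[of E] term_vert_def[of E] by auto
qed (simp_all add: init_vert_def term_vert_def)

lemma summable_ends:
  assumes "diagram_base D" "diagram_base E"
  shows "init_vert (diagram_sum D E) = init_vert D" "term_vert (diagram_sum D E) = term_vert E"
  using assms unfolding diagram_base_def init_vert_def term_vert_def by simp_all

lemma diagram_base_comp:
  assumes D: "diagram_base D" and E: "diagram_base E" and c: "composable_diagrams D E"
  shows "diagram_base (diagram_comp D E)"
  using D E composable_ends[OF D E c] unfolding diagram_base_def
  by (auto intro: cell_ok_mono)

lemma summable_common_vertex:
  assumes "summable_diagrams D E" "v \<in> dverts D" "v \<in> dverts E"
  shows "v = term_vert D" "v = init_vert E"
  using assms unfolding summable_diagrams_def by auto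

lemma diagram_base_sum:
  assumes D: "diagram_base D" and E: "diagram_base E" and s: "summable_diagrams D E"
  shows "diagram_base (diagram_sum D E)"
proof -
  have "hd (top_path D) \<in> edges D" using D hd_in_set unfolding diagram_base_def by blast
  then have init: "init_vert D \<in> dverts D" unfolding init_vert_def by (rule dverts_edge)
  have "target e \<noteq> init_vert D" if "e \<in> edges E" for e
    using that E summable_common_vertex(2)[OF s init] dverts_edge(2)[OF that] unfolding diagram_base_def by metis
  moreover have "term_vert D = init_vert E" using s unfolding summable_diagrams_def by simp
  ultimately show ?thesis
    using D E summable_ends[OF D E] unfolding diagram_base_def
    by (auto intro: cell_ok_mono simp: path_between_append)
qed

lemma summable_disjoint_edges:
  assumes "diagram_base D" "summable_diagrams D E" "e \<in> edges D" "e \<in> edges E"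
  shows False
  using assms summable_common_vertex(1)[OF assms(2), of "source e"] summable_common_vertex(1)[OF assms(2), of "target e"]
    dverts_edge[of e D] dverts_edge[of e E] unfolding diagram_base_def by metis

lemma summable_no_common_target:
  assumes "diagram_base D" "diagram_base E" "summable_diagrams D E" "d \<in> edges E" "target d \<in> dverts D"
  shows False
  using assms summable_common_vertex(2)[OF assms(3), of "target d"] dverts_edge[of d E] unfolding diagram_base_def by metis

lemma composable_common_target:
  assumes "diagram_base D" "diagram_base E" "composable_diagrams D E"
    and "d \<in> edges D \<union> edges E" "target d \<in> dverts D" "target d \<in> dverts E"
  shows "\<exists>m\<in>set (top_path E). target m = target d"
proof -
  have "target d \<in> path_verts (top_path E)" using assms unfolding composable_diagrams_def by auto
  moreover have "target d \<noteq> init_vert E"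
    using assms(1,2,4) composable_ends[OF assms(1-3)] unfolding diagram_base_def by auto
  ultimately show ?thesis using assms(2) path_between_vert unfolding diagram_base_def by blast
qed

lemma diagram_upperD:
  assumes "diagram_upper D"
  shows "e \<in> set (top_path D) \<Longrightarrow> d \<in> edges D \<Longrightarrow> target d = target e \<Longrightarrow> (e, d) \<in> weakly_above D"
    and "([e], [a, b]) \<in> cells D \<Longrightarrow> d \<in> edges D \<Longrightarrow> target d = target a \<Longrightarrow> (a, d) \<in> weakly_above D"
    and "([e], [a, b]) \<in> cells D \<Longrightarrow> target a \<notin> path_verts (top_path D)"
    and "(p, q) \<in> cells D \<Longrightarrow> (p', q') \<in> cells D \<Longrightarrow> e \<in> set q \<Longrightarrow> e \<in> set q' \<Longrightarrow> (p, q) = (p', q')"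
    and "(p, q) \<in> cells D \<Longrightarrow> e \<in> set q \<Longrightarrow> e \<notin> set (top_path D)"
proof -
  note U = assms[unfolded diagram_upper_def]
  show "e \<in> set (top_path D) \<Longrightarrow> d \<in> edges D \<Longrightarrow> target d = target e \<Longrightarrow> (e, d) \<in> weakly_above D"
    using U[THEN conjunct1] by blast
  show "([e], [a, b]) \<in> cells D \<Longrightarrow> d \<in> edges D \<Longrightarrow> target d = target a \<Longrightarrow> (a, d) \<in> weakly_above D"
    using U[THEN conjunct2, THEN conjunct1] by blast
  show "([e], [a, b]) \<in> cells D \<Longrightarrow> target a \<notin> path_verts (top_path D)"
    using U[THEN conjunct2, THEN conjunct2, THEN conjunct1] by blast
  show "(p, q) \<in> cells D \<Longrightarrow> (p', q') \<in> cells D \<Longrightarrow> e \<in> set q \<Longrightarrow> e \<in> set q' \<Longrightarrow> (p, q) = (p', q')"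
    using U[THEN conjunct2, THEN conjunct2, THEN conjunct2, THEN conjunct1] by blast
  show "(p, q) \<in> cells D \<Longrightarrow> e \<in> set q \<Longrightarrow> e \<notin> set (top_path D)"
    using U[THEN conjunct2, THEN conjunct2, THEN conjunct2, THEN conjunct2] by blast
qed

text \<open>
  A vertex of both factors lies on the middle path, and has an incoming edge there. An edge that
  is top-most at this vertex in the upper factor is in particular above that middle edge, which
  by the first clause is above all edges of the lower factor that enter the vertex. A vertex
  created by a cell of the lower factor is not on the middle path and therefore does not occur
  in the upper factor.
\<close>

lemma diagram_upper_comp:
  assumes D: "diagram_base D" "diagram_upper D" and E: "diagram_base E" "diagram_upper E"
    and c: "composable_diagrams D E"
  shows "diagram_upper (diagram_comp D E)"
proof -
  note UD = diagram_upperD[OF D(2)] and UE = diagram_upperD[OF E(2)]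
  have waD: "weakly_above D \<subseteq> weakly_above (diagram_comp D E)" and waE: "weakly_above E \<subseteq> weakly_above (diagram_comp D E)"
    by (auto intro!: weakly_above_mono)
  have mid: "top_path E = bot_path D" "set (top_path E) \<subseteq> edges D" "edges D \<inter> edges E = set (top_path E)"
      "dverts D \<inter> dverts E = path_verts (top_path E)"
    using c D(1) unfolding composable_diagrams_def diagram_base_def by auto
  have topD: "set (top_path D) \<subseteq> edges D" using D(1) unfolding diagram_base_def by simp
  have cellD: "set p \<subseteq> edges D \<and> set q \<subseteq> edges D" if "(p, q) \<in> cells D" for p q
    using D(1) that cell_ok_edges unfolding diagram_base_def by blast
  have cellE: "set p \<subseteq> edges E \<and> set q \<subseteq> edges E" if "(p, q) \<in> cells E" for p q
    using E(1) that cell_ok_edges unfolding diagram_base_def by blast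
  have down: "(x, d) \<in> weakly_above (diagram_comp D E)"
    if x: "x \<in> edges D" "\<And>d. d \<in> edges D \<Longrightarrow> target d = target x \<Longrightarrow> (x, d) \<in> weakly_above D"
      and d: "d \<in> edges D \<union> edges E" "target d = target x" for x d
  proof (cases "d \<in> edges D")
    case True
    then show ?thesis using x d waD by blast
  next
    case False
    then have "d \<in> edges E" using d by blast
    then have "target d \<in> dverts D" "target d \<in> dverts E" using d x dverts_edge by metis+
    then obtain m where m: "m \<in> set (top_path E)" "target m = target d"
      using composable_common_target[OF D(1) E(1) c d(1)] by blast
    then have "(x, m) \<in> weakly_above D" "(m, d) \<in> weakly_above E" using x(2) mid d UE(1) \<open>d \<in> edges E\<close> by auto
    then show ?thesis using waD waE weakly_above_trans by blast
  qed
  show ?thesis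
    unfolding diagram_upper_def diagram_comp_simps
  proof (intro conjI allI ballI impI; (elim conjE)?)
    fix e d assume "e \<in> set (top_path D)" "d \<in> edges D \<union> edges E" "target d = target e"
    then show "(e, d) \<in> weakly_above (diagram_comp D E)" using down[of e d] UD(1) topD by blast
  next
    fix e a b d assume ab: "([e], [a, b]) \<in> cells D \<union> cells E" and d: "d \<in> edges D \<union> edges E" "target d = target a"
    show "(a, d) \<in> weakly_above (diagram_comp D E)"
    proof (cases "([e], [a, b]) \<in> cells D")
      case True
      then have "a \<in> edges D" using cellD by fastforce
      then show ?thesis using down[of a d] UD(2)[OF True] d by blast
    next
      case False
      then have cE: "([e], [a, b]) \<in> cells E" using ab by blast
      then have "target a \<in> dverts E" using cellE dverts_edge(2)[of a E] by fastforce
      moreover have "target a \<notin> path_verts (top_path E)" using UE(3)[OF cE] .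
      ultimately have "target d \<notin> dverts D" using mid d by auto
      then have "d \<in> edges E" using d(1) dverts_edge(2)[of d D] by blast
      then show ?thesis using UE(2)[OF cE] d waE by blast
    qed
  next
    fix e a b assume ab: "([e], [a, b]) \<in> cells D \<union> cells E"
    show "target a \<notin> path_verts (top_path D)"
    proof (cases "([e], [a, b]) \<in> cells D")
      case True
      then show ?thesis by (rule UD(3))
    next
      case False
      then have cE: "([e], [a, b]) \<in> cells E" using ab by blast
      then have "target a \<in> dverts E" using cellE dverts_edge(2)[of a E] by fastforce
      moreover have "target a \<notin> path_verts (top_path E)" using UE(3)[OF cE] .
      ultimately have "target a \<notin> dverts D" using mid by auto
      then show ?thesis using path_verts_subset[OF topD] by blast
    qed
  next
    fix p q p' q' e assume pq: "(p, q) \<in> cells D \<union> cells E" "(p', q') \<in> cells D \<union> cells E" and e: "e \<in> set q \<inter> set q'"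
    have cross: False if "(p, q) \<in> cells D" "(p', q') \<in> cells E" "e \<in> set q" "e \<in> set q'" for p q p' q'
      using cellD[OF that(1)] cellE[OF that(2)] that mid UE(5)[OF that(2)] by blast
    show "(p, q) = (p', q')" using pq e cross UD(4) UE(4) by blast
  next
    fix p q e assume "(p, q) \<in> cells D \<union> cells E" "e \<in> set q"
    then show "e \<notin> set (top_path D)" using UD(5) UE(5) cellE mid topD by blast
  qed
qed

lemma diagram_upper_sum:
  assumes D: "diagram_base D" "diagram_upper D" and E: "diagram_base E" "diagram_upper E"
    and s: "summable_diagrams D E"
  shows "diagram_upper (diagram_sum D E)"
proof -
  note UD = diagram_upperD[OF D(2)] and UE = diagram_upperD[OF E(2)]
  have waD: "weakly_above D \<subseteq> weakly_above (diagram_sum D E)" and waE: "weakly_above E \<subseteq> weakly_above (diagram_sum D E)"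
    by (auto intro!: weakly_above_mono)
  have top: "set (top_path D) \<subseteq> edges D" "set (top_path E) \<subseteq> edges E" using D(1) E(1) unfolding diagram_base_def by simp_all
  have cellD: "set p \<subseteq> edges D \<and> set q \<subseteq> edges D" if "(p, q) \<in> cells D" for p q
    using D(1) that cell_ok_edges unfolding diagram_base_def by blast
  have cellE: "set p \<subseteq> edges E \<and> set q \<subseteq> edges E" if "(p, q) \<in> cells E" for p q
    using E(1) that cell_ok_edges unfolding diagram_base_def by blast
  have disj: False if "e \<in> edges D" "e \<in> edges E" for e using summable_disjoint_edges[OF D(1) s that] .
  have tgt: False if "d \<in> edges D" "d' \<in> edges E" "target d = target d'" for d d'
    using summable_no_common_target[OF D(1) E(1) s that(2)] dverts_edge(2)[OF that(1)] that(3) by simp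
  have verts: "path_verts (top_path D @ top_path E) = path_verts (top_path D) \<union> path_verts (top_path E)"
    by (auto simp: path_verts_def)
  have aD: "e \<in> edges D \<and> a \<in> edges D" if "([e], [a, b]) \<in> cells D" for e a b using cellD[OF that] by simp
  have aE: "e \<in> edges E \<and> a \<in> edges E" if "([e], [a, b]) \<in> cells E" for e a b using cellE[OF that] by simp
  show ?thesis
    unfolding diagram_upper_def diagram_sum_simps
  proof (intro conjI allI ballI impI; (elim conjE)?)
    fix e d assume "e \<in> set (top_path D @ top_path E)" "d \<in> edges D \<union> edges E" "target d = target e"
    then consider "e \<in> set (top_path D)" "d \<in> edges D" "target d = target e"
      | "e \<in> set (top_path E)" "d \<in> edges E" "target d = target e"
      using top tgt[of e d] tgt[of d e] by auto
    then show "(e, d) \<in> weakly_above (diagram_sum D E)"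
      using UD(1) UE(1) waD waE by cases blast+
  next
    fix e a b d assume "([e], [a, b]) \<in> cells D \<union> cells E" "d \<in> edges D \<union> edges E" "target d = target a"
    then consider "([e], [a, b]) \<in> cells D" "d \<in> edges D" "target d = target a"
      | "([e], [a, b]) \<in> cells E" "d \<in> edges E" "target d = target a"
      using aD[of e a b] aE[of e a b] tgt[of a d] tgt[of d a] by auto
    then show "(a, d) \<in> weakly_above (diagram_sum D E)"
      using UD(2) UE(2) waD waE by cases blast+
  next
    fix e a b assume ab: "([e], [a, b]) \<in> cells D \<union> cells E"
    show "target a \<notin> path_verts (top_path D @ top_path E)"
    proof (cases "([e], [a, b]) \<in> cells D")
      case True
      have "target a \<notin> path_verts (top_path E)"
      proof
        assume "target a \<in> path_verts (top_path E)"
        then have "target a \<in> dverts E" using path_verts_subset[OF top(2)] by blast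
        moreover have "target a \<in> dverts D" using aD[OF True] dverts_edge by blast
        ultimately have "target a = term_vert D" using summable_common_vertex[OF s] by blast
        moreover have "term_vert D \<in> path_verts (top_path D)"
          using D(1) unfolding diagram_base_def term_vert_def path_verts_def by simp
        ultimately show False using UD(3)[OF True] by simp
      qed
      then show ?thesis using UD(3)[OF True] verts by blast
    next
      case False
      then have cE: "([e], [a, b]) \<in> cells E" using ab by blast
      have "target a \<notin> path_verts (top_path D)"
        using summable_no_common_target[OF D(1) E(1) s] aE[OF cE] path_verts_subset[OF top(1)] by blast
      then show ?thesis using UE(3)[OF cE] verts by blast
    qed
  next
    fix p q p' q' e assume pq: "(p, q) \<in> cells D \<union> cells E" "(p', q') \<in> cells D \<union> cells E" and e: "e \<in> set q \<inter> set q'"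
    have cross: False if "(p, q) \<in> cells D" "(p', q') \<in> cells E" "e \<in> set q" "e \<in> set q'" for p q p' q'
      using cellD[OF that(1)] cellE[OF that(2)] that disj by blast
    show "(p, q) = (p', q')" using pq e cross UD(4) UE(4) by blast
  next
    fix p q e assume "(p, q) \<in> cells D \<union> cells E" "e \<in> set q"
    then show "e \<notin> set (top_path D @ top_path E)" using UD(5) UE(5) cellE cellD disj top by fastforce
  qed
qed

lemma composable_inv: "composable_diagrams D E \<Longrightarrow> composable_diagrams (diagram_inv E) (diagram_inv D)"
  unfolding composable_diagrams_def by auto

lemma summable_inv:
  assumes "diagram_base D" "diagram_base E" "summable_diagrams D E"
  shows "summable_diagrams (diagram_inv D) (diagram_inv E)"
  using assms base_ends_inv unfolding summable_diagrams_def by simp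

lemma pi_diagram_invariants:
  assumes "source a = source e" "target a = source b" "target b = target e"
    and ne: "source e \<noteq> target a" "target a \<noteq> target e" "source e \<noteq> target e"
  shows "diagram_base (pi_diagram e a b)" "diagram_upper (pi_diagram e a b)" "diagram_upper (diagram_inv (pi_diagram e a b))"
proof -
  let ?D = "pi_diagram e a b"
  have "(e, b) \<in> weakly_above ?D" "(b, e) \<in> weakly_above (diagram_inv ?D)"
    unfolding weakly_above_def by (auto intro!: r_into_rtrancl)
  moreover have "(x, x) \<in> weakly_above D" for x D unfolding weakly_above_def by simp
  moreover have "e \<noteq> a" "e \<noteq> b" "a \<noteq> b" using assms by auto
  ultimately show "diagram_base ?D" "diagram_upper ?D" "diagram_upper (diagram_inv ?D)" using assms
    by (auto simp: diagram_base_def diagram_upper_def init_vert_def term_vert_def cell_ok_def path_verts_def)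
qed

lemma diagram_invariants:
  "diagram D \<Longrightarrow> diagram_base D \<and> diagram_upper D \<and> diagram_upper (diagram_inv D)"
proof (induction rule: diagram.induct)
  case (diagram_edge u v i)
  then show ?case
    by (auto simp: diagram_base_def diagram_upper_def init_vert_def term_vert_def weakly_above_def)
next
  case (diagram_pi u w v i j k)
  then show ?case
    using pi_diagram_invariants[of "Edge u j w" "Edge u i v" "Edge w k v"] by simp
next
  case (diagram_sum D E)
  then show ?case
    using diagram_base_sum diagram_upper_sum diagram_base_inv summable_inv by (simp add: diagram_inv_sum)
next
  case (diagram_comp D E)
  then show ?case
    using diagram_base_comp diagram_upper_comp diagram_base_inv composable_inv by (simp add: diagram_inv_comp)
next
  case (diagram_inv D)
  then show ?case using diagram_base_inv by simp
qed

text \<open>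
  Uniqueness: an edge that is weakly above the left lower edge \<open>a\<close> and different
  from it would end in a cell with \<open>a\<close> as last edge of its bottom path, but the
  only cell with \<open>a\<close> on its bottom path is the given one, where \<open>b\<close> is
  last.
\<close>

lemma topmost_left_edge:
  assumes D: "diagram D" and c: "([e], [a, b]) \<in> cells D"
  shows "topmost_incoming D (target a) x \<longleftrightarrow> x = a"
proof -
  note base = diagram_invariants[OF D, THEN conjunct1]
  note U = diagram_upperD[OF diagram_invariants[OF D, THEN conjunct2, THEN conjunct1]]
  have ok: "cell_ok (edges D) ([e], [a, b])" using base c unfolding diagram_base_def by blast
  note ok = cell_ok_pi[OF ok]
  have a: "topmost_incoming D (target a) a"
    using U(2)[OF c] ok by (auto simp: topmost_incoming_def incoming_def)
  have "x = a" if "topmost_incoming D (target a) x"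
  proof -
    have "(x, a) \<in> weakly_above D" using that ok by (auto simp: topmost_incoming_def incoming_def)
    then show ?thesis
      unfolding weakly_above_def
    proof (cases rule: rtranclE)
      case (step y)
      then obtain p q where pq: "(p, q) \<in> cells D" "a = last q" by auto
      have "cell_ok (edges D) (p, q)" using base pq unfolding diagram_base_def by blast
      then have "a \<in> set q" unfolding cell_ok_def pq(2) by auto
      then have "q = [a, b]" using U(4)[OF pq(1) c, of a] by simp
      then have "last q = b" by simp
      then have "a = b" using pq(2) by simp
      then have False using ok base unfolding diagram_base_def by metis
      then show ?thesis ..
    qed
  qed
  then show ?thesis using a by blast
qed

lemma bottommost_incoming_inv: "bottommost_incoming D v e \<longleftrightarrow> topmost_incoming (diagram_inv D) v e"
  by (simp add: bottommost_incoming_def topmost_incoming_def incoming_def weakly_above_inv)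

lemma bottommost_left_edge:
  assumes "diagram D" "([a, b], [e]) \<in> cells D"
  shows "bottommost_incoming D (target a) x \<longleftrightarrow> x = a"
  unfolding bottommost_incoming_inv using assms by (intro topmost_left_edge diagram.diagram_inv) auto

lemma left_edge_inner:
  assumes D: "diagram D" and c: "([e], [a, b]) \<in> cells D"
  shows "target a \<in> inner_verts D"
proof -
  note base = diagram_invariants[OF D, THEN conjunct1]
  note U = diagram_upperD[OF diagram_invariants[OF D, THEN conjunct2, THEN conjunct1]]
  have "cell_ok (edges D) ([e], [a, b])" using base c unfolding diagram_base_def by blast
  then have "target a \<in> dverts D" using cell_ok_pi(2) dverts_edge(2) by blast
  moreover have "init_vert D \<in> path_verts (top_path D)" "term_vert D \<in> path_verts (top_path D)"
    using base unfolding diagram_base_def init_vert_def term_vert_def path_verts_def by auto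
  ultimately show ?thesis using U(3)[OF c] unfolding inner_verts_def by auto
qed

section \<open>Diagrams built from $\pi$-cells only\<close>

definition pi_only :: "prediagram \<Rightarrow> bool" where
  "pi_only D \<longleftrightarrow> (\<forall>c\<in>cells D. pi_cell c)"

lemma pi_only_simps:
  "pi_only (diagram_comp D E) \<longleftrightarrow> pi_only D \<and> pi_only E" "pi_only (diagram_sum D E) \<longleftrightarrow> pi_only D \<and> pi_only E"
  by (auto simp: pi_only_def)

definition inherited :: "(edge \<Rightarrow> bool) \<Rightarrow> prediagram \<Rightarrow> bool" where
  "inherited P D \<longleftrightarrow> (\<forall>c\<in>cells D. \<forall>e a b. c = ([e], [a, b]) \<longrightarrow> P e \<longrightarrow> P a \<and> P b)"

lemma inherited_simps:
  "inherited P (diagram_comp D E) \<longleftrightarrow> inherited P D \<and> inherited P E"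
  "inherited P (diagram_sum D E) \<longleftrightarrow> inherited P D \<and> inherited P E"
  unfolding inherited_def diagram_comp_simps diagram_sum_simps ball_Un by (rule refl)+

text \<open>
  A property of the top path that is passed from the top edge of a cell to its bottom edges
  holds everywhere. It is stated as an implication from \<open>pi_only\<close>, because the
  induction over diagrams includes reflection: it is carried out for a diagram together with its
  inverse.
\<close>

definition propagates :: "(edge \<Rightarrow> bool) \<Rightarrow> prediagram \<Rightarrow> bool" where
  "propagates P D \<longleftrightarrow> pi_only D \<and> inherited P D \<and> (\<forall>e\<in>set (top_path D). P e) \<longrightarrow> (\<forall>e\<in>edges D. P e)"

lemma propagates_comp:
  assumes "diagram_base D" "composable_diagrams D E" "propagates P D" "propagates P E"
  shows "propagates P (diagram_comp D E)"
proof -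
  have "set (top_path E) \<subseteq> edges D" using assms(1,2) unfolding composable_diagrams_def diagram_base_def by auto
  then show ?thesis
    using assms(3,4) unfolding propagates_def pi_only_simps inherited_simps diagram_comp_simps by blast
qed

lemma propagates_sum: "propagates P D \<Longrightarrow> propagates P E \<Longrightarrow> propagates P (diagram_sum D E)"
  unfolding propagates_def pi_only_simps inherited_simps diagram_sum_simps set_append by blast

lemma pi_only_propagates: "diagram D \<Longrightarrow> propagates P D \<and> propagates P (diagram_inv D)"
proof (induction rule: diagram.induct)
  case (diagram_comp D E)
  have b: "diagram_base D" "diagram_base (diagram_inv E)"
    using diagram_comp.hyps diagram_invariants diagram_base_inv by blast+
  show ?case
    unfolding diagram_inv_comp
    using propagates_comp[OF b(1)] propagates_comp[OF b(2) composable_inv] diagram_comp by blast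
next
  case (diagram_sum D E)
  then show ?case unfolding diagram_inv_sum using propagates_sum by blast
next
  case (diagram_pi u w v i j k)
  let ?D = "pi_diagram (Edge u i v) (Edge u j w) (Edge w k v)"
  have "([Edge u i v], [Edge u j w, Edge w k v]) \<in> cells ?D" by simp
  then have "inherited P ?D \<Longrightarrow> P (Edge u i v) \<Longrightarrow> P (Edge u j w) \<and> P (Edge w k v)" unfolding inherited_def by blast
  then have "propagates P ?D" unfolding propagates_def by simp
  moreover have "\<not> pi_only (diagram_inv ?D)" by (simp add: pi_only_def pi_cell_def diagram_inv_def)
  ultimately show ?case unfolding propagates_def by blast
next
  case (diagram_edge u v i)
  then show ?case by (simp add: propagates_def)
next
  case (diagram_inv D)
  then show ?case by simp
qed

definition halving :: "(edge \<Rightarrow> real \<times> real) \<Rightarrow> prediagram \<Rightarrow> bool" where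
  "halving I D \<longleftrightarrow> (\<forall>c\<in>cells D. \<forall>e a b l r. c = ([e], [a, b]) \<and> I e = (l, r) \<longrightarrow>
     I a = (l, (l + r) / 2) \<and> I b = ((l + r) / 2, r))"

definition keeps_chains :: "(edge \<Rightarrow> real \<times> real) \<Rightarrow> prediagram \<Rightarrow> bool" where
  "keeps_chains I D \<longleftrightarrow> (pi_only D \<and> halving I D \<longrightarrow>
     (\<forall>l r. chain l r (map I (top_path D)) \<longrightarrow> chain l r (map I (bot_path D))))"

lemma halving_simps:
  "halving I (diagram_comp D E) \<longleftrightarrow> halving I D \<and> halving I E" "halving I (diagram_sum D E) \<longleftrightarrow> halving I D \<and> halving I E"
  unfolding halving_def diagram_comp_simps diagram_sum_simps ball_Un by (rule refl)+

lemma keeps_chains_comp: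
  "composable_diagrams D E \<Longrightarrow> keeps_chains I D \<Longrightarrow> keeps_chains I E \<Longrightarrow> keeps_chains I (diagram_comp D E)"
  unfolding keeps_chains_def pi_only_simps halving_simps composable_diagrams_def by auto

lemma keeps_chains_sum: "keeps_chains I D \<Longrightarrow> keeps_chains I E \<Longrightarrow> keeps_chains I (diagram_sum D E)"
  unfolding keeps_chains_def pi_only_simps halving_simps diagram_sum_simps map_append chain_append by blast

lemma pi_only_keeps_chains: "diagram D \<Longrightarrow> keeps_chains I D \<and> keeps_chains I (diagram_inv D)"
proof (induction rule: diagram.induct)
  case (diagram_pi u w v i j k)
  show ?case
  proof
    let ?D = "pi_diagram (Edge u i v) (Edge u j w) (Edge w k v)"
    obtain x y where "I (Edge u i v) = (x, y)" by fastforce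
    then show "keeps_chains I ?D" by (auto simp: keeps_chains_def halving_def)
    have "\<not> pi_only (diagram_inv ?D)" by (simp add: pi_only_def pi_cell_def diagram_inv_def)
    then show "keeps_chains I (diagram_inv ?D)" by (simp add: keeps_chains_def)
  qed
next
  case (diagram_comp D E)
  then show ?case unfolding diagram_inv_comp using keeps_chains_comp composable_inv by blast
next
  case (diagram_sum D E)
  then show ?case unfolding diagram_inv_sum using keeps_chains_sum by blast
next
  case (diagram_edge u v i)
  then show ?case by (simp add: keeps_chains_def)
next
  case (diagram_inv D)
  then show ?case by simp
qed

section \<open>Bipartite Thompson graphs and parity\<close>

lemma interval_assignment_iff: "interval_assignment D I \<longleftrightarrow> I (hd (top_path D)) = (0, 1) \<and> halving I D"
  unfolding interval_assignment_def halving_def by blast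

text \<open>
  Going down from the top edge, each halving turns \<open>a\<close> into \<open>2 * a\<close>
  for the left edge, with the same initial vertex, and into \<open>2 * a + 1\<close> for the
  right edge, where both the parity and the colour of the initial vertex change.
\<close>

lemma pi_cells_assign_parity:
  assumes D: "diagram D" "pi_only D" and I: "interval_assignment D I" and top: "length (top_path D) = 1"
    and flip: "\<And>e a b. ([e], [a, b]) \<in> cells D \<Longrightarrow> source a \<in> A \<longleftrightarrow> target a \<notin> A"
    and e: "e \<in> edges D"
  shows "\<exists>k a. I e = adic_interval 2 k a \<and> (odd_ones a \<longleftrightarrow> (source e \<in> A \<longleftrightarrow> init_vert D \<notin> A))"
proof -
  define P where "P e \<longleftrightarrow> (\<exists>k a. I e = adic_interval 2 k a \<and> (odd_ones a \<longleftrightarrow> (source e \<in> A \<longleftrightarrow> init_vert D \<notin> A)))" for e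
  have "propagates P D" using pi_only_propagates[OF D(1)] by blast
  moreover have "\<forall>e\<in>set (top_path D). P e"
  proof
    fix e assume "e \<in> set (top_path D)"
    then have e: "e = hd (top_path D)" using top by (auto simp: length_Suc_conv)
    then have "I e = adic_interval 2 0 0" "source e = init_vert D"
      using I by (simp_all add: interval_assignment_def adic_interval_def init_vert_def)
    then show "P e" unfolding P_def by (metis odd_ones_0)
  qed
  moreover have "inherited P D"
    unfolding inherited_def
  proof (intro ballI allI impI)
    fix c e a b assume "c \<in> cells D" "c = ([e], [a, b])" and e: "P e"
    then have c: "([e], [a, b]) \<in> cells D" by simp
    obtain k d where kd: "I e = adic_interval 2 k d" "odd_ones d \<longleftrightarrow> (source e \<in> A \<longleftrightarrow> init_vert D \<notin> A)"
      using e unfolding P_def by blast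
    have "I a = (fst (I e), (fst (I e) + snd (I e)) / 2) \<and> I b = ((fst (I e) + snd (I e)) / 2, snd (I e))"
      using I c unfolding interval_assignment_def by (metis prod.collapse)
    then have ab: "I a = adic_interval 2 (Suc k) (2 * d)" "I b = adic_interval 2 (Suc k) (Suc (2 * d))"
      unfolding adic_interval_left_half adic_interval_right_half kd(1) by simp_all
    have "cell_ok (edges D) ([e], [a, b])" using diagram_invariants[OF D(1)] c unfolding diagram_base_def by blast
    then have "source a = source e" "source b = target a" using cell_ok_pi by metis+
    then have "odd_ones (2 * d) \<longleftrightarrow> (source a \<in> A \<longleftrightarrow> init_vert D \<notin> A)"
        "odd_ones (Suc (2 * d)) \<longleftrightarrow> (source b \<in> A \<longleftrightarrow> init_vert D \<notin> A)"
      using kd(2) flip[OF c] by auto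
    then show "P a \<and> P b" unfolding P_def using ab by blast
  qed
  ultimately have "\<forall>e\<in>edges D. P e" using D(2) unfolding propagates_def by blast
  then show ?thesis using e unfolding P_def by blast
qed

lemma bipartite_flip:
  assumes "bipartite (thompson_graph D)"
  obtains A where "\<And>v e. v \<in> inner_verts D \<Longrightarrow> topmost_incoming D v e \<Longrightarrow> source e \<in> A \<longleftrightarrow> v \<notin> A"
    "\<And>v e. v \<in> inner_verts D \<Longrightarrow> bottommost_incoming D v e \<Longrightarrow> source e \<in> A \<longleftrightarrow> v \<notin> A"
proof -
  let ?G = "thompson_graph D"
  obtain A B where AB: "A \<inter> B = {}"
      "\<forall>x\<in>arcs ?G. tail ?G x \<in> A \<and> head ?G x \<in> B \<or> tail ?G x \<in> B \<and> head ?G x \<in> A"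
    using assms unfolding bipartite_def by (elim exE conjE)
  have *: "source e \<in> A \<longleftrightarrow> v \<notin> A" if "(s, e) \<in> arcs (thompson_graph D)" "target e = v" for s e v
    using bspec[OF AB(2) that(1)] AB(1) that(2) by (auto simp: thompson_graph_def)
  show ?thesis
  proof (rule that[of A])
    fix v e assume "v \<in> inner_verts D" and t: "topmost_incoming D v e"
    then have "(Upper, e) \<in> arcs (thompson_graph D)" by (auto simp: thompson_graph_def)
    moreover have "target e = v" using t by (simp add: topmost_incoming_def incoming_def)
    ultimately show "source e \<in> A \<longleftrightarrow> v \<notin> A" by (rule *)
  next
    fix v e assume "v \<in> inner_verts D" and t: "bottommost_incoming D v e"
    then have "(Lower, e) \<in> arcs (thompson_graph D)" by (auto simp: thompson_graph_def)
    moreover have "target e = v" using t by (simp add: bottommost_incoming_def incoming_def)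
    ultimately show "source e \<in> A \<longleftrightarrow> v \<notin> A" by (rule *)
  qed
qed

lemma inner_verts_inv: "diagram D \<Longrightarrow> inner_verts (diagram_inv D) = inner_verts D"
  using base_ends_inv diagram_invariants unfolding inner_verts_def by simp

text \<open>
  The two-colouring determines the parity at both subdivisions, up to the colour of the common
  initial vertex. Hence the parities agree interval by interval.
\<close>

lemma jones_subgroup_stabilizes: "jones_subgroup \<subseteq> parity_stabilizer"
proof
  fix f assume "f \<in> jones_subgroup"
  then obtain D where f: "f \<in> carrier thompson_F" and D: "diagram_in_F D" "corresponds D f" "bipartite (thompson_graph D)"
    unfolding jones_subgroup_def by blast
  obtain Dp Dn I J where cut: "cut_diagram D Dp Dn" and I: "interval_assignment Dp I"
      and J: "interval_assignment (diagram_inv Dn) J" and lin: "\<And>e. e \<in> set (bot_path Dp) \<Longrightarrow> maps_linearly f (I e) (J e)"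
    using D(2) unfolding corresponds_def by blast
  \<comment> \<open>Reflecting the lower part makes both parts consist of \<open>\<pi>\<close>-cells with the same bottom path.\<close>
  define E where "E = diagram_inv Dn"
  have dia: "diagram D" "diagram Dp" "diagram E" "pi_only Dp" "pi_only E" and comp: "composable_diagrams Dp Dn"
      and Deq: "D = diagram_comp Dp Dn"
    using cut D(1) unfolding cut_diagram_def diagram_in_F_def E_def pi_only_def by (auto intro: diagram.diagram_inv)
  have tops: "length (top_path Dp) = 1" "length (top_path E) = 1"
    using D(1) unfolding diagram_in_F_def Deq E_def by simp_all
  have mid: "bot_path E = bot_path Dp" using comp unfolding composable_diagrams_def E_def by simp
  have basep: "diagram_base Dp" and baseE: "diagram_base E" and "diagram_base Dn"
    using diagram_invariants dia cut unfolding cut_diagram_def by blast+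
  then have init: "init_vert E = init_vert Dp"
    using composable_ends[OF basep _ comp] base_ends_inv[of Dn] unfolding E_def by simp
  obtain A where A: "\<And>v e. v \<in> inner_verts D \<Longrightarrow> topmost_incoming D v e \<Longrightarrow> source e \<in> A \<longleftrightarrow> v \<notin> A"
      "\<And>v e. v \<in> inner_verts D \<Longrightarrow> bottommost_incoming D v e \<Longrightarrow> source e \<in> A \<longleftrightarrow> v \<notin> A"
    using bipartite_flip[OF D(3)] by blast
  have flip_p: "source a \<in> A \<longleftrightarrow> target a \<notin> A" if "([e], [a, b]) \<in> cells Dp" for e a b
  proof -
    have c: "([e], [a, b]) \<in> cells D" using that unfolding Deq by simp
    then show ?thesis using A(1)[OF left_edge_inner[OF dia(1) c]] topmost_left_edge[OF dia(1) c] by blast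
  qed
  have flip_n: "source a \<in> A \<longleftrightarrow> target a \<notin> A" if "([e], [a, b]) \<in> cells E" for e a b
  proof -
    have c: "([a, b], [e]) \<in> cells D" using that unfolding Deq E_def by simp
    then have c': "([e], [a, b]) \<in> cells (diagram_inv D)" by simp
    have "target a \<in> inner_verts D"
      using left_edge_inner[OF diagram.diagram_inv[OF dia(1)] c'] inner_verts_inv[OF dia(1)] by simp
    then show ?thesis using A(2) bottommost_left_edge[OF dia(1) c] by blast
  qed
  have Ie: "\<exists>k a. I e = adic_interval 2 k a \<and> (odd_ones a \<longleftrightarrow> (source e \<in> A \<longleftrightarrow> init_vert Dp \<notin> A))"
    if "e \<in> set (bot_path Dp)" for e
    using that basep by (intro pi_cells_assign_parity[OF dia(2,4) I tops(1) flip_p]) (auto simp: diagram_base_def)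
  have Je: "\<exists>k a. J e = adic_interval 2 k a \<and> (odd_ones a \<longleftrightarrow> (source e \<in> A \<longleftrightarrow> init_vert Dp \<notin> A))"
    if "e \<in> set (bot_path Dp)" for e
    using that baseE J unfolding init[symmetric]
    by (intro pi_cells_assign_parity[OF dia(3,5) _ tops(2) flip_n]) (auto simp: diagram_base_def E_def[symmetric] mid[symmetric])
  have ch: "chain 0 1 (map K (bot_path X))" if X: "diagram X" "pi_only X" "interval_assignment X K" "length (top_path X) = 1" for X K
  proof -
    obtain e where "top_path X = [e]" using X(4) by (auto simp: length_Suc_conv)
    then have "chain 0 1 (map K (top_path X))" using X(3) by (simp add: interval_assignment_iff)
    then show ?thesis using pi_only_keeps_chains[OF X(1)] X unfolding keeps_chains_def interval_assignment_iff by blast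
  qed
  have "subdivision_map 2 f (map I (bot_path Dp)) (map J (bot_path Dp))"
    unfolding subdivision_map_def
  proof (intro conjI)
    show "chain 0 1 (map I (bot_path Dp))" using ch dia I tops by blast
    show "chain 0 1 (map J (bot_path Dp))" using ch[OF dia(3,5)] J tops unfolding E_def mid[symmetric] by blast
    show "\<forall>X\<in>set (map I (bot_path Dp)). is_adic 2 X" using Ie unfolding is_adic_def by force
    show "\<forall>X\<in>set (map J (bot_path Dp)). is_adic 2 X" using Je unfolding is_adic_def by force
    show "list_all2 (maps_linearly f) (map I (bot_path Dp)) (map J (bot_path Dp))"
      using lin by (simp add: list_all2_conv_all_nth)
  qed
  moreover have "parities (map I (bot_path Dp)) = parities (map J (bot_path Dp))"
  proof -
    have "fst (I e) \<in> odd_dyadics \<longleftrightarrow> fst (J e) \<in> odd_dyadics" if e: "e \<in> set (bot_path Dp)" for e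
      using Ie[OF e] Je[OF e] by auto
    then show ?thesis by (simp add: parities_def)
  qed
  ultimately show "f \<in> parity_stabilizer"
    by (rule subdivision_parity_stabilizer[OF thompson_carrierD(1)[OF f]])
qed

section \<open>The diagram of a tree\<close>

text \<open>
  Vertices are numbered along the longest positive path, so a node that covers the leaves $i,
  \dots, j-1$ is an edge from $i$ to $j$. Leaves have the name 0 whatever \<open>nm\<close> is,
  so that the diagrams of two trees with different nonzero \<open>nm\<close> share precisely
  their leaves.
\<close>

definition root_edge :: "nat \<Rightarrow> nat \<Rightarrow> btree \<Rightarrow> edge" where
  "root_edge nm i T = Edge i (if T = Leaf then 0 else nm) (i + leaves T)"

fun tree_diagram :: "nat \<Rightarrow> nat \<Rightarrow> btree \<Rightarrow> prediagram" where
  "tree_diagram nm i Leaf = edge_diagram (root_edge nm i Leaf)"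
| "tree_diagram nm i (Node A B) =
    diagram_comp
      (pi_diagram (root_edge nm i (Node A B)) (root_edge nm i A) (root_edge nm (i + leaves A) B))
      (diagram_sum (tree_diagram nm i A) (tree_diagram nm (i + leaves A) B))"

definition leaf_edge :: "nat \<Rightarrow> edge" where
  "leaf_edge k = Edge k 0 (Suc k)"

lemma root_edge_simps [simp]:
  "source (root_edge nm i T) = i" "target (root_edge nm i T) = i + leaves T"
  by (simp_all add: root_edge_def)

lemma leaves_Node_ge: "leaves A + leaves B \<ge> 2"
  using leaves_pos[of A] leaves_pos[of B] by linarith

lemma tree_diagram_top [simp]: "top_path (tree_diagram nm i T) = [root_edge nm i T]"
  by (cases T) simp_all

lemma tree_diagram_bot [simp]: "bot_path (tree_diagram nm i T) = map leaf_edge [i..<i + leaves T]"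
proof (induction T arbitrary: i)
  case (Node A B)
  have "[i..<i + (leaves A + leaves B)] = [i..<i + leaves A] @ [i + leaves A..<i + leaves A + leaves B]"
    using upt_add_eq_append[of i "i + leaves A" "leaves B"] by (simp add: add.assoc)
  then show ?case using Node by simp
qed (simp add: root_edge_def leaf_edge_def)

lemma root_edge_in_tree_diagram: "root_edge nm i T \<in> edges (tree_diagram nm i T)"
  by (cases T) simp_all

lemma tree_diagram_edges:
  assumes "nm \<noteq> 0" "e \<in> edges (tree_diagram nm i T)"
  shows "i \<le> source e \<and> source e < target e \<and> target e \<le> i + leaves T \<and>
    (if Suc (source e) = target e then name e = 0 else name e = nm)"
  using assms(2)
proof (induction T arbitrary: i)
  case Leaf
  then show ?case by (simp add: root_edge_def)
next
  case (Node A B)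
  have top: "source (root_edge nm i (Node A B)) = i" "target (root_edge nm i (Node A B)) = i + (leaves A + leaves B)"
      "name (root_edge nm i (Node A B)) = nm" by (simp_all add: root_edge_def)
  consider "e = root_edge nm i (Node A B)" | "e \<in> edges (tree_diagram nm i A)" | "e \<in> edges (tree_diagram nm (i + leaves A) B)"
    using Node.prems root_edge_in_tree_diagram by auto
  then show ?case
  proof cases
    case 1
    then show ?thesis using top leaves_Node_ge[of A B] leaves_pos[of A] by simp
  next
    case 2
    from Node.IH(1)[OF this] show ?thesis by auto
  next
    case 3
    from Node.IH(2)[OF this] show ?thesis by auto
  qed
qed

lemma tree_diagram_leaf_edges:
  assumes "nm \<noteq> 0"
  shows "e \<in> edges (tree_diagram nm i T) \<and> name e = 0 \<longleftrightarrow> e \<in> set (map leaf_edge [i..<i + leaves T])"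
proof (induction T arbitrary: i)
  case Leaf
  show ?case by (auto simp: root_edge_def leaf_edge_def)
next
  case (Node A B)
  have "name (root_edge nm i (Node A B)) \<noteq> 0" using assms by (simp add: root_edge_def)
  then have "e \<in> edges (tree_diagram nm i (Node A B)) \<and> name e = 0 \<longleftrightarrow>
      (e \<in> edges (tree_diagram nm i A) \<and> name e = 0) \<or> (e \<in> edges (tree_diagram nm (i + leaves A) B) \<and> name e = 0)"
    using root_edge_in_tree_diagram[of nm i A] root_edge_in_tree_diagram[of nm "i + leaves A" B] by auto
  also have "\<dots> \<longleftrightarrow> e \<in> set (map leaf_edge [i..<i + leaves (Node A B)])"
    unfolding Node.IH set_map set_upt leaves.simps image_iff Bex_def atLeastLessThan_iff
    by (metis (no_types, lifting) add.assoc le_add1 le_trans linorder_not_le trans_less_add1)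
  finally show ?case .
qed

lemma tree_diagram_dverts [simp]:
  assumes "nm \<noteq> 0"
  shows "dverts (tree_diagram nm i T) = {i..i + leaves T}"
proof (rule Set.set_eqI)
  fix v
  have "v \<in> {i..i + leaves T}" if "v \<in> dverts (tree_diagram nm i T)"
    using that tree_diagram_edges[OF assms] unfolding dverts_def by fastforce
  moreover have "v \<in> dverts (tree_diagram nm i T)" if v: "v \<in> {i..i + leaves T}"
  proof (cases "v < i + leaves T")
    case True
    then have "leaf_edge v \<in> edges (tree_diagram nm i T)" using v tree_diagram_leaf_edges[OF assms, of "leaf_edge v" i T] by auto
    from dverts_edge(1)[OF this] show ?thesis by (simp add: leaf_edge_def)
  next
    case False
    then have "v = target (root_edge nm i T)" using v by simp
    then show ?thesis using dverts_edge(2)[OF root_edge_in_tree_diagram] by metis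
  qed
  ultimately show "v \<in> dverts (tree_diagram nm i T) \<longleftrightarrow> v \<in> {i..i + leaves T}" by blast
qed

lemma tree_diagram_ends [simp]: "init_vert (tree_diagram nm i T) = i" "term_vert (tree_diagram nm i T) = i + leaves T"
  by (simp_all add: init_vert_def term_vert_def)

lemma diagram_tree_diagram:
  assumes nm: "nm \<noteq> 0"
  shows "diagram (tree_diagram nm i T)"
proof (induction T arbitrary: i)
  case Leaf
  show ?case by (simp add: root_edge_def diagram_edge)
next
  case (Node A B)
  let ?e = "root_edge nm i (Node A B)" and ?a = "root_edge nm i A" and ?b = "root_edge nm (i + leaves A) B"
  let ?A = "tree_diagram nm i A" and ?B = "tree_diagram nm (i + leaves A) B"
  have "diagram (pi_diagram ?e ?a ?b)"
    using diagram_pi[of i "i + leaves A" "i + leaves A + leaves B"] leaves_pos[of A] leaves_pos[of B]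
    unfolding root_edge_def leaves.simps add.assoc by simp
  moreover have "diagram (diagram_sum ?A ?B)"
    using Node by (intro diagram_sum) (auto simp: summable_diagrams_def nm)
  moreover have "composable_diagrams (pi_diagram ?e ?a ?b) (diagram_sum ?A ?B)"
  proof -
    have "?e \<notin> edges ?A"
      using tree_diagram_edges[OF nm, of ?e i A] leaves_pos[of B] by (auto simp del: leaves_pos)
    moreover have "?e \<notin> edges ?B"
      using tree_diagram_edges[OF nm, of ?e "i + leaves A" B] leaves_pos[of A] by (auto simp del: leaves_pos)
    moreover have "dverts (pi_diagram ?e ?a ?b) = {i, i + leaves A, i + leaves A + leaves B}"
      by (auto simp: dverts_def)
    ultimately show ?thesis
      using root_edge_in_tree_diagram by (auto simp: composable_diagrams_def path_verts_def nm)
  qed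
  ultimately show ?case by (simp add: diagram_comp)
qed

lemma tree_diagram_cells:
  assumes nm: "nm \<noteq> 0" and c: "c \<in> cells (tree_diagram nm i T)"
  shows "\<exists>e a b. c = ([e], [a, b]) \<and> name e = nm \<and> a \<in> edges (tree_diagram nm i T) \<and> b \<in> edges (tree_diagram nm i T)"
  using c
proof (induction T arbitrary: i)
  case (Node A B)
  then consider "c = ([root_edge nm i (Node A B)], [root_edge nm i A, root_edge nm (i + leaves A) B])"
    | "c \<in> cells (tree_diagram nm i A)" | "c \<in> cells (tree_diagram nm (i + leaves A) B)" by auto
  then show ?case
  proof cases
    case 1
    then show ?thesis by (auto simp: root_edge_def)
  next
    case 2
    from Node.IH(1)[OF this] show ?thesis by auto
  next
    case 3
    from Node.IH(2)[OF this] show ?thesis by auto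
  qed
qed auto

lemma tree_diagram_left_edges:
  "i < v \<Longrightarrow> v < i + leaves T \<Longrightarrow> \<exists>e a b. ([e], [a, b]) \<in> cells (tree_diagram nm i T) \<and> target a = v"
proof (induction T arbitrary: i)
  case (Node A B)
  consider "v < i + leaves A" | "v = i + leaves A" | "i + leaves A < v" by linarith
  then show ?case
  proof cases
    case 1
    then show ?thesis using Node.IH(1)[of i] Node.prems by auto
  next
    case 2
    then show ?thesis by (intro exI[of _ "root_edge nm i (Node A B)"] exI[of _ "root_edge nm i A"] exI[of _ "root_edge nm (i + leaves A) B"]) simp
  next
    case 3
    then show ?thesis using Node.IH(2)[of "i + leaves A"] Node.prems by auto
  qed
qed auto

text \<open>
  Numbering the left ends together with the right end of the chain makes vertex \<open>k\<close>
  of the diagram of a tree correspond to point number \<open>k\<close>.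
\<close>

definition division_point :: "(real \<times> real) list \<Rightarrow> real \<Rightarrow> nat \<Rightarrow> real" where
  "division_point xs r k = (if k < length xs then fst (xs ! k) else r)"

lemma division_point_append:
  assumes "chain m r ys" "ys \<noteq> []"
  shows "division_point (xs @ ys) r k = (if k \<le> length xs then division_point xs m k else division_point ys r (k - length xs))"
proof -
  have "fst (ys ! 0) = m" using assms by (cases ys) auto
  then show ?thesis using assms(2) by (auto simp: division_point_def nth_append)
qed

lemma chain_division_point:
  assumes "chain l r xs" "k < length xs"
  shows "xs ! k = (division_point xs r k, division_point xs r (Suc k))"
  using assms
proof (induction xs arbitrary: l k)
  case (Cons I xs)
  show ?case
  proof (cases k)
    case 0
    have "snd I = division_point (I # xs) r (Suc 0)" using Cons.prems by (cases xs) (auto simp: division_point_def)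
    then show ?thesis using 0 by (simp add: division_point_def prod_eq_iff)
  next
    case (Suc j)
    have "division_point (I # xs) r (Suc m) = division_point xs r m" for m by (simp add: division_point_def)
    moreover have "xs ! j = (division_point xs r j, division_point xs r (Suc j))" using Cons.IH[of "snd I" j] Cons.prems Suc by simp
    ultimately show ?thesis by (simp only: Suc nth_Cons_Suc)
  qed
qed simp

definition edge_position :: "(nat \<Rightarrow> real) \<Rightarrow> edge \<Rightarrow> real \<times> real" where
  "edge_position p e = (p (source e), p (target e))"

lemma division_point_subtree_leaves:
  "division_point (subtree_leaves T k a) (snd (adic_interval 2 k a)) 0 = fst (adic_interval 2 k a)"
  "division_point (subtree_leaves T k a) r (leaves T) = r"
  by (simp_all add: division_point_def subtree_leaves_def hd_leaf_intervals flip: hd_conv_nth)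

lemma division_point_tree_leaf_intervals_Node:
  assumes r: "r = snd (adic_interval 2 k a)"
  shows "division_point (subtree_leaves (Node A B) k a) r j =
    (if j \<le> leaves A then division_point (subtree_leaves A (Suc k) (2 * a)) (snd (adic_interval 2 (Suc k) (2 * a))) j
     else division_point (subtree_leaves B (Suc k) (Suc (2 * a))) r (j - leaves A))"
proof -
  have e: "fst (adic_interval 2 (Suc k) (Suc (2 * a))) = snd (adic_interval 2 (Suc k) (2 * a))"
    "snd (adic_interval 2 (Suc k) (Suc (2 * a))) = r"
    unfolding r by (simp_all only: adic_interval_left_half adic_interval_right_half fst_conv snd_conv)
  have "chain (fst (adic_interval 2 (Suc k) (Suc (2 * a)))) (snd (adic_interval 2 (Suc k) (Suc (2 * a)))) (subtree_leaves B (Suc k) (Suc (2 * a)))"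
    unfolding subtree_leaves_def by (rule chain_leaf_intervals, rule adic_interval_less) simp
  then have ch: "chain (snd (adic_interval 2 (Suc k) (2 * a))) r (subtree_leaves B (Suc k) (Suc (2 * a)))" unfolding e .
  have ne: "subtree_leaves B (Suc k) (Suc (2 * a)) \<noteq> []" by (simp add: subtree_leaves_def)
  show ?thesis by (simp only: subtree_leaves_Node division_point_append[OF ch ne] length_subtree_leaves)
qed

text \<open>
  The edge from vertex \<open>u\<close> to vertex \<open>v\<close> is assigned the interval
  between division points \<open>u\<close> and \<open>v\<close> of the subdivision. In this form
  the assignment needs no recursion over the diagram.
\<close>

lemma tree_diagram_positions:
  assumes "\<And>j. j \<le> leaves T \<Longrightarrow> p (i + j) = division_point (subtree_leaves T k a) (snd (adic_interval 2 k a)) j"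
  shows "edge_position p (root_edge nm i T) = adic_interval 2 k a"
    and "([e], [x, y]) \<in> cells (tree_diagram nm i T) \<Longrightarrow>
      \<exists>k a. edge_position p e = adic_interval 2 k a \<and> edge_position p x = adic_interval 2 (Suc k) (2 * a) \<and>
        edge_position p y = adic_interval 2 (Suc k) (Suc (2 * a))"
  using assms
proof (induction T arbitrary: i k a)
  case Leaf
  {
    case 1
    from 1[of 0] 1[of 1] show ?case by (simp add: edge_position_def division_point_def adic_interval_def)
  next
    case 2
    then show ?case by simp
  }
next
  case (Node A B)
  have pA: "p (i + j) = division_point (subtree_leaves A (Suc k) (2 * a)) (snd (adic_interval 2 (Suc k) (2 * a))) j"
    if p: "\<And>j. j \<le> leaves (Node A B) \<Longrightarrow> p (i + j) = division_point (subtree_leaves (Node A B) k a) (snd (adic_interval 2 k a)) j"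
      and j: "j \<le> leaves A" for i k a j
    using p[of j] j unfolding division_point_tree_leaf_intervals_Node[OF refl] by simp
  have pB: "p (i + leaves A + j) = division_point (subtree_leaves B (Suc k) (Suc (2 * a))) (snd (adic_interval 2 (Suc k) (Suc (2 * a)))) j"
    if p: "\<And>j. j \<le> leaves (Node A B) \<Longrightarrow> p (i + j) = division_point (subtree_leaves (Node A B) k a) (snd (adic_interval 2 k a)) j"
      and j: "j \<le> leaves B" for i k a j
  proof (cases "j = 0")
    case True
    have "fst (adic_interval 2 (Suc k) (Suc (2 * a))) = snd (adic_interval 2 (Suc k) (2 * a))"
      by (simp only: adic_interval_left_half adic_interval_right_half fst_conv snd_conv)
    moreover have "p (i + leaves A) = snd (adic_interval 2 (Suc k) (2 * a))"
      using pA[OF p, of "leaves A"] unfolding division_point_subtree_leaves(2) by blast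
    ultimately show ?thesis unfolding True add_0_right division_point_subtree_leaves(1) by simp
  next
    case False
    have "snd (adic_interval 2 (Suc k) (Suc (2 * a))) = snd (adic_interval 2 k a)"
      by (simp only: adic_interval_right_half snd_conv)
    then show ?thesis using False j p[of "leaves A + j"] unfolding division_point_tree_leaf_intervals_Node[OF refl] by (simp add: add.assoc)
  qed
  have root: "edge_position p (root_edge nm i (Node A B)) = adic_interval 2 k a"
    if p: "\<And>j. j \<le> leaves (Node A B) \<Longrightarrow> p (i + j) = division_point (subtree_leaves (Node A B) k a) (snd (adic_interval 2 k a)) j" for i k a
    using p[of 0] p[of "leaves (Node A B)"] unfolding division_point_subtree_leaves edge_position_def root_edge_simps
    by (simp add: prod_eq_iff)
  {
    case 1
    then show ?case by (rule root)
  next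
    case 2
    note p = 2(2)
    from 2(1) consider "e = root_edge nm i (Node A B)" "x = root_edge nm i A" "y = root_edge nm (i + leaves A) B"
      | "([e], [x, y]) \<in> cells (tree_diagram nm i A)" | "([e], [x, y]) \<in> cells (tree_diagram nm (i + leaves A) B)" by auto
    then show ?case
    proof cases
      case 1
      have "edge_position p e = adic_interval 2 k a" unfolding 1 by (rule root[OF p])
      moreover have "edge_position p x = adic_interval 2 (Suc k) (2 * a)" unfolding 1 by (rule Node.IH(1)[OF pA[OF p]])
      moreover have "edge_position p y = adic_interval 2 (Suc k) (Suc (2 * a))" unfolding 1 by (rule Node.IH(3)[OF pB[OF p]])
      ultimately show ?thesis by blast
    next
      case 2
      show ?thesis by (rule Node.IH(2)[OF 2 pA[OF p]])
    next
      case 3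
      show ?thesis by (rule Node.IH(4)[OF 3 pB[OF p]])
    qed
  }
qed

lemma tree_positions:
  defines "P T \<equiv> division_point (leaf_intervals T 0 1) 1"
  shows "edge_position (P T) (root_edge nm 0 T) = (0, 1)"
    and "([e], [x, y]) \<in> cells (tree_diagram nm 0 T) \<Longrightarrow>
      \<exists>k a. edge_position (P T) e = adic_interval 2 k a \<and> edge_position (P T) x = adic_interval 2 (Suc k) (2 * a) \<and>
        edge_position (P T) y = adic_interval 2 (Suc k) (Suc (2 * a))"
proof -
  have p: "P T (0 + j) = division_point (subtree_leaves T 0 0) (snd (adic_interval 2 0 0)) j" for j
    by (simp add: P_def subtree_leaves_unit)
  show "edge_position (P T) (root_edge nm 0 T) = (0, 1)"
    using tree_diagram_positions(1)[OF p, of nm] by (simp add: adic_interval_def)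
  show "\<exists>k a. edge_position (P T) e = adic_interval 2 k a \<and> edge_position (P T) x = adic_interval 2 (Suc k) (2 * a) \<and>
        edge_position (P T) y = adic_interval 2 (Suc k) (Suc (2 * a))" if "([e], [x, y]) \<in> cells (tree_diagram nm 0 T)"
    by (rule tree_diagram_positions(2)[OF p that])
qed

lemma tree_left_edge_parity:
  assumes "([e], [x, y]) \<in> cells (tree_diagram nm 0 T)"
  shows "division_point (leaf_intervals T 0 1) 1 (target x) \<in> odd_dyadics \<longleftrightarrow> division_point (leaf_intervals T 0 1) 1 (source x) \<notin> odd_dyadics"
proof -
  obtain k a where x: "edge_position (division_point (leaf_intervals T 0 1) 1) x = adic_interval 2 (Suc k) (2 * a)"
    using tree_positions(2)[OF assms] by blast
  have "division_point (leaf_intervals T 0 1) 1 (source x) = fst (adic_interval 2 (Suc k) (2 * a))"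
    using arg_cong[OF x, of fst] by (simp add: edge_position_def)
  then have s: "division_point (leaf_intervals T 0 1) 1 (source x) = real (2 * a) / 2 ^ Suc k" by simp
  have "division_point (leaf_intervals T 0 1) 1 (target x) = snd (adic_interval 2 (Suc k) (2 * a))"
    using arg_cong[OF x, of snd] by (simp add: edge_position_def)
  then have t: "division_point (leaf_intervals T 0 1) 1 (target x) = real (Suc (2 * a)) / 2 ^ Suc k" by (simp add: add.commute)
  show ?thesis unfolding s t odd_dyadics_iff by simp
qed

definition tree_pair_diagram :: "btree \<Rightarrow> btree \<Rightarrow> prediagram" where
  "tree_pair_diagram T T' = diagram_comp (tree_diagram 1 0 T) (diagram_inv (tree_diagram 2 0 T'))"

lemma composable_tree_pair:
  assumes "leaves T = leaves T'"
  shows "composable_diagrams (tree_diagram 1 0 T) (diagram_inv (tree_diagram 2 0 T'))"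
proof -
  have n12: "(1::nat) \<noteq> 0" "(2::nat) \<noteq> 0" by simp_all
  let ?L = "set (map leaf_edge [0..<leaves T])"
  have "edges (tree_diagram 1 0 T) \<inter> edges (tree_diagram 2 0 T') = ?L"
  proof (rule Set.set_eqI)
    fix e
    have "name e = 0" if "e \<in> edges (tree_diagram 1 0 T)" "e \<in> edges (tree_diagram 2 0 T')"
      using tree_diagram_edges[OF n12(1) that(1)] tree_diagram_edges[OF n12(2) that(2)] by (auto split: if_splits)
    then show "e \<in> edges (tree_diagram 1 0 T) \<inter> edges (tree_diagram 2 0 T') \<longleftrightarrow> e \<in> ?L"
      using tree_diagram_leaf_edges[OF n12(1), of e 0 T] tree_diagram_leaf_edges[OF n12(2), of e 0 T'] assms by auto
  qed
  moreover have "path_verts (map leaf_edge [0..<leaves T]) = {0..leaves T}"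
  proof -
    have "path_verts (map leaf_edge [0..<leaves T]) = {0..<leaves T} \<union> Suc ` {0..<leaves T}"
      by (auto simp: path_verts_def leaf_edge_def image_image)
    also have "\<dots> = {0..leaves T}" using leaves_pos[of T]
      unfolding image_Suc_atLeastLessThan by (auto simp del: leaves_pos)
    finally show ?thesis .
  qed
  ultimately show ?thesis using assms by (simp add: composable_diagrams_def)
qed

lemma diagram_tree_pair:
  assumes "leaves T = leaves T'"
  shows "diagram (tree_pair_diagram T T')"
  unfolding tree_pair_diagram_def
  by (intro diagram_comp diagram.diagram_inv diagram_tree_diagram composable_tree_pair assms) simp_all

lemma increasing_path_length:
  assumes "successively (\<lambda>d e. target d = source e) p" "p \<noteq> []" "\<And>e. e \<in> set p \<Longrightarrow> source e < target e"
  shows "source (hd p) + length p \<le> target (last p)"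
  using assms
proof (induction p)
  case (Cons e p)
  have e: "source e < target e" using Cons.prems by simp
  show ?case
  proof (cases p)
    case Nil
    then show ?thesis using e by simp
  next
    case (Cons d q)
    then have "source (hd p) + length p \<le> target (last p)" using Cons.IH Cons.prems by auto
    moreover have "target e = source (hd p)" using Cons.prems Cons by simp
    ultimately show ?thesis using e Cons by simp
  qed
qed simp

lemma tree_pair_cut:
  assumes "leaves T = leaves T'"
  shows "cut_diagram (tree_pair_diagram T T') (tree_diagram 1 0 T) (diagram_inv (tree_diagram 2 0 T'))"
proof -
  let ?D = "tree_pair_diagram T T'"
  have n12: "(1::nat) \<noteq> 0" "(2::nat) \<noteq> 0" by simp_all
  have ends: "init_vert ?D = 0" "term_vert ?D = leaves T"
    unfolding tree_pair_diagram_def init_vert_def term_vert_def by simp_all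
  have inc: "source e < target e" if "e \<in> edges ?D" for e
    using that tree_diagram_edges[OF n12(1), of e 0 T] tree_diagram_edges[OF n12(2), of e 0 T'] by (auto simp: tree_pair_diagram_def)
  have "positive_path ?D (map leaf_edge [0..<leaves T])"
  proof -
    have "set (map leaf_edge [0..<leaves T]) \<subseteq> edges ?D"
      using tree_diagram_leaf_edges[OF n12(1), of _ 0 T] by (auto simp: tree_pair_diagram_def)
    moreover have "successively (\<lambda>d e. target d = source e) (map leaf_edge [0..<leaves T])"
      by (simp add: successively_conv_nth leaf_edge_def)
    ultimately show ?thesis
      unfolding positive_path_def ends using leaves_pos[of T]
      by (simp add: hd_map last_map leaf_edge_def last_upt hd_upt)
  qed
  moreover have "length q \<le> leaves T" if "positive_path ?D q" for q
    using that increasing_path_length[of q] inc unfolding positive_path_def ends by fastforce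
  ultimately have "longest_positive_path ?D (bot_path (tree_diagram 1 0 T))"
    unfolding longest_positive_path_def by simp
  moreover have "pi_cell c" if "c \<in> cells (tree_diagram nm 0 S)" "nm \<noteq> 0" for c nm S
    using tree_diagram_cells[OF that(2,1)] by (auto simp: pi_cell_def)
  ultimately show ?thesis
    unfolding cut_diagram_def using composable_tree_pair[OF assms]
    by (simp add: diagram_tree_diagram diagram.diagram_inv) (simp add: tree_pair_diagram_def)
qed

lemma tree_positions_assignment: "interval_assignment (tree_diagram nm 0 T) (edge_position (division_point (leaf_intervals T 0 1) 1))"
  unfolding interval_assignment_def
proof (intro conjI allI impI; (elim conjE)?)
  show "edge_position (division_point (leaf_intervals T 0 1) 1) (hd (top_path (tree_diagram nm 0 T))) = (0, 1)"
    using tree_positions(1)[of T nm] by simp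
next
  fix e a b l r
  assume c: "([e], [a, b]) \<in> cells (tree_diagram nm 0 T)" and lr: "edge_position (division_point (leaf_intervals T 0 1) 1) e = (l, r)"
  obtain k d where kd: "(l, r) = adic_interval 2 k d" "edge_position (division_point (leaf_intervals T 0 1) 1) a = adic_interval 2 (Suc k) (2 * d)"
      "edge_position (division_point (leaf_intervals T 0 1) 1) b = adic_interval 2 (Suc k) (Suc (2 * d))"
    using tree_positions(2)[OF c] lr by auto
  then show "edge_position (division_point (leaf_intervals T 0 1) 1) a = (l, (l + r) / 2)" "edge_position (division_point (leaf_intervals T 0 1) 1) b = ((l + r) / 2, r)"
    unfolding adic_interval_left_half adic_interval_right_half by (simp_all flip: kd(1))
qed

lemma tree_pair_corresponds:
  assumes "tree_map f T T'"
  shows "corresponds (tree_pair_diagram T T') f"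
proof -
  let ?I = "edge_position (division_point (leaf_intervals T 0 1) 1)" and ?J = "edge_position (division_point (leaf_intervals T' 0 1) 1)"
  have len: "leaves T = leaves T'" by (rule tree_map_leaves[OF assms])
  have "maps_linearly f (?I e) (?J e)" if e: "e \<in> set (bot_path (tree_diagram 1 0 T))" for e
  proof -
    obtain k where k: "k < leaves T" "e = leaf_edge k" using e by auto
    then have "?I e = leaf_intervals T 0 1 ! k" "?J e = leaf_intervals T' 0 1 ! k"
      using chain_division_point[OF chain_leaf_intervals, of 0 1 k T] chain_division_point[OF chain_leaf_intervals, of 0 1 k T'] len
      by (simp_all add: edge_position_def leaf_edge_def)
    then show ?thesis using assms k len by (simp add: tree_map_def list_all2_conv_all_nth)
  qed
  then show ?thesis
    unfolding corresponds_def
    using tree_pair_cut[OF len] tree_positions_assignment[of 1 T] tree_positions_assignment[of 2 T'] diagram_inv_inv by metis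
qed

lemma tree_pair_in_F: "leaves T = leaves T' \<Longrightarrow> diagram_in_F (tree_pair_diagram T T')"
  unfolding diagram_in_F_def using diagram_tree_pair by (simp add: tree_pair_diagram_def)

text \<open>
  The colour of a vertex is the parity of its division point, which by assumption may be
  computed in either tree.
\<close>

lemma tree_pair_bipartite:
  assumes len: "leaves T = leaves T'" and par: "parities (leaf_intervals T 0 1) = parities (leaf_intervals T' 0 1)"
  shows "bipartite (thompson_graph (tree_pair_diagram T T'))"
proof -
  let ?D = "tree_pair_diagram T T'" and ?n = "leaves T"
  let ?p = "division_point (leaf_intervals T 0 1) 1" and ?p' = "division_point (leaf_intervals T' 0 1) 1"
  have n12: "(1::nat) \<noteq> 0" "(2::nat) \<noteq> 0" by simp_all
  have dia: "diagram ?D" by (rule diagram_tree_pair[OF len])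
  have ends: "init_vert ?D = 0" "term_vert ?D = ?n" "dverts ?D = {0..?n}"
    using len unfolding tree_pair_diagram_def init_vert_def term_vert_def by simp_all
  have eq: "?p v \<in> odd_dyadics \<longleftrightarrow> ?p' v \<in> odd_dyadics" if "v < ?n" for v
    using arg_cong[OF par, of "\<lambda>ps. ps ! v"] that len by (simp add: parities_def division_point_def)
  define A where "A = {v. v < ?n \<and> ?p v \<in> odd_dyadics}"
  have inner: "0 < v \<and> v < ?n" if "v \<in> inner_verts ?D" for v
    using that unfolding inner_verts_def ends by auto
  have tgt: "source a < target a" if "a \<in> edges ?D" for a
    using that tree_diagram_edges[OF n12(1), of a 0 T] tree_diagram_edges[OF n12(2), of a 0 T'] by (auto simp: tree_pair_diagram_def)
  have upper: "source e < ?n \<and> (source e \<in> A \<longleftrightarrow> v \<notin> A)" if v: "v \<in> inner_verts ?D" and e: "topmost_incoming ?D v e" for v e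
  proof -
    obtain e0 a b where c: "([e0], [a, b]) \<in> cells (tree_diagram 1 0 T)" "target a = v"
      using tree_diagram_left_edges[of 0 v T 1] inner[OF v] by auto
    then have "([e0], [a, b]) \<in> cells ?D" by (simp add: tree_pair_diagram_def)
    then have "e = a" using topmost_left_edge[OF dia] e c(2) by blast
    moreover have "source e < target e" using tgt[of e] e by (auto simp: topmost_incoming_def incoming_def)
    moreover have "target e = v" using e by (simp add: topmost_incoming_def incoming_def)
    ultimately show ?thesis using tree_left_edge_parity[OF c(1)] inner[OF v] by (auto simp: A_def)
  qed
  have lower: "source e < ?n \<and> (source e \<in> A \<longleftrightarrow> v \<notin> A)" if v: "v \<in> inner_verts ?D" and e: "bottommost_incoming ?D v e" for v e
  proof -
    obtain e0 a b where c: "([e0], [a, b]) \<in> cells (tree_diagram 2 0 T')" "target a = v"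
      using tree_diagram_left_edges[of 0 v T' 2] inner[OF v] len by auto
    then have "([a, b], [e0]) \<in> cells ?D" by (simp add: tree_pair_diagram_def)
    then have "e = a" using bottommost_left_edge[OF dia] e c(2) by blast
    moreover have "source e < target e" using tgt[of e] e by (auto simp: bottommost_incoming_def incoming_def)
    moreover have "target e = v" using e by (simp add: bottommost_incoming_def incoming_def)
    ultimately show ?thesis using tree_left_edge_parity[OF c(1)] inner[OF v] eq by (auto simp: A_def)
  qed
  show ?thesis
    unfolding bipartite_def
  proof (rule exI[of _ A], rule exI[of _ "{0..<?n} - A"], intro conjI ballI)
    show "verts (thompson_graph ?D) = A \<union> ({0..<?n} - A)" by (auto simp: thompson_graph_def ends A_def)
    show "A \<inter> ({0..<?n} - A) = {}" by blast
    fix x assume "x \<in> arcs (thompson_graph ?D)"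
    then obtain s e v where x: "x = (s, e)" "v \<in> inner_verts ?D" "topmost_incoming ?D v e \<or> bottommost_incoming ?D v e"
      by (auto simp: thompson_graph_def)
    then have "target e = v" by (auto simp: topmost_incoming_def bottommost_incoming_def incoming_def)
    then show "tail (thompson_graph ?D) x \<in> A \<and> head (thompson_graph ?D) x \<in> {0..<?n} - A \<or>
        tail (thompson_graph ?D) x \<in> {0..<?n} - A \<and> head (thompson_graph ?D) x \<in> A"
      using x upper[of v e] lower[of v e] inner[of v] by (auto simp: thompson_graph_def)
  qed
qed

text \<open>
  Removing a caret over two adjacent leaves merges the two halves of one interval. The interval
  that is subdivided is arbitrary, because the induction passes to subtrees.
\<close>

lemma tree_diagram_cherry:
  assumes nm: "nm \<noteq> 0" and c: "([e], [leaf_edge k, leaf_edge (Suc k)]) \<in> cells (tree_diagram nm i T)"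
  shows "\<exists>S. leaves S < leaves T \<and> (\<forall>l r. \<exists>xs x y ys. length xs = k - i \<and>
    leaf_intervals T l r = xs @ (x, (x + y) / 2) # ((x + y) / 2, y) # ys \<and> leaf_intervals S l r = xs @ (x, y) # ys)"
  using c
proof (induction T arbitrary: i)
  case (Node A B)
  then consider "leaf_edge k = root_edge nm i A" "leaf_edge (Suc k) = root_edge nm (i + leaves A) B"
    | "([e], [leaf_edge k, leaf_edge (Suc k)]) \<in> cells (tree_diagram nm i A)"
    | "([e], [leaf_edge k, leaf_edge (Suc k)]) \<in> cells (tree_diagram nm (i + leaves A) B)" by auto
  then show ?case
  proof cases
    case 1
    then have "A = Leaf" "B = Leaf" "k = i" using nm by (auto simp: leaf_edge_def root_edge_def split: if_splits)
    then have "leaves Leaf < leaves (Node A B) \<and> length ([] :: (real \<times> real) list) = k - i \<and>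
        leaf_intervals (Node A B) l r = [] @ (l, (l + r) / 2) # ((l + r) / 2, r) # [] \<and> leaf_intervals Leaf l r = [] @ (l, r) # []" for l r
      by simp
    then show ?thesis by blast
  next
    case 2
    obtain S where S: "leaves S < leaves A" "\<And>l r. \<exists>xs x y ys. length xs = k - i \<and>
        leaf_intervals A l r = xs @ (x, (x + y) / 2) # ((x + y) / 2, y) # ys \<and> leaf_intervals S l r = xs @ (x, y) # ys"
      using Node.IH(1)[OF 2] by blast
    have "\<exists>xs x y ys. length xs = k - i \<and> leaf_intervals (Node A B) l r = xs @ (x, (x + y) / 2) # ((x + y) / 2, y) # ys \<and>
        leaf_intervals (Node S B) l r = xs @ (x, y) # ys" for l r
    proof -
      obtain xs x y ys where "length xs = k - i" "leaf_intervals A l ((l + r) / 2) = xs @ (x, (x + y) / 2) # ((x + y) / 2, y) # ys"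
          "leaf_intervals S l ((l + r) / 2) = xs @ (x, y) # ys" using S(2) by blast
      then show ?thesis by (intro exI[of _ xs] exI[of _ x] exI[of _ y] exI[of _ "ys @ leaf_intervals B ((l + r) / 2) r"]) simp
    qed
    moreover have "leaves (Node S B) < leaves (Node A B)" using S(1) by simp
    ultimately show ?thesis by blast
  next
    case 3
    obtain S where S: "leaves S < leaves B" "\<And>l r. \<exists>xs x y ys. length xs = k - (i + leaves A) \<and>
        leaf_intervals B l r = xs @ (x, (x + y) / 2) # ((x + y) / 2, y) # ys \<and> leaf_intervals S l r = xs @ (x, y) # ys"
      using Node.IH(2)[OF 3] by blast
    have "leaf_edge k \<in> edges (tree_diagram nm (i + leaves A) B)" using tree_diagram_cells[OF nm 3] by auto
    then have ki: "i + leaves A \<le> k" using tree_diagram_edges[OF nm] by (fastforce simp: leaf_edge_def)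
    have "\<exists>xs x y ys. length xs = k - i \<and> leaf_intervals (Node A B) l r = xs @ (x, (x + y) / 2) # ((x + y) / 2, y) # ys \<and>
        leaf_intervals (Node A S) l r = xs @ (x, y) # ys" for l r
    proof -
      obtain xs x y ys where "length xs = k - (i + leaves A)" "leaf_intervals B ((l + r) / 2) r = xs @ (x, (x + y) / 2) # ((x + y) / 2, y) # ys"
          "leaf_intervals S ((l + r) / 2) r = xs @ (x, y) # ys" using S(2) by blast
      then show ?thesis using ki
        by (intro exI[of _ "leaf_intervals A l ((l + r) / 2) @ xs"] exI[of _ x] exI[of _ y] exI[of _ ys]) simp
    qed
    moreover have "leaves (Node A S) < leaves (Node A B)" using S(1) by simp
    ultimately show ?thesis by blast
  qed
qed auto

text \<open>
  The names of the edges rule out all dipoles except those on the common leaves: a $\pi$-cell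
  and a $\pi^{-1}$-cell on leaves $k$ and $k+1$. Then \<open>f\<close> is linear with the same
  slope on both leaves, because in both trees these are the halves of one interval, and the two
  carets can be removed.
\<close>

lemma tree_pair_reduce:
  assumes f: "tree_map f T T'" and nr: "\<not> reduced (tree_pair_diagram T T')"
  shows "\<exists>S S'. tree_map f S S' \<and> leaves S < leaves T"
proof -
  let ?E = "tree_diagram 1 0 T" and ?E' = "tree_diagram 2 0 T'"
  have n12: "(1::nat) \<noteq> 0" "(2::nat) \<noteq> 0" by simp_all
  obtain p q r where pq: "(p, q) \<in> cells ?E \<or> (q, p) \<in> cells ?E'" and qr: "(q, r) \<in> cells ?E \<or> (r, q) \<in> cells ?E'"
    using nr unfolding reduced_def tree_pair_diagram_def by auto
  have E: "\<exists>e a b. p = [e] \<and> q = [a, b] \<and> name e = 1 \<and> a \<in> edges ?E \<and> b \<in> edges ?E" if "(p, q) \<in> cells ?E" for p q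
    using tree_diagram_cells[OF n12(1) that] by auto
  have E': "\<exists>e a b. p = [e] \<and> q = [a, b] \<and> name e = 2 \<and> a \<in> edges ?E' \<and> b \<in> edges ?E'" if "(p, q) \<in> cells ?E'" for p q
    using tree_diagram_cells[OF n12(2) that] by auto
  have "(p, q) \<in> cells ?E \<and> (r, q) \<in> cells ?E'"
    using pq qr E[of p q] E[of q r] E'[of q p] E'[of r q] by fastforce
  then obtain e e' a b where c: "([e], [a, b]) \<in> cells ?E" "([e'], [a, b]) \<in> cells ?E'"
    and ab: "a \<in> edges ?E" "a \<in> edges ?E'" "b \<in> edges ?E" "b \<in> edges ?E'"
    using E[of p q] E'[of r q] by auto
  have leaf: "x = leaf_edge (source x)" if "x \<in> edges ?E" "x \<in> edges ?E'" for x
  proof (cases x)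
    case (Edge u i v)
    then show ?thesis using tree_diagram_edges[OF n12(1) that(1)] tree_diagram_edges[OF n12(2) that(2)]
      by (auto simp: leaf_edge_def split: if_splits)
  qed
  define k where "k = source a"
  have "target a = source b"
    using diagram_invariants[OF diagram_tree_diagram[OF n12(1)], of 0 T] c(1) cell_ok_pi(5) unfolding diagram_base_def by blast
  then have "a = leaf_edge k" "b = leaf_edge (Suc k)"
    using leaf[OF ab(1,2)] leaf[OF ab(3,4)] by (simp_all add: k_def) (metis edge.sel(3) leaf_edge_def)
  then have c': "([e], [leaf_edge k, leaf_edge (Suc k)]) \<in> cells ?E" "([e'], [leaf_edge k, leaf_edge (Suc k)]) \<in> cells ?E'"
    using c by simp_all
  obtain S xs x y ys where S: "leaves S < leaves T" "length xs = k" "leaf_intervals T 0 1 = xs @ (x, (x + y) / 2) # ((x + y) / 2, y) # ys"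
      "leaf_intervals S 0 1 = xs @ (x, y) # ys"
    using tree_diagram_cherry[OF n12(1) c'(1)] by (metis diff_zero)
  obtain S' xs' x' y' ys' where S': "length xs' = k" "leaf_intervals T' 0 1 = xs' @ (x', (x' + y') / 2) # ((x' + y') / 2, y') # ys'"
      "leaf_intervals S' 0 1 = xs' @ (x', y') # ys'"
    using tree_diagram_cherry[OF n12(2) c'(2)] by (metis diff_zero)
  have "x < y" using chain_members(2)[OF chain_leaf_intervals, of 0 1 "(x, y)" S] S by simp
  moreover have "list_all2 (maps_linearly f) xs xs'" "list_all2 (maps_linearly f) ys ys'"
      "maps_linearly f (x, (x + y) / 2) (x', (x' + y') / 2)" "maps_linearly f ((x + y) / 2, y) ((x' + y') / 2, y')"
    using f S S' by (simp_all add: tree_map_def list_all2_append)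
  ultimately have "tree_map f S S'"
    using S(4) S'(3) by (simp add: tree_map_def list_all2_appendI maps_linearly_halves[of x y])
  then show ?thesis using S(1) by blast
qed

lemma reduced_tree_pair_exists:
  "tree_map f T T' \<Longrightarrow> \<exists>S S'. tree_map f S S' \<and> reduced (tree_pair_diagram S S')"
proof (induction "leaves T" arbitrary: T T' rule: less_induct)
  case less
  then show ?case using tree_pair_reduce[OF less.prems] by blast
qed

lemma parity_stabilizer_subset_jones: "parity_stabilizer \<subseteq> jones_subgroup"
proof
  fix f assume f: "f \<in> parity_stabilizer"
  then have car: "f \<in> carrier thompson_F" by (simp add: parity_stabilizer_def)
  obtain T T' where "tree_map f T T'" using thompson_tree_map[OF car] .
  then obtain S S' where S: "tree_map f S S'" "reduced (tree_pair_diagram S S')"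
    using reduced_tree_pair_exists by blast
  have "leaves S = leaves S'" "parities (leaf_intervals S 0 1) = parities (leaf_intervals S' 0 1)"
    using tree_map_leaves[OF S(1)] tree_map_parities[OF f S(1)] by simp_all
  then have "diagram_in_F (tree_pair_diagram S S')" "bipartite (thompson_graph (tree_pair_diagram S S'))"
    using tree_pair_in_F tree_pair_bipartite by simp_all
  then show "f \<in> jones_subgroup"
    unfolding jones_subgroup_def using car S(2) tree_pair_corresponds[OF S(1)] by blast
qed

theorem jones_subgroup_eq: "jones_subgroup = parity_stabilizer"
  using jones_subgroup_stabilizes parity_stabilizer_subset_jones by blast

section \<open>The ternary-to-binary homeomorphism\<close>

text \<open>
  Iterates of the operator that has the map $\varphi$ as its fixed point. They start with the
  identity and increase, since the operator is monotone and its value at the identity is above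
  the identity.
\<close>

fun phi_approx :: "nat \<Rightarrow> real \<Rightarrow> real" where
  "phi_approx 0 x = x"
| "phi_approx (Suc n) x =
    (if x \<le> 1/3 then phi_approx n (3 * x) / 2
     else if x \<le> 2/3 then (2 + phi_approx n (3 * x - 1)) / 4
     else (3 + phi_approx n (3 * x - 2)) / 4)"

lemma phi_approx_bounds:
  "phi_approx n 0 = 0" "phi_approx n 1 = 1"
  "x \<in> {0..1} \<Longrightarrow> phi_approx n x \<in> {0..1}"
  "x \<in> {0..1} \<Longrightarrow> phi_approx n x \<le> phi_approx (Suc n) x"
proof (induction n arbitrary: x)
  case 0
  { case 3 then show ?case by simp
  next case 4 then show ?case by (auto simp: field_simps) }
next
  case (Suc n)
  { case 1 show ?case using Suc.IH(1) by simp
  next case 2 show ?case using Suc.IH(2) by simp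
  next case 3
    then show ?case using Suc.IH(3)[of "3 * x"] Suc.IH(3)[of "3 * x - 1"] Suc.IH(3)[of "3 * x - 2"] by auto
  next case 4
    consider "x \<le> 1/3" | "1/3 < x" "x \<le> 2/3" | "2/3 < x" by linarith
    then show ?case
    proof cases
      case 1
      then show ?thesis using Suc.IH(4)[of "3 * x"] 4 by (simp only: phi_approx.simps(2) if_True) simp
    next
      case 2
      then show ?thesis
        using Suc.IH(4)[of "3 * x - 1"] 4 unfolding phi_approx.simps(2)[of "Suc n" x] phi_approx.simps(2)[of n x] by simp
    next
      case 3
      then show ?thesis
        using Suc.IH(4)[of "3 * x - 2"] 4 unfolding phi_approx.simps(2)[of "Suc n" x] phi_approx.simps(2)[of n x] by simp
    qed }
qed simp_all

lemma phi_approx_mono: "x \<in> {0..1} \<Longrightarrow> y \<in> {0..1} \<Longrightarrow> x \<le> y \<Longrightarrow> phi_approx n x \<le> phi_approx n y"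
proof (induction n arbitrary: x y)
  case (Suc n)
  note b = phi_approx_bounds(3)[of _ n]
  consider "y \<le> 1/3" | "x \<le> 1/3" "1/3 < y" | "1/3 < x" "y \<le> 2/3" | "1/3 < x" "x \<le> 2/3" "2/3 < y" | "2/3 < x"
    by linarith
  then show ?case
  proof cases
    case 1
    then show ?thesis using Suc.IH[of "3 * x" "3 * y"] Suc.prems by simp
  next
    case 2
    then show ?thesis using b[of "3 * x"] b[of "3 * y - 1"] b[of "3 * y - 2"] Suc.prems by auto
  next
    case 3
    then show ?thesis using Suc.IH[of "3 * x - 1" "3 * y - 1"] Suc.prems by simp
  next
    case 4
    then show ?thesis using b[of "3 * x - 1"] b[of "3 * y - 2"] Suc.prems by simp
  next
    case 5
    then show ?thesis using Suc.IH[of "3 * x - 2" "3 * y - 2"] Suc.prems by simp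
  qed
qed simp

definition phi :: "real \<Rightarrow> real" where
  "phi x = lim (\<lambda>n. phi_approx n x)"

lemma phi_limit:
  assumes "x \<in> {0..1}"
  shows "(\<lambda>n. phi_approx n x) \<longlonglongrightarrow> phi x"
proof -
  have "incseq (\<lambda>n. phi_approx n x)" using phi_approx_bounds(4)[OF assms] by (rule incseq_SucI)
  moreover have "\<forall>n. phi_approx n x \<le> 1" using phi_approx_bounds(3)[OF assms] by simp
  ultimately obtain L where "(\<lambda>n. phi_approx n x) \<longlonglongrightarrow> L" by (rule incseq_convergent)
  then show ?thesis unfolding phi_def by (simp add: limI)
qed

lemma phi_0 [simp]: "phi 0 = 0" and phi_1 [simp]: "phi 1 = 1"
  unfolding phi_def phi_approx_bounds(1,2) by (simp_all add: limI)

lemma phi_mono: "x \<in> {0..1} \<Longrightarrow> y \<in> {0..1} \<Longrightarrow> x \<le> y \<Longrightarrow> phi x \<le> phi y"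
  by (rule LIMSEQ_le[OF phi_limit phi_limit]) (use phi_approx_mono in blast)+

lemma phi_unit: "x \<in> {0..1} \<Longrightarrow> phi x \<in> {0..1}"
  using phi_mono[of 0 x] phi_mono[of x 1] by simp

lemma phi_self_similar:
  assumes x: "x \<in> {0..1}"
  shows "phi (x / 3) = phi x / 2" "phi ((1 + x) / 3) = (2 + phi x) / 4" "phi ((2 + x) / 3) = (3 + phi x) / 4"
proof -
  have 1: "phi_approx (Suc n) (x / 3) = phi_approx n x / 2" for n using x by simp
  have 2: "phi_approx (Suc n) ((1 + x) / 3) = (2 + phi_approx n x) / 4" for n
    using x phi_approx_bounds(1,2)[of n] by (cases "x = 0") (simp_all add: field_simps)
  have 3: "phi_approx (Suc n) ((2 + x) / 3) = (3 + phi_approx n x) / 4" for n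
    using x phi_approx_bounds(1,2)[of n] by (cases "x = 0") (simp_all add: field_simps)
  have lim: "phi y = L" if "y \<in> {0..1}" "(\<lambda>n. phi_approx (Suc n) y) \<longlonglongrightarrow> L" for y L
    using LIMSEQ_unique[OF LIMSEQ_Suc[OF phi_limit[OF that(1)]] that(2)] .
  show "phi (x / 3) = phi x / 2"
    by (rule lim, use x in simp) (unfold 1, intro tendsto_intros phi_limit x, simp)
  show "phi ((1 + x) / 3) = (2 + phi x) / 4"
    by (rule lim, use x in simp) (unfold 2, intro tendsto_intros phi_limit x, simp)
  show "phi ((2 + x) / 3) = (3 + phi x) / 4"
    by (rule lim, use x in simp) (unfold 3, intro tendsto_intros phi_limit x, simp)
qed

text \<open>
  Both kinds of intervals are given by words over three letters, which are written with the
  ternary digits 0, 1, 2 and with the binary code words 0, 10, 11. The map $\varphi$ translates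
  one notation into the other, and the predicate relates intervals with the same word.
\<close>

definition cylinder :: "nat \<Rightarrow> nat \<Rightarrow> nat \<Rightarrow> nat \<Rightarrow> bool" where
  "cylinder k t m a \<longleftrightarrow> t < 3 ^ k \<and> a < 2 ^ m \<and> (odd_ones a \<longleftrightarrow> odd t) \<and>
     (\<forall>x\<in>{0..1}. phi ((real t + x) / 3 ^ k) = (real a + phi x) / 2 ^ m)"

lemma cylinder_0: "cylinder 0 0 0 0"
  by (simp add: cylinder_def)

text \<open>
  The three thirds of a triadic interval go to the left half and the two quarters of the right
  half. In binary digits, $a$ is followed by 0, 10 or 11; so the parity changes in the middle
  third only, in accordance with $3t, 3t+1, 3t+2$.
\<close>

lemma cylinder_step:
  assumes "cylinder k t m a"
  shows "cylinder (Suc k) (3 * t) (Suc m) (2 * a)"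
    "cylinder (Suc k) (3 * t + 1) (Suc (Suc m)) (2 * Suc (2 * a))"
    "cylinder (Suc k) (3 * t + 2) (Suc (Suc m)) (Suc (2 * Suc (2 * a)))"
proof -
  have c: "t < 3 ^ k" "a < 2 ^ m" "odd_ones a \<longleftrightarrow> odd t"
    using assms unfolding cylinder_def by auto
  have phi: "phi ((real t + x) / 3 ^ k) = (real a + phi x) / 2 ^ m" if "x \<in> {0..1}" for x
    using assms that unfolding cylinder_def by blast
  have scale: "(real (3 * t + d) + x) / 3 ^ Suc k = (real t + (real d + x) / 3) / 3 ^ k" for d x
    by (simp add: field_simps)
  have inner: "(real d + x) / 3 \<in> {0..1}" if "x \<in> {0..1}" "d \<le> 2" for d x
    using that by auto
  have "phi ((real (3 * t + 0) + x) / 3 ^ Suc k) = (real (2 * a) + phi x) / 2 ^ Suc m" if x: "x \<in> {0..1}" for x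
    unfolding scale phi[OF inner[OF x zero_le]] using phi_self_similar(1)[OF x] by (simp add: field_simps)
  then show "cylinder (Suc k) (3 * t) (Suc m) (2 * a)" using c by (simp add: cylinder_def)
  have "phi ((real (3 * t + 1) + x) / 3 ^ Suc k) = (real (2 * Suc (2 * a)) + phi x) / 2 ^ Suc (Suc m)"
    if x: "x \<in> {0..1}" for x
    unfolding scale using phi[OF inner[OF x, of 1]] phi_self_similar(2)[OF x] by (simp add: field_simps)
  then show "cylinder (Suc k) (3 * t + 1) (Suc (Suc m)) (2 * Suc (2 * a))"
    using c unfolding cylinder_def by (simp del: mult_Suc_right)
  have "phi ((real (3 * t + 2) + x) / 3 ^ Suc k) = (real (Suc (2 * Suc (2 * a))) + phi x) / 2 ^ Suc (Suc m)"
    if x: "x \<in> {0..1}" for x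
    unfolding scale using phi[OF inner[OF x, of 2]] phi_self_similar(3)[OF x] by (simp add: field_simps)
  moreover have "Suc (2 * Suc (2 * a)) < 2 ^ Suc (Suc m)" using c(2) by simp
  ultimately show "cylinder (Suc k) (3 * t + 2) (Suc (Suc m)) (Suc (2 * Suc (2 * a)))"
    using c unfolding cylinder_def by (simp del: mult_Suc_right)
qed

lemma triadic_cylinder: "t < 3 ^ k \<Longrightarrow> \<exists>m\<ge>k. \<exists>a. cylinder k t m a"
proof (induction k arbitrary: t)
  case 0
  then show ?case using cylinder_0 by auto
next
  case (Suc k)
  define s d where "s = t div 3" and "d = t mod 3"
  have t: "t = 3 * s + d" "d < 3" by (simp_all add: s_def d_def)
  then have "s < 3 ^ k" using Suc.prems by simp
  then obtain m a where m: "m \<ge> k" "cylinder k s m a" using Suc.IH by blast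
  consider "d = 0" | "d = 1" | "d = 2" using t(2) by linarith
  then show ?case
  proof cases
    case 1
    then show ?thesis using cylinder_step(1)[OF m(2)] t m(1) by (metis Suc_le_mono add_0_right)
  next
    case 2
    then show ?thesis using cylinder_step(2)[OF m(2)] t m(1) by (metis Suc_le_mono le_SucI)
  next
    case 3
    then show ?thesis using cylinder_step(3)[OF m(2)] t m(1) by (metis Suc_le_mono le_SucI)
  qed
qed

text \<open>
  Reading the binary digits of \<open>a\<close> as a word over the code 0, 10, 11 leaves either
  nothing or a single digit 1 at the end.
\<close>

lemma dyadic_cylinder:
  "a < 2 ^ m \<Longrightarrow> (\<exists>k t. cylinder k t m a) \<or> (\<exists>l c k t. m = Suc l \<and> a = Suc (2 * c) \<and> cylinder k t l c)"
proof (induction m arbitrary: a)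
  case 0
  then show ?case using cylinder_0 by auto
next
  case (Suc m)
  obtain c where c: "a = 2 * c \<or> a = Suc (2 * c)" by (metis oddE Suc_eq_plus1 evenE)
  then have "c < 2 ^ m" using Suc.prems by auto
  from Suc.IH[OF this] show ?case
  proof (elim disjE exE conjE)
    fix k t assume "cylinder k t m c"
    then show ?thesis using c cylinder_step(1) by blast
  next
    fix l e k t assume "m = Suc l" "c = Suc (2 * e)" "cylinder k t l e"
    then show ?thesis using c cylinder_step(2,3)[of k t l e] by blast
  qed
qed

lemma cylinder_ends:
  assumes "cylinder k t m a"
  shows "phi (real t / 3 ^ k) = real a / 2 ^ m" "phi ((real t + 1) / 3 ^ k) = (real a + 1) / 2 ^ m"
proof -
  have phi: "\<forall>x\<in>{0..1}. phi ((real t + x) / 3 ^ k) = (real a + phi x) / 2 ^ m"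
    using assms unfolding cylinder_def by blast
  show "phi (real t / 3 ^ k) = real a / 2 ^ m" using bspec[OF phi, of 0] by simp
  show "phi ((real t + 1) / 3 ^ k) = (real a + 1) / 2 ^ m" using bspec[OF phi, of 1] by simp
qed

lemma phi_triadic_parity:
  assumes "t \<le> 3 ^ k"
  shows "phi (real t / 3 ^ k) \<in> odd_dyadics \<longleftrightarrow> odd t"
proof (cases "t = 3 ^ k")
  case True
  have "odd_ones 1" by (simp add: odd_ones.simps)
  then have "1 \<in> odd_dyadics" using odd_dyadics_iff[of 1 0] by simp
  then show ?thesis using True by simp
next
  case False
  then have "t < 3 ^ k" using assms by simp
  then obtain m a where c: "cylinder k t m a" using triadic_cylinder by blast
  then show ?thesis unfolding cylinder_ends(1)[OF c] odd_dyadics_iff by (simp add: cylinder_def)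
qed

lemma phi_strict_mono: "strict_mono_on {0..1} phi"
proof (rule strict_mono_onI)
  fix x y :: real assume xy: "x \<in> {0..1}" "y \<in> {0..1}" "x < y"
  obtain k where "2 / (y - x) < 3 ^ k" using real_arch_pow[of 3 "2 / (y - x)"] by auto
  then have k: "2 < y * 3 ^ k - x * 3 ^ k" using xy by (simp add: field_simps)
  \<comment> \<open>A whole triadic interval between \<open>x\<close> and \<open>y\<close>; its image has positive length.\<close>
  define t where "t = nat \<lceil>x * 3 ^ k\<rceil>"
  have "0 \<le> x * 3 ^ k" using xy by simp
  then have t: "x * 3 ^ k \<le> real t" "real t \<le> x * 3 ^ k + 1" unfolding t_def by linarith+
  have "y * 3 ^ k \<le> 1 * 3 ^ k" using xy by (intro mult_right_mono) auto
  then have t': "real t + 1 \<le> y * 3 ^ k" "real t + 1 \<le> 3 ^ k" "real t < 3 ^ k" using t k by linarith+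
  then have "real t < real (3 ^ k)" by simp
  then have "t < 3 ^ k" by (simp only: of_nat_less_iff)
  then obtain m a where c: "cylinder k t m a" using triadic_cylinder by blast
  have in01: "real t / 3 ^ k \<in> {0..1}" "(real t + 1) / 3 ^ k \<in> {0..1}" "x \<le> real t / 3 ^ k" "(real t + 1) / 3 ^ k \<le> y"
    using t(1) t' by (simp_all add: field_simps)
  have "phi x \<le> phi (real t / 3 ^ k)" using phi_mono xy in01 by blast
  also have "\<dots> < phi ((real t + 1) / 3 ^ k)" unfolding cylinder_ends[OF c] by (simp add: divide_strict_right_mono)
  also have "\<dots> \<le> phi y" using phi_mono xy in01 by blast
  finally show "phi x < phi y" .
qed

lemma dyadic_in_phi_range:
  assumes "a < 2 ^ m"
  shows "\<exists>x\<in>{0..1}. phi x = real a / 2 ^ m"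
  using dyadic_cylinder[OF assms]
proof (elim disjE exE conjE)
  fix k t assume c: "cylinder k t m a"
  then have "real t < real (3 ^ k)" unfolding cylinder_def by (simp only: of_nat_less_iff)
  then have "real t / 3 ^ k \<in> {0..1}" by simp
  then show ?thesis using cylinder_ends(1)[OF c] by blast
next
  fix l d k t assume m: "m = Suc l" "a = Suc (2 * d)" and c: "cylinder k t l d"
  from cylinder_step(2)[OF c] have c': "cylinder (Suc k) (3 * t + 1) (Suc m) (2 * a)" using m by simp
  then have "real (3 * t + 1) < real (3 ^ Suc k)" unfolding cylinder_def by (simp only: of_nat_less_iff)
  then have "real (3 * t + 1) / 3 ^ Suc k \<in> {0..1}" by simp
  moreover have "phi (real (3 * t + 1) / 3 ^ Suc k) = real a / 2 ^ m" using cylinder_ends(1)[OF c'] by simp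
  ultimately show ?thesis by blast
qed

lemma dyadic_between:
  assumes "0 \<le> u" "u < v" "v \<le> (1::real)"
  shows "\<exists>a m. a < 2 ^ m \<and> u < real a / 2 ^ m \<and> real a / 2 ^ m < v"
proof -
  obtain m where "1 / (v - u) < 2 ^ m" using real_arch_pow[of 2 "1 / (v - u)"] by auto
  then have m: "1 < v * 2 ^ m - u * 2 ^ m" using assms by (simp add: field_simps)
  define a where "a = nat (\<lfloor>u * 2 ^ m\<rfloor> + 1)"
  have "0 \<le> u * 2 ^ m" using assms by simp
  then have a: "u * 2 ^ m < real a" "real a \<le> u * 2 ^ m + 1" unfolding a_def by linarith+
  have "v * 2 ^ m \<le> 1 * 2 ^ m" using assms by (intro mult_right_mono) auto
  then have "real a < 2 ^ m" using a m by linarith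
  then have "real a < real (2 ^ m)" by simp
  then have "a < 2 ^ m" by (simp only: of_nat_less_iff)
  moreover have "u < real a / 2 ^ m" "real a / 2 ^ m < v" using a m by (simp_all add: field_simps)
  ultimately show ?thesis by blast
qed

text \<open>
  The range contains all dyadic fractions of the unit interval, and a monotone function with
  dense range has no jumps.
\<close>

lemma phi_image: "phi ` {0..1} = {0..1}"
proof
  show "phi ` {0..1} \<subseteq> {0..1}" using phi_unit by blast
  show "{0..1} \<subseteq> phi ` {0..1}"
  proof
    fix y :: real assume y: "y \<in> {0..1}"
    define S where "S = {x \<in> {0..1}. phi x \<le> y}"
    define s where "s = Sup S"
    have S0: "0 \<in> S" using y by (simp add: S_def)
    have bdd: "bdd_above S" unfolding S_def by (rule bdd_aboveI[of _ 1]) simp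
    have up: "x \<le> s" if "x \<in> S" for x unfolding s_def using that bdd by (rule cSup_upper)
    have "s \<le> 1" unfolding s_def by (intro cSup_least) (use S0 in blast, simp add: S_def)
    then have s: "s \<in> {0..1}" using up[OF S0] by simp
    have "\<not> phi s < y"
    proof
      assume lt: "phi s < y"
      obtain a m where am: "a < 2 ^ m" "phi s < real a / 2 ^ m" "real a / 2 ^ m < y"
        using dyadic_between[of "phi s" y] lt y phi_unit[OF s] by auto
      obtain x where x: "x \<in> {0..1}" "phi x = real a / 2 ^ m" using dyadic_in_phi_range[OF am(1)] by blast
      then have "x \<in> S" using am by (simp add: S_def)
      then have "phi x \<le> phi s" using phi_mono[OF x(1) s up] by blast
      then show False using am x by simp
    qed
    moreover have "\<not> y < phi s"
    proof
      assume lt: "y < phi s"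
      obtain a m where am: "a < 2 ^ m" "y < real a / 2 ^ m" "real a / 2 ^ m < phi s"
        using dyadic_between[of y "phi s"] lt y phi_unit[OF s] by auto
      obtain x where x: "x \<in> {0..1}" "phi x = real a / 2 ^ m" using dyadic_in_phi_range[OF am(1)] by blast
      have "z \<le> x" if "z \<in> S" for z
        using that phi_mono[OF x(1), of z] am x unfolding S_def by fastforce
      then have "s \<le> x" unfolding s_def using S0 by (intro cSup_least) auto
      then have "phi s \<le> phi x" using phi_mono[OF s x(1)] by blast
      then show False using am x by simp
    qed
    ultimately have "phi s = y" by simp
    then show "y \<in> phi ` {0..1}" using s by blast
  qed
qed

definition psi :: "real \<Rightarrow> real" where
  "psi = inv_into {0..1} phi"

lemma phi_inj: "inj_on phi {0..1}"
  using phi_strict_mono by (rule strict_mono_on_imp_inj_on)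

lemma psi_phi: "x \<in> {0..1} \<Longrightarrow> psi (phi x) = x"
  unfolding psi_def using phi_inj by (rule inv_into_f_f)

lemma phi_psi: "y \<in> {0..1} \<Longrightarrow> phi (psi y) = y"
  unfolding psi_def using phi_image by (intro f_inv_into_f) simp

lemma psi_unit: "y \<in> {0..1} \<Longrightarrow> psi y \<in> {0..1}"
  unfolding psi_def using phi_image inv_into_into[of y phi "{0..1}"] by simp

lemma psi_strict_mono: "strict_mono_on {0..1} psi"
proof (rule strict_mono_onI)
  fix x y :: real assume xy: "x \<in> {0..1}" "y \<in> {0..1}" "x < y"
  show "psi x < psi y"
  proof (rule ccontr)
    assume "\<not> psi x < psi y"
    then have "phi (psi y) \<le> phi (psi x)" using phi_mono psi_unit xy by auto
    then show False using xy phi_psi by simp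
  qed
qed

section \<open>The stabilizer as a copy of $F_3$\<close>

text \<open>
  Expanding a fraction by a power of 3 keeps the parity of the numerator.
\<close>

lemma triadic_odd_eq:
  assumes "real a / 3 ^ k = real b / 3 ^ j"
  shows "odd a \<longleftrightarrow> odd b"
proof -
  have "real (a * 3 ^ j) = real (b * 3 ^ k)" using assms by (simp add: field_simps)
  then have "a * 3 ^ j = b * 3 ^ k" by (simp only: of_nat_eq_iff)
  then have "odd (a * 3 ^ j) \<longleftrightarrow> odd (b * 3 ^ k)" by simp
  then show ?thesis by simp
qed

text \<open>
  Conjugation by $\varphi$, from $F_3$ to $F$; \<open>to_F3\<close> is the opposite direction.
\<close>

definition to_F :: "(real \<Rightarrow> real) \<Rightarrow> real \<Rightarrow> real" where
  "to_F f = (\<lambda>y\<in>{0..1}. phi (f (psi y)))"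

definition to_F3 :: "(real \<Rightarrow> real) \<Rightarrow> real \<Rightarrow> real" where
  "to_F3 g = (\<lambda>x\<in>{0..1}. psi (g (phi x)))"

lemma cylinder_maps_linearly:
  assumes "cylinder k t m a" "cylinder j b l c" "maps_linearly f (adic_interval 3 k t) (adic_interval 3 j b)"
  shows "maps_linearly (to_F f) (adic_interval 2 m a) (adic_interval 2 l c)"
proof -
  have "to_F f ((real a + z) / 2 ^ m) = (real c + z) / 2 ^ l" if z: "z \<in> {0..1}" for z
  proof -
    define x where "x = psi z"
    have x: "x \<in> {0..1}" "phi x = z" using z psi_unit phi_psi by (simp_all add: x_def)
    have "(real a + z) / 2 ^ m = phi ((real t + x) / 3 ^ k)" using assms(1) x unfolding cylinder_def by auto
    moreover have "(real t + x) / 3 ^ k \<in> {0..1}"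
    proof -
      have "real (Suc t) \<le> real (3 ^ k)" using assms(1) unfolding cylinder_def by (simp only: of_nat_le_iff Suc_le_eq)
      then show ?thesis using x by (simp add: field_simps)
    qed
    ultimately have "to_F f ((real a + z) / 2 ^ m) = phi (f ((real t + x) / 3 ^ k))"
      using phi_unit psi_phi by (simp add: to_F_def)
    also have "f ((real t + x) / 3 ^ k) = (real b + x) / 3 ^ j"
      using assms(3) x maps_linearly_adic[of 3 f k t j b] by simp
    also have "phi \<dots> = (real c + z) / 2 ^ l" using assms(2) x unfolding cylinder_def by auto
    finally show ?thesis .
  qed
  then show ?thesis by (simp add: maps_linearly_adic)
qed

lemma cylinder_interval: "cylinder k t m a \<Longrightarrow> (phi (real t / 3 ^ k), phi ((real t + 1) / 3 ^ k)) = adic_interval 2 m a"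
  using cylinder_ends by (simp add: adic_interval_def)

text \<open>
  Let $f$ map the $i$-th interval of a triadic grid onto $[b_i/3^m, (b_i+1)/3^m]$, with $m$
  depending on $i$. As the images are adjacent, \<open>triadic_odd_eq\<close> shows that
  $b_{i+1}$ and $b_i + 1$ have the same parity, so $b_i$ is odd iff $i$ is.
\<close>

lemma to_F_stabilizer:
  assumes f: "f \<in> carrier (thompson_group 3)"
  shows "to_F f \<in> parity_stabilizer"
proof -
  note fD = thompson_carrierD[OF f]
  obtain N where "\<forall>t<3 ^ N. \<exists>m b. b < 3 ^ m \<and> maps_linearly f (adic_interval 3 N t) (adic_interval 3 m b)"
    using thompson_grid_linear[OF _ f] unfolding grid_linear_def by fastforce
  then obtain ms bs where fb: "\<And>t. t < 3 ^ N \<Longrightarrow> bs t < 3 ^ ms t"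
      and fl: "\<And>t. t < 3 ^ N \<Longrightarrow> maps_linearly f (adic_interval 3 N t) (adic_interval 3 (ms t) (bs t))"
    by metis
  have ends: "f (real t / 3 ^ N) = real (bs t) / 3 ^ ms t" "f ((real t + 1) / 3 ^ N) = (real (bs t) + 1) / 3 ^ ms t"
    if "t < 3 ^ N" for t
    using maps_linearly_ends[OF fl[OF that]] adic_interval_less[of 3] by (simp_all add: divide_strict_right_mono)
  have odd_bs: "odd (bs t) \<longleftrightarrow> odd t" if "t < 3 ^ N" for t
    using that
  proof (induction t)
    case 0
    then have "real (bs 0) / 3 ^ ms 0 = 0" using ends(1)[of 0] fD(4) by simp
    then show ?case by simp
  next
    case (Suc t)
    have "real (Suc (bs t)) / 3 ^ ms t = real (bs (Suc t)) / 3 ^ ms (Suc t)"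
      using ends(2)[of t] ends(1)[of "Suc t"] Suc.prems by (simp add: add.commute)
    then have "odd (Suc (bs t)) \<longleftrightarrow> odd (bs (Suc t))" by (rule triadic_odd_eq)
    then show ?case using Suc by simp
  qed
  define p where "p i = phi (real i / 3 ^ N)" for i
  define q where "q i = phi (f (real i / 3 ^ N))" for i
  let ?xs = "map (\<lambda>i. (p i, p (Suc i))) [0..<3 ^ N]" and ?ys = "map (\<lambda>i. (q i, q (Suc i))) [0..<3 ^ N]"
  have grid: "real i / 3 ^ N \<in> {0..1}" "real (Suc i) / 3 ^ N \<in> {0..1}" "real i / 3 ^ N < real (Suc i) / 3 ^ N" if "i < 3 ^ N" for i
  proof -
    have "real (Suc i) \<le> real (3 ^ N)" using that by (simp only: of_nat_le_iff Suc_le_eq)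
    then show "real i / 3 ^ N \<in> {0..1}" "real (Suc i) / 3 ^ N \<in> {0..1}" using that by simp_all
    show "real i / 3 ^ N < real (Suc i) / 3 ^ N" by (simp add: divide_strict_right_mono)
  qed
  have p_mono: "p i < p (Suc i)" if "i < 3 ^ N" for i
    using strict_mono_onD[OF phi_strict_mono] grid[OF that] unfolding p_def by blast
  have q_mono: "q i < q (Suc i)" if "i < 3 ^ N" for i
  proof -
    have "f (real i / 3 ^ N) < f (real (Suc i) / 3 ^ N)" using strict_mono_onD[OF fD(2)] grid[OF that] by blast
    then show ?thesis
      using strict_mono_onD[OF phi_strict_mono] thompson_maps_unit[OF f] grid[OF that] unfolding q_def by blast
  qed
  have "chain (p 0) (p (3 ^ N)) ?xs" using p_mono by (rule chain_map_upt)
  then have xs: "chain 0 1 ?xs" by (simp add: p_def)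
  have "chain (q 0) (q (3 ^ N)) ?ys" using q_mono by (rule chain_map_upt)
  then have ys: "chain 0 1 ?ys" using fD by (simp add: q_def)
  have main: "is_adic 2 (p i, p (Suc i)) \<and> is_adic 2 (q i, q (Suc i)) \<and> maps_linearly (to_F f) (p i, p (Suc i)) (q i, q (Suc i)) \<and>
      (p i \<in> odd_dyadics \<longleftrightarrow> q i \<in> odd_dyadics)" if i: "i < 3 ^ N" for i
  proof -
    obtain m a where a: "cylinder N i m a" using triadic_cylinder[OF i] by blast
    obtain l c where c: "cylinder (ms i) (bs i) l c" using triadic_cylinder[OF fb[OF i]] by blast
    have P: "(p i, p (Suc i)) = adic_interval 2 m a" using cylinder_interval[OF a] by (simp add: p_def add.commute)
    have "f (real (Suc i) / 3 ^ N) = (real (bs i) + 1) / 3 ^ ms i" using ends(2)[OF i] by (simp add: add.commute)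
    then have Q: "(q i, q (Suc i)) = adic_interval 2 l c"
      using cylinder_interval[OF c] ends(1)[OF i] by (simp add: q_def)
    have "q i \<in> odd_dyadics \<longleftrightarrow> odd (bs i)"
      unfolding q_def ends(1)[OF i] using fb[OF i] by (intro phi_triadic_parity) simp
    moreover have "p i \<in> odd_dyadics \<longleftrightarrow> odd i"
      unfolding p_def using i by (intro phi_triadic_parity) simp
    ultimately show ?thesis unfolding P Q using cylinder_maps_linearly[OF a c fl[OF i]] odd_bs[OF i] by simp
  qed
  have "subdivision_map 2 (to_F f) ?xs ?ys"
    unfolding subdivision_map_def using xs ys main by (auto simp: list_all2_conv_all_nth)
  moreover have "parities ?xs = parities ?ys" using main by (simp add: parities_def)
  ultimately show ?thesis
    by (rule subdivision_parity_stabilizer[rotated]) (simp add: to_F_def)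
qed

text \<open>
  An image of a fine triadic interval under $\varphi$ is mapped by \<open>g\<close> onto a
  dyadic interval whose ends have different parities. The right half of the image of a triadic
  interval is excluded, because its two ends have equal parities. Hence the dyadic interval is
  the image of a triadic interval under $\varphi$.
\<close>

lemma to_F3_thompson:
  assumes g: "g \<in> parity_stabilizer"
  shows "to_F3 g \<in> carrier (thompson_group 3)"
proof (rule thompson_carrierI)
  have car: "g \<in> carrier thompson_F" and par: "\<And>x. x \<in> {0..1} \<Longrightarrow> g x \<in> odd_dyadics \<longleftrightarrow> x \<in> odd_dyadics"
    using g by (simp_all add: parity_stabilizer_def)
  note gD = thompson_carrierD[OF car]
  show "to_F3 g \<in> extensional {0..1}" by (simp add: to_F3_def)
  show "strict_mono_on {0..1} (to_F3 g)"
  proof (rule strict_mono_onI)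
    fix x y :: real assume xy: "x \<in> {0..1}" "y \<in> {0..1}" "x < y"
    have "phi x < phi y" using strict_mono_onD[OF phi_strict_mono xy] .
    then have "g (phi x) < g (phi y)" using strict_mono_onD[OF gD(2)] phi_unit xy by blast
    then have "psi (g (phi x)) < psi (g (phi y))"
      using strict_mono_onD[OF psi_strict_mono] thompson_maps_unit[OF car] phi_unit xy by blast
    then show "to_F3 g x < to_F3 g y" using xy by (simp add: to_F3_def)
  qed
  show "to_F3 g ` {0..1} = {0..1}"
  proof -
    have "psi ` {0..1} = {0..1}"
    proof
      show "psi ` {0..1} \<subseteq> {0..1}" using psi_unit by blast
      show "{0..1} \<subseteq> psi ` {0..1}" using psi_phi phi_unit by (metis image_eqI subsetI)
    qed
    then have "(\<lambda>x. psi (g (phi x))) ` {0..1} = {0..1}" using phi_image gD(3) by (metis image_image)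
    then show ?thesis by (simp add: to_F3_def)
  qed
  obtain N where N: "\<And>k a. k \<ge> N \<Longrightarrow> a < 2 ^ k \<Longrightarrow> \<exists>m b. b < 2 ^ m \<and> maps_linearly g (adic_interval 2 k a) (adic_interval 2 m b)"
    using thompson_grid_linear[OF order_refl car] unfolding grid_linear_def by metis
  show "adic_piecewise_linear 3 (to_F3 g)"
  proof (rule grid_piecewise_linear)
    fix t :: nat assume t: "t < 3 ^ N"
    obtain m a where m: "m \<ge> N" "cylinder N t m a" using triadic_cylinder[OF t] by blast
    then have "a < 2 ^ m" by (simp add: cylinder_def)
    then obtain l b where b: "b < 2 ^ l" "maps_linearly g (adic_interval 2 m a) (adic_interval 2 l b)" using N m by blast
    have gb: "g ((real a + z) / 2 ^ m) = (real b + z) / 2 ^ l" if "z \<in> {0..1}" for z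
      using b(2) that by (simp add: maps_linearly_adic)
    have t01: "real (Suc t) \<le> real (3 ^ N)" using t by (simp only: of_nat_le_iff Suc_le_eq)
    have left: "odd_ones b \<longleftrightarrow> odd t"
    proof -
      have "g (phi (real t / 3 ^ N)) = real b / 2 ^ l" using gb[of 0] cylinder_ends(1)[OF m(2)] by simp
      moreover have "phi (real t / 3 ^ N) \<in> {0..1}" using t01 t by (intro phi_unit) simp
      ultimately show ?thesis using par[of "phi (real t / 3 ^ N)"] phi_triadic_parity[of t N] t by simp
    qed
    have right: "odd_ones (Suc b) \<longleftrightarrow> even t"
    proof -
      have "g (phi (real (Suc t) / 3 ^ N)) = real (Suc b) / 2 ^ l"
        using gb[of 1] cylinder_ends(2)[OF m(2)] by (simp add: add.commute)
      moreover have "phi (real (Suc t) / 3 ^ N) \<in> {0..1}" using t01 by (intro phi_unit) simp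
      ultimately have "real (Suc b) / 2 ^ l \<in> odd_dyadics \<longleftrightarrow> odd (Suc t)"
        using par[of "phi (real (Suc t) / 3 ^ N)"] phi_triadic_parity[of "Suc t" N] t by (simp del: of_nat_Suc odd_dyadics_iff)
      then show ?thesis unfolding odd_dyadics_iff by simp
    qed
    \<comment> \<open>Otherwise the interval is the right half of \<open>c\<close>, whose right end has the parity of \<open>Suc c\<close>.\<close>
    have "\<exists>k s. cylinder k s l b"
    proof (rule ccontr)
      assume "\<nexists>k s. cylinder k s l b"
      then obtain l' c k s where c: "l = Suc l'" "b = Suc (2 * c)" "cylinder k s l' c"
        using dyadic_cylinder[OF b(1)] by blast
      have "odd_ones c \<longleftrightarrow> odd s" "s < 3 ^ k" using c(3) by (simp_all add: cylinder_def)
      moreover have "odd_ones (Suc c) \<longleftrightarrow> odd (Suc s)"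
      proof -
        have "phi (real (Suc s) / 3 ^ k) = real (Suc c) / 2 ^ l'" using cylinder_ends(2)[OF c(3)] by (simp add: add.commute)
        moreover have "phi (real (Suc s) / 3 ^ k) \<in> odd_dyadics \<longleftrightarrow> odd (Suc s)"
          using \<open>s < 3 ^ k\<close> by (intro phi_triadic_parity) simp
        ultimately show ?thesis by (simp only: odd_dyadics_iff)
      qed
      moreover have "Suc b = 2 * Suc c" using c(2) by simp
      ultimately show False using left right c(2) odd_ones_double[of "Suc c"] by (metis odd_ones_Suc_double even_Suc)
    qed
    then obtain k s where c: "cylinder k s l b" by blast
    have "to_F3 g ((real t + x) / 3 ^ N) = (real s + x) / 3 ^ k" if x: "x \<in> {0..1}" for x
    proof -
      have "(real t + x) / 3 ^ N \<in> {0..1}" using t01 x by (simp add: field_simps)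
      then have "to_F3 g ((real t + x) / 3 ^ N) = psi (g (phi ((real t + x) / 3 ^ N)))" by (simp add: to_F3_def)
      also have "phi ((real t + x) / 3 ^ N) = (real a + phi x) / 2 ^ m" using m(2) x by (simp add: cylinder_def)
      also have "g \<dots> = (real b + phi x) / 2 ^ l" using gb phi_unit[OF x] by simp
      also have "\<dots> = phi ((real s + x) / 3 ^ k)" using c x by (simp add: cylinder_def)
      also have "psi \<dots> = (real s + x) / 3 ^ k"
      proof (rule psi_phi)
        have "real (Suc s) \<le> real (3 ^ k)" using c unfolding cylinder_def by (simp only: of_nat_le_iff Suc_le_eq)
        then show "(real s + x) / 3 ^ k \<in> {0..1}" using x by (simp add: field_simps)
      qed
      finally show ?thesis .
    qed
    then have "maps_linearly (to_F3 g) (adic_interval 3 N t) (adic_interval 3 k s)" by (simp add: maps_linearly_adic)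
    then show "\<exists>m b. maps_linearly (to_F3 g) (adic_interval 3 N t) (adic_interval 3 m b)" by blast
  qed simp
qed

lemma to_F3_to_F: "f \<in> carrier (thompson_group 3) \<Longrightarrow> to_F3 (to_F f) = f"
proof (rule extensionalityI)
  assume f: "f \<in> carrier (thompson_group 3)"
  then show "f \<in> extensional {0..1}" by (rule thompson_carrierD)
  fix x :: real assume "x \<in> {0..1}"
  then show "to_F3 (to_F f) x = f x"
    using phi_unit psi_phi thompson_maps_unit[OF f] by (simp add: to_F3_def to_F_def)
qed (simp add: to_F3_def)

lemma to_F_to_F3: "g \<in> carrier thompson_F \<Longrightarrow> to_F (to_F3 g) = g"
proof (rule extensionalityI)
  assume g: "g \<in> carrier thompson_F"
  then show "g \<in> extensional {0..1}" by (rule thompson_carrierD)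
  fix y :: real assume "y \<in> {0..1}"
  then show "to_F (to_F3 g) y = g y"
    using psi_unit phi_psi thompson_maps_unit[OF g] by (simp add: to_F3_def to_F_def)
qed (simp add: to_F_def)

lemma to_F3_mult:
  assumes "g \<in> carrier thompson_F"
  shows "to_F3 (compose {0..1} h g) = compose {0..1} (to_F3 h) (to_F3 g)"
proof (rule extensionalityI)
  fix x :: real assume x: "x \<in> {0..1}"
  then have "g (phi x) \<in> {0..1}" using phi_unit thompson_maps_unit[OF assms] by simp
  then show "to_F3 (compose {0..1} h g) x = compose {0..1} (to_F3 h) (to_F3 g) x"
    using x phi_unit psi_unit phi_psi by (simp add: to_F3_def compose_def)
qed (simp_all add: to_F3_def compose_def)

theorem parity_stabilizer_iso_F3: "thompson_F\<lparr>carrier := parity_stabilizer\<rparr> \<cong> thompson_group 3"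
proof -
  have car: "parity_stabilizer \<subseteq> carrier thompson_F" by (auto simp: parity_stabilizer_def)
  have "to_F3 \<in> hom (thompson_F\<lparr>carrier := parity_stabilizer\<rparr>) (thompson_group 3)"
    using car to_F3_thompson by (auto simp: hom_def to_F3_mult)
  moreover have "bij_betw to_F3 parity_stabilizer (carrier (thompson_group 3))"
    using car to_F3_thompson to_F_stabilizer to_F3_to_F to_F_to_F3
    by (intro bij_betw_byWitness[where f' = to_F]) auto
  ultimately show ?thesis unfolding is_iso_def iso_def by auto
qed

section \<open>Generators, isomorphism type and minimality of Jones' subgroup\<close>

theorem theorem1:
  shows "jones_subgroup =
      generate thompson_F
        {thompson_x 0 \<otimes>\<^bsub>thompson_F\<^esub> thompson_x 1,
         thompson_x 1 \<otimes>\<^bsub>thompson_F\<^esub> thompson_x 2,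
         thompson_x 2 \<otimes>\<^bsub>thompson_F\<^esub> thompson_x 3}
    \<and> thompson_F\<lparr>carrier := jones_subgroup\<rparr> \<cong> thompson_group 3
    \<and> (subgroup jones_subgroup thompson_F
       \<and> thompson_x 0 \<otimes>\<^bsub>thompson_F\<^esub> thompson_x 1 \<in> jones_subgroup
       \<and> sum_closed jones_subgroup
       \<and> (\<forall>H. subgroup H thompson_F
              \<and> thompson_x 0 \<otimes>\<^bsub>thompson_F\<^esub> thompson_x 1 \<in> H
              \<and> sum_closed H
            \<longrightarrow> jones_subgroup \<subseteq> H))"
proof (intro conjI allI impI; (elim conjE)?)
  have gens: "{thompson_x 0 \<cdot> thompson_x 1,
         thompson_x 1 \<cdot> thompson_x 2,
         thompson_x 2 \<cdot> thompson_x 3} = jones_generators"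
    unfolding jones_gen_def by (simp only: numeral_2_eq_2 numeral_3_eq_3 One_nat_def)
  have gen0: "thompson_x 0 \<cdot> thompson_x 1 = jones_gen 0"
    unfolding jones_gen_def by (simp only: One_nat_def)
  show eq: "jones_subgroup = generate thompson_F
        {thompson_x 0 \<cdot> thompson_x 1,
         thompson_x 1 \<cdot> thompson_x 2,
         thompson_x 2 \<cdot> thompson_x 3}"
    unfolding gens jones_subgroup_eq parity_stabilizer_generated jones_generated_def ..
  show "thompson_F\<lparr>carrier := jones_subgroup\<rparr> \<cong> thompson_group 3"
    unfolding jones_subgroup_eq by (rule parity_stabilizer_iso_F3)
  show "subgroup jones_subgroup thompson_F"
    unfolding jones_subgroup_eq by (rule parity_stabilizer_subgroup)
  show "thompson_x 0 \<cdot> thompson_x 1 \<in> jones_subgroup"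
    unfolding gen0 jones_subgroup_eq by (rule jones_gen_stabilizer)
  show "sum_closed jones_subgroup"
    unfolding jones_subgroup_eq sum_closed_def using parity_stabilizer_sum by blast
  fix H assume H: "subgroup H thompson_F" "thompson_x 0 \<cdot> thompson_x 1 \<in> H" "sum_closed H"
  have "thompson_id \<in> H" using subgroup.one_closed[OF H(1)] by simp
  then have "jones_gen i \<in> H" for i
    using H(2,3) unfolding gen0 sum_closed_def by (induction i) (auto simp: jones_gen_Suc)
  then show "jones_subgroup \<subseteq> H"
    unfolding eq gens by (intro group.generate_subgroup_incl[OF group_F _ H(1)]) auto
qed

end
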